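(* Let $n$ be an integer with $2\le n\le 4$, let $f:\mathbb{R}^n\to(0,\infty)$ be an even positive continuous function, let $\mu$ be the measure with density $f$ (with measures of hyperplane sections defined by integrating $f$ over the section), and let $K$ and $L$ be origin-symmetric convex bodies in $\mathbb{R}^n$. Then $$\left|\mu(K)-\mu(L)\right|\le\frac{n}{n-1}\,\max_{\xi\in S^{n-1}}\left|\mu(K\cap\xi^\perp)-\mu(L\cap\xi^\perp)\right|\ \max\left(\mathrm{Vol}_n(K)^{1/n},\,\mathrm{Vol}_n(L)^{1/n}\right).$$
   Context: $S^{n-1}$ is the Euclidean unit sphere in $\mathbb{R}^n$, and for $\xi\in S^{n-1}$, $\xi^\perp=\{x\in\mathbb{R}^n: \langle x,\xi\rangle=0\}$ is the central hyperplane perpendicular to $\xi$. A convex body is a compact convex set having the origin as an interior point; it is origin-symmetric if $K=-K$. $\mathrm{Vol}_n$ is $n$-dimensional Lebesgue measure. For a closed bounded set $B\subset\mathbb{R}^n$, $\mu(B)=\int_B f(x)\,dx$ with $dx$ the Lebesgue measure on $\mathbb{R}^n$; for a closed bounded set $B\subset\xi^\perp$ (a section), $\mu(B)=\int_B f(x)\,dx$ with $dx$ the $(n-1)$-dimensional Lebesgue measure on $\xi^\perp$. *)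

theory Defs
  imports "HOL-Analysis.Analysis"
begin

definition convex_body :: "'a::euclidean_space set \<Rightarrow> bool" where
  "convex_body K \<longleftrightarrow> compact K \<and> convex K \<and> 0 \<in> interior K"

definition origin_symmetric :: "'a::real_vector set \<Rightarrow> bool" where
  "origin_symmetric K \<longleftrightarrow> uminus ` K = K"

definition perp :: "'a::real_inner \<Rightarrow> 'a set" where
  "perp \<xi> = {x. x \<bullet> \<xi> = 0}"

definition orthonormal_basis_of :: "'a::euclidean_space set \<Rightarrow> 'a set \<Rightarrow> bool" where
  "orthonormal_basis_of S B \<longleftrightarrow>
     B \<subseteq> S \<and> pairwise orthogonal B \<and> (\<forall>b\<in>B. norm b = 1) \<and> span B = S"

lemma orthonormal_basis_of_exists:
  assumes "subspace S"
  shows "\<exists>B. orthonormal_basis_of S B"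
  using orthonormal_basis_subspace[OF assms]
  unfolding orthonormal_basis_of_def by metis

lemma orthonormal_basis_of_finite_card:
  assumes "orthonormal_basis_of S B"
  shows "finite B" and "card B = dim S"
proof -
  have "independent B"
    using assms unfolding orthonormal_basis_of_def
    by (intro pairwise_orthogonal_independent) auto
  then show "finite B" "card B = dim S"
    using assms independent_imp_finite dim_span_eq_card_independent
    unfolding orthonormal_basis_of_def by metis+
qed

lemma subspace_perp: "subspace (perp \<xi>)"
  by (auto simp: perp_def subspace_def inner_add_left)

text \<open>
  The \<open>dim S\<close>-dimensional Lebesgue (Borel) measure on a linear subspace \<open>S\<close>, regarded as a
  measure on the ambient space concentrated on \<open>S\<close>: the product of one-dimensional Lebesgue
  measures in the coordinates of an orthonormal basis of \<open>S\<close>, which is how the library builds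
  \<^const>\<open>lborel\<close> from the standard basis. By rotation invariance of Lebesgue measure it does
  not depend on the chosen basis.
\<close>

definition subspace_lborel :: "'a::euclidean_space set \<Rightarrow> 'a measure" where
  "subspace_lborel S =
     (let B = (SOME B. orthonormal_basis_of S B)
      in distr (\<Pi>\<^sub>M b\<in>B. lborel) borel (\<lambda>g. \<Sum>b\<in>B. g b *\<^sub>R b))"

definition body_meas :: "('a::euclidean_space \<Rightarrow> real) \<Rightarrow> 'a set \<Rightarrow> real" where
  "body_meas f B = (LINT x:B|lborel. f x)"

definition section_meas :: "('a::euclidean_space \<Rightarrow> real) \<Rightarrow> 'a \<Rightarrow> 'a set \<Rightarrow> real" where
  "section_meas f \<xi> K = (LINT x:K \<inter> perp \<xi>|subspace_lborel (perp \<xi>). f x)"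

definition section_gap ::
  "('a::euclidean_space \<Rightarrow> real) \<Rightarrow> 'a set \<Rightarrow> 'a set \<Rightarrow> 'a \<Rightarrow> real" where
  "section_gap f K L \<xi> = \<bar>section_meas f \<xi> K - section_meas f \<xi> L\<bar>"

end

theory Submission
  imports Defs "HOL-Probability.Distributions"
begin

text \<open>
  Let \<open>\<rho>\<^sub>K(y)\<close> be the largest \<open>s\<close> with \<open>s y \<in> K\<close>. Away from the origin, \<open>\<rho>\<^sub>K \<ge> 1\<close> holds exactly on \<open>K\<close>, so
  \<open>f (1\<^sub>K - 1\<^sub>L) \<le> f (1\<^sub>K - 1\<^sub>L) \<rho>\<^sub>K\<close> pointwise and \<open>\<mu>(K) - \<mu>(L)\<close> is at most the integral of the right-hand
  side. The key fact is that for \<open>n \<le> 4\<close> a symmetric convex body is an intersection body, in the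
  following dual form (\<open>radial_intersection_body\<close>): if the integrals of \<open>H\<close> over all central hyperplanes are
  \<open>\<le> 0\<close>, then \<open>\<integral> H \<rho>\<^sub>K \<le> 0\<close>. It is applied to \<open>H = f (1\<^sub>K - 1\<^sub>L) - (e/D) 1\<^sub>B\<close>, where \<open>e\<close> is the largest
  section gap, \<open>B\<close> the centred ball with the volume of \<open>K\<close>, and \<open>D\<close> the volume of a central section of \<open>B\<close>.
  There remains \<open>\<integral>\<^sub>B \<rho>\<^sub>K\<close>. As \<open>B\<close> and \<open>K\<close> have equal volume and \<open>\<rho>\<^sub>K \<ge> 1\<close> exactly on \<open>K\<close>, it is at most
  \<open>\<integral>\<^sub>K \<rho>\<^sub>K\<close>, which is \<open>n/(n-1) Vol(K)\<close> by homogeneity; and \<open>Vol(K)/D \<le> Vol(K)\<^sup>1\<^sup>/\<^sup>n\<close> is an inequality between the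
  volumes of the unit balls of dimensions \<open>n\<close> and \<open>n - 1\<close>.

  The intersection-body property is proved without Fourier analysis. The Radon transform over central
  hyperplanes, extended homogeneously, is self-adjoint for Lebesgue measure (\<open>radon_selfadjoint\<close>). Pair \<open>H\<close>
  with a Gaussian times \<open>W(\<xi>)\<close>, the integral over \<open>x \<in> K\<close> of a normal density of width \<open>a\<close> at \<open>\<xi> \<bullet> x\<close>,
  minus the same integral for the width \<open>\<surd>2 a\<close>. Since a symmetric convex body has its largest parallel sections
  through the origin, \<open>W \<ge> 0\<close> (\<open>slab_mono\<close>, from the Prekopa-Leindler inequality). The Radon transform of
  the Gaussian times \<open>W\<close> at \<open>y\<close> is, up to a constant, \<open>1/|y|\<close> times the integral over \<open>x \<in> K\<close> of a kernel
  depending only on the distance \<open>d\<close> of \<open>x\<close> from the line \<open>\<real> y\<close>. The kernel is nonnegative, at most \<open>a\<^sup>2/(2 d\<^sup>3)\<close>, and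
  comparable to \<open>a\<^sup>2/d\<^sup>3\<close> for \<open>d \<ge> a\<close>. Because \<open>d\<^sup>-\<^sup>3\<close> is not integrable near the origin of a space of dimension
  \<open>n - 1 \<le> 3\<close>, the mass near the axis dominates \<open>a\<^sup>2\<close> as \<open>a \<longrightarrow> 0\<close>, whereas the mass at a fixed distance from the axis
  is of order \<open>a\<^sup>2\<close>. After normalization the kernels concentrate on the axis and yield \<open>\<rho>\<^sub>K(y)\<close> in the limit.

  The measure on a hyperplane \<open>u\<^sup>\<bottom>\<close> is the image under the orthogonal projection of Lebesgue measure
  weighted by a normal density in the direction \<open>u\<close> (\<open>perp_lborel_eq_distr\<close>). Hence section integrals are
  integrals over the whole space that depend continuously on \<open>u\<close>, and the maximal section gap is attained.
\<close>

section \<open>Lebesgue measure in orthonormal coordinates\<close>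

lemma nn_integral_lborel_translate:
  fixes f :: "'a::euclidean_space \<Rightarrow> ennreal"
  assumes [measurable]: "f \<in> borel_measurable borel"
  shows "(\<integral>\<^sup>+x. f (c + x) \<partial>lborel) = (\<integral>\<^sup>+x. f x \<partial>lborel)"
proof -
  have "(\<integral>\<^sup>+x. f x \<partial>lborel) = (\<integral>\<^sup>+x. f x \<partial>distr lborel borel ((+) c))"
    by (simp add: lborel_distr_plus)
  also have "\<dots> = (\<integral>\<^sup>+x. f (c + x) \<partial>lborel)"
    by (subst nn_integral_distr) auto
  finally show ?thesis by simp
qed

text \<open>
  Both \<open>|A|\<close> and \<open>|T\<^sup>-\<^sup>1 A|\<close>, multiplied by the volume of the unit ball \<open>B\<close>, equal the double integral of
  \<open>1\<^sub>B(y) 1\<^sub>A(T x + y)\<close>: use translation invariance in \<open>x\<close> for one order of integration and in \<open>y\<close> for the other,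
  and \<open>T B = B\<close>.
\<close>

lemma lborel_distr_orthogonal:
  fixes T :: "'a::euclidean_space \<Rightarrow> 'a"
  assumes T: "orthogonal_transformation T"
  shows "distr lborel borel T = lborel"
proof (rule measure_eqI)
  have lin: "linear T" using T by (rule orthogonal_transformation_linear)
  then have Tm[measurable]: "T \<in> borel \<rightarrow>\<^sub>M borel"
    by (intro borel_measurable_continuous_onI linear_continuous_on) (simp add: linear_conv_bounded_linear)
  fix A assume "A \<in> sets (distr lborel borel T)"
  then have A[measurable]: "A \<in> sets borel" by simp
  define B :: "'a set" where "B = cball 0 1"
  have B[measurable]: "B \<in> sets borel" by (simp add: B_def)
  define \<kappa> where "\<kappa> = emeasure lborel B"
  have \<kappa>: "\<kappa> \<noteq> 0" "\<kappa> \<noteq> \<infinity>"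
    using unit_ball_vol_pos[of "real DIM('a)"] unfolding \<kappa>_def B_def
    by (subst emeasure_cball; simp del: unit_ball_vol_pos add: ennreal_eq_0_iff)+
  have ball: "(\<integral>\<^sup>+x. indicator B (y - T x) \<partial>lborel) = \<kappa>" for y
  proof -
    obtain z where z: "y = T z"
      using orthogonal_transformation_surj[OF T] by (metis surj_def)
    have "indicator B (y - T x) = (indicator B ((- z) + x) :: ennreal)" for x
      using orthogonal_transformation_norm[OF T, of "z - x"] lin
      by (simp add: z B_def indicator_def linear_diff norm_minus_commute)
    then show ?thesis
      using nn_integral_lborel_translate[of "indicator B" "- z"] by (simp add: \<kappa>_def del: add_uminus_conv_diff uminus_add_conv_diff)
  qed
  have "\<kappa> * emeasure (distr lborel borel T) A = (\<integral>\<^sup>+y. indicator B y * (\<integral>\<^sup>+x. indicator A (T x) \<partial>lborel) \<partial>lborel)"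
  proof -
    have "emeasure (distr lborel borel T) A = (\<integral>\<^sup>+x. indicator A x \<partial>distr lborel borel T)"
      by simp
    also have "\<dots> = (\<integral>\<^sup>+x. indicator A (T x) \<partial>lborel)"
      by (rule nn_integral_distr) simp_all
    finally show ?thesis
      by (subst nn_integral_multc) (simp_all add: \<kappa>_def)
  qed
  also have "\<dots> = (\<integral>\<^sup>+y. indicator B y * (\<integral>\<^sup>+x. indicator A (T x + y) \<partial>lborel) \<partial>lborel)"
  proof -
    have "(\<integral>\<^sup>+x. indicator A (T x) \<partial>lborel) = (\<integral>\<^sup>+x. indicator A (T x + y) \<partial>lborel)" for y
    proof -
      obtain z where z: "y = T z"
        using orthogonal_transformation_surj[OF T] by (metis surj_def)
      show ?thesis
        using nn_integral_lborel_translate[of "\<lambda>x. indicator A (T x)" z] lin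
        by (simp add: z linear_add add.commute)
    qed
    then show ?thesis by (auto intro!: nn_integral_cong)
  qed
  also have "\<dots> = (\<integral>\<^sup>+y. (\<integral>\<^sup>+x. indicator B y * indicator A (T x + y) \<partial>lborel) \<partial>lborel)"
    by (simp add: nn_integral_cmult)
  also have "\<dots> = (\<integral>\<^sup>+x. (\<integral>\<^sup>+y. indicator B y * indicator A (T x + y) \<partial>lborel) \<partial>lborel)"
    by (rule lborel_pair.Fubini') simp
  also have "\<dots> = (\<integral>\<^sup>+x. (\<integral>\<^sup>+y. indicator B (y - T x) * indicator A y \<partial>lborel) \<partial>lborel)"
  proof (rule nn_integral_cong)
    fix x
    show "(\<integral>\<^sup>+y. indicator B y * indicator A (T x + y) \<partial>lborel)
        = (\<integral>\<^sup>+y. indicator B (y - T x) * indicator A y \<partial>lborel)"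
      using nn_integral_lborel_translate[of "\<lambda>y. indicator B (y - T x) * indicator A y" "T x"] by simp
  qed
  also have "\<dots> = (\<integral>\<^sup>+y. (\<integral>\<^sup>+x. indicator B (y - T x) * indicator A y \<partial>lborel) \<partial>lborel)"
    by (rule lborel_pair.Fubini') simp
  also have "\<dots> = (\<integral>\<^sup>+y. \<kappa> * indicator A y \<partial>lborel)"
    by (simp add: nn_integral_multc ball)
  also have "\<dots> = \<kappa> * emeasure lborel A"
    by (simp add: nn_integral_cmult)
  finally show "emeasure (distr lborel borel T) A = emeasure lborel A"
    using \<kappa> by (subst (asm) ennreal_mult_cancel_left) auto
qed simp

text \<open>
  With coordinates relabelled by a bijection onto the standard basis the product measure is Lebesgue
  measure, as one sees on boxes; the orthogonal map that takes the standard basis to \<open>E\<close> preserves it.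
\<close>

lemma lborel_eq_orthonormal_basis:
  fixes E :: "'a::euclidean_space set"
  assumes E: "orthonormal_basis_of UNIV E"
  shows "(lborel :: 'a measure) = distr (\<Pi>\<^sub>M e\<in>E. lborel) borel (\<lambda>g. \<Sum>e\<in>E. g e *\<^sub>R e)"
proof -
  interpret product_sigma_finite "\<lambda>_::'a. lborel :: real measure" by standard
  have fin: "finite E" and card: "card E = DIM('a)"
    using orthonormal_basis_of_finite_card[OF E] by auto
  obtain \<phi> where \<phi>: "bij_betw \<phi> E (Basis :: 'a set)"
    using fin card finite_same_card_bij by (metis finite_Basis)
  have orth: "e \<bullet> e' = (if e = e' then 1 else 0)" if "e \<in> E" "e' \<in> E" for e e'
    using E that unfolding orthonormal_basis_of_def pairwise_def orthogonal_def
    by (auto simp: dot_square_norm)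
  define T where "T x = (\<Sum>e\<in>E. (x \<bullet> \<phi> e) *\<^sub>R e)" for x :: 'a
  have lin: "linear T"
    unfolding T_def by (intro linear_compose_sum ballI linearI) (auto simp: algebra_simps inner_simps)
  have T: "orthogonal_transformation T"
    unfolding orthogonal_transformation_def
  proof (intro conjI allI lin)
    fix v w
    have "T v \<bullet> T w = (\<Sum>e\<in>E. (v \<bullet> \<phi> e) * (w \<bullet> \<phi> e))"
      unfolding T_def inner_sum_left inner_sum_right
      using fin by (auto simp: orth if_distrib sum.delta mult.commute cong: if_cong intro!: sum.cong)
    also have "\<dots> = (\<Sum>b\<in>Basis. (v \<bullet> b) * (w \<bullet> b))"
      by (rule sum.reindex_bij_betw[OF \<phi>])
    also have "\<dots> = v \<bullet> w" by (rule euclidean_inner[symmetric])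
    finally show "T v \<bullet> T w = v \<bullet> w" .
  qed
  have Tm[measurable]: "T \<in> borel \<rightarrow>\<^sub>M borel"
    using lin by (intro borel_measurable_continuous_onI linear_continuous_on) (simp add: linear_conv_bounded_linear)
  have \<phi>B: "\<phi> e \<in> Basis" if "e \<in> E" for e using \<phi> that by (auto simp: bij_betw_def)
  have \<phi>inj: "\<phi> e = \<phi> e' \<longleftrightarrow> e = e'" if "e \<in> E" "e' \<in> E" for e e'
    using \<phi> that by (auto simp: bij_betw_def inj_on_def)
  have dot: "(\<Sum>e\<in>E. g e *\<^sub>R \<phi> e) \<bullet> \<phi> e' = g e'" if "e' \<in> E" for g e'
    using that fin by (auto simp: inner_sum_left inner_Basis \<phi>B \<phi>inj if_distrib sum.delta cong: if_cong)
  have "lborel = distr (\<Pi>\<^sub>M e\<in>E. lborel) borel (\<lambda>g. \<Sum>e\<in>E. g e *\<^sub>R \<phi> e)"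
  proof (rule lborel_eqI)
    fix l u :: 'a assume le: "\<And>b. b \<in> Basis \<Longrightarrow> l \<bullet> b \<le> u \<bullet> b"
    have "(\<lambda>g. \<Sum>e\<in>E. g e *\<^sub>R \<phi> e) -` box l u \<inter> space (\<Pi>\<^sub>M e\<in>E. lborel)
        = (\<Pi>\<^sub>E e\<in>E. {l \<bullet> \<phi> e<..<u \<bullet> \<phi> e})"
    proof -
      have "(\<Sum>e\<in>E. g e *\<^sub>R \<phi> e) \<in> box l u \<longleftrightarrow> (\<forall>e\<in>E. g e \<in> {l \<bullet> \<phi> e<..<u \<bullet> \<phi> e})" for g
        unfolding box_def mem_Collect_eq bij_betw_imp_surj_on[OF \<phi>, symmetric] by (simp add: dot)
      then show ?thesis by (auto simp: space_PiM PiE_iff)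
    qed
    then have "emeasure (distr (\<Pi>\<^sub>M e\<in>E. lborel) borel (\<lambda>g. \<Sum>e\<in>E. g e *\<^sub>R \<phi> e)) (box l u)
        = (\<Prod>e\<in>E. ennreal ((u - l) \<bullet> \<phi> e))"
      using le \<phi>B by (subst emeasure_distr) (auto simp: emeasure_PiM fin inner_diff_left intro!: prod.cong)
    also have "\<dots> = (\<Prod>b\<in>Basis. ennreal ((u - l) \<bullet> b))"
      by (rule prod.reindex_bij_betw[OF \<phi>])
    also have "\<dots> = ennreal (\<Prod>b\<in>Basis. (u - l) \<bullet> b)"
      using le by (intro prod_ennreal) (auto simp: inner_diff_left)
    finally show "emeasure (distr (\<Pi>\<^sub>M e\<in>E. lborel) borel (\<lambda>g. \<Sum>e\<in>E. g e *\<^sub>R \<phi> e)) (box l u)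
        = ennreal (\<Prod>b\<in>Basis. (u - l) \<bullet> b)" .
  qed simp
  then have "distr lborel borel T = distr (distr (\<Pi>\<^sub>M e\<in>E. lborel) borel (\<lambda>g. \<Sum>e\<in>E. g e *\<^sub>R \<phi> e)) borel T"
    by simp
  also have "\<dots> = distr (\<Pi>\<^sub>M e\<in>E. lborel) borel (T \<circ> (\<lambda>g. \<Sum>e\<in>E. g e *\<^sub>R \<phi> e))"
    by (rule distr_distr) simp_all
  also have "T \<circ> (\<lambda>g. \<Sum>e\<in>E. g e *\<^sub>R \<phi> e) = (\<lambda>g. \<Sum>e\<in>E. g e *\<^sub>R e)"
    by (auto simp: T_def dot)
  finally show ?thesis by (simp add: lborel_distr_orthogonal[OF T])
qed

definition perp_proj :: "'a::euclidean_space \<Rightarrow> 'a \<Rightarrow> 'a" where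
  "perp_proj u x = x - (x \<bullet> u) *\<^sub>R u"

definition perp_lborel :: "'a::euclidean_space \<Rightarrow> 'a measure" where
  "perp_lborel u = subspace_lborel (perp u)"

lemma sets_perp_lborel[simp, measurable_cong]: "sets (perp_lborel u) = sets borel"
  and space_perp_lborel[simp]: "space (perp_lborel u) = UNIV"
  by (auto simp: perp_lborel_def subspace_lborel_def Let_def)

text \<open>
  The basis hidden in the definition of the hyperplane measure, completed by its normal vector to a basis
  of the whole space.
\<close>

lemma perp_lborel_basis:
  fixes u :: "'a::euclidean_space"
  assumes u: "norm u = 1"
  obtains B where "finite B" "u \<notin> B" "card B = DIM('a) - 1" "orthonormal_basis_of UNIV (insert u B)"
    "\<forall>b\<in>B. b \<bullet> u = 0" "perp_lborel u = distr (\<Pi>\<^sub>M b\<in>B. lborel) borel (\<lambda>g. \<Sum>b\<in>B. g b *\<^sub>R b)"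
proof -
  define B where "B = (SOME B. orthonormal_basis_of (perp u) B)"
  have B: "orthonormal_basis_of (perp u) B"
    unfolding B_def by (rule someI_ex[OF orthonormal_basis_of_exists[OF subspace_perp]])
  have sub: "B \<subseteq> perp u" and sp: "span B = perp u" using B by (auto simp: orthonormal_basis_of_def)
  have uu: "u \<bullet> u = 1" using u by (simp add: dot_square_norm)
  have nin: "u \<notin> B" using sub uu by (auto simp: perp_def)
  have full: "orthonormal_basis_of UNIV (insert u B)"
    unfolding orthonormal_basis_of_def
  proof (intro conjI)
    show "pairwise orthogonal (insert u B)"
      using B sub by (auto simp: orthonormal_basis_of_def pairwise_insert orthogonal_def perp_def inner_commute)
    show "\<forall>b\<in>insert u B. norm b = 1" using B u by (auto simp: orthonormal_basis_of_def)
    show "span (insert u B) = UNIV"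
    proof (intro set_eqI iffI UNIV_I)
      fix x :: 'a
      have "perp_proj u x \<in> span B" unfolding sp perp_def perp_proj_def by (simp add: inner_diff_left uu)
      then show "x \<in> span (insert u B)" unfolding span_insert perp_proj_def by blast
    qed
  qed auto
  have fin: "finite B" using orthonormal_basis_of_finite_card[OF B] by simp
  have "card (insert u B) = DIM('a)" using orthonormal_basis_of_finite_card[OF full] by simp
  then have "card B = DIM('a) - 1" using fin nin by simp
  moreover have "perp_lborel u = distr (\<Pi>\<^sub>M b\<in>B. lborel) borel (\<lambda>g. \<Sum>b\<in>B. g b *\<^sub>R b)"
    by (simp add: perp_lborel_def subspace_lborel_def B_def Let_def)
  ultimately show thesis
    using that[OF fin nin _ full] sub by (auto simp: perp_def)
qed

lemma perp_proj_measurable[measurable]: "perp_proj u \<in> borel \<rightarrow>\<^sub>M borel"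
  unfolding perp_proj_def[abs_def] by simp

text \<open>
  Fubini in an orthonormal basis containing \<open>u\<close>: lines parallel to \<open>u\<close> against the measure on the hyperplane. It
  allows one to work with this measure without the basis chosen in its definition.
\<close>

lemma nn_integral_lborel_perp_lborel:
  fixes u :: "'a::euclidean_space" and F :: "'a \<Rightarrow> ennreal"
  assumes u: "norm u = 1" and F[measurable]: "F \<in> borel_measurable borel"
  shows "(\<integral>\<^sup>+x. F x \<partial>lborel) = (\<integral>\<^sup>+w. (\<integral>\<^sup>+s. F (w + s *\<^sub>R u) \<partial>lborel) \<partial>perp_lborel u)"
proof -
  interpret product_sigma_finite "\<lambda>_::'a. lborel :: real measure" by standard
  obtain B where B: "finite B" "u \<notin> B" "card B = DIM('a) - 1" "orthonormal_basis_of UNIV (insert u B)"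
    and B': "\<forall>b\<in>B. b \<bullet> u = 0" and h: "perp_lborel u = distr (\<Pi>\<^sub>M b\<in>B. lborel) borel (\<lambda>g. \<Sum>b\<in>B. g b *\<^sub>R b)"
    by (rule perp_lborel_basis[OF u]) blast
  have "(\<integral>\<^sup>+x. F x \<partial>lborel) = (\<integral>\<^sup>+g. F (\<Sum>e\<in>insert u B. g e *\<^sub>R e) \<partial>(\<Pi>\<^sub>M e\<in>insert u B. lborel))"
    by (subst lborel_eq_orthonormal_basis[OF B(4)], subst nn_integral_distr) auto
  also have "\<dots> = (\<integral>\<^sup>+g. (\<integral>\<^sup>+s. F (\<Sum>e\<in>insert u B. (g(u := s)) e *\<^sub>R e) \<partial>lborel) \<partial>(\<Pi>\<^sub>M b\<in>B. lborel))"
    using B by (intro product_nn_integral_insert) auto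
  also have "\<dots> = (\<integral>\<^sup>+g. (\<integral>\<^sup>+s. F ((\<Sum>b\<in>B. g b *\<^sub>R b) + s *\<^sub>R u) \<partial>lborel) \<partial>(\<Pi>\<^sub>M b\<in>B. lborel))"
  proof (intro nn_integral_cong arg_cong[where f=F])
    fix g :: "'a \<Rightarrow> real" and s :: real
    have "(\<Sum>b\<in>B. (g(u := s)) b *\<^sub>R b) = (\<Sum>b\<in>B. g b *\<^sub>R b)"
      using B by (intro sum.cong) auto
    then show "(\<Sum>e\<in>insert u B. (g(u := s)) e *\<^sub>R e) = (\<Sum>b\<in>B. g b *\<^sub>R b) + s *\<^sub>R u"
      using B by (simp add: add.commute)
  qed
  also have "\<dots> = (\<integral>\<^sup>+w. (\<integral>\<^sup>+s. F (w + s *\<^sub>R u) \<partial>lborel) \<partial>perp_lborel u)"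
    unfolding h by (subst nn_integral_distr) auto
  finally show ?thesis .
qed

lemma AE_perp_lborel_perp:
  fixes u :: "'a::euclidean_space"
  assumes u: "norm u = 1"
  shows "AE w in perp_lborel u. w \<bullet> u = 0"
proof -
  obtain B where "finite B" "u \<notin> B" "card B = DIM('a) - 1" "orthonormal_basis_of UNIV (insert u B)"
    and B: "\<forall>b\<in>B. b \<bullet> u = 0" and h: "perp_lborel u = distr (\<Pi>\<^sub>M b\<in>B. lborel) borel (\<lambda>g. \<Sum>b\<in>B. g b *\<^sub>R b)"
    by (rule perp_lborel_basis[OF u]) blast
  show ?thesis unfolding h
    by (subst AE_distr_iff) (auto simp: inner_sum_left B)
qed

lemma emeasure_perp_lborel_cball:
  fixes u :: "'a::euclidean_space"
  assumes u: "norm u = 1" and r: "0 < r"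
  shows "emeasure (perp_lborel u) (cball 0 r) = ennreal (unit_ball_vol (DIM('a) - 1) * r ^ (DIM('a) - 1))"
proof -
  obtain B where B: "finite B" "u \<notin> B" "card B = DIM('a) - 1" "orthonormal_basis_of UNIV (insert u B)"
    and B': "\<forall>b\<in>B. b \<bullet> u = 0" and h: "perp_lborel u = distr (\<Pi>\<^sub>M b\<in>B. lborel) borel (\<lambda>g. \<Sum>b\<in>B. g b *\<^sub>R b)"
    by (rule perp_lborel_basis[OF u]) blast
  have orth: "e \<bullet> e' = (if e = e' then 1 else 0)" if "e \<in> B" "e' \<in> B" for e e'
    using B(4) that unfolding orthonormal_basis_of_def pairwise_def orthogonal_def
    by (auto simp: dot_square_norm)
  have nrm: "norm (\<Sum>b\<in>B. g b *\<^sub>R b) = sqrt (\<Sum>b\<in>B. (g b)\<^sup>2)" for g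
    unfolding norm_eq_sqrt_inner inner_sum_left inner_sum_right
    using B(1) by (auto simp: orth if_distrib sum.delta power2_eq_square cong: if_cong intro!: sum.cong arg_cong[where f=sqrt])
  have "(\<lambda>g. \<Sum>b\<in>B. g b *\<^sub>R b) -` cball 0 r \<inter> space (\<Pi>\<^sub>M b\<in>B. lborel)
      = {g. sqrt (\<Sum>b\<in>B. (g b)\<^sup>2) \<le> r} \<inter> space (\<Pi>\<^sub>M b\<in>B. lborel)"
    by (auto simp: nrm)
  then show ?thesis unfolding h
    using emeasure_cball_aux[OF B(1) r] B(3) by (subst emeasure_distr) auto
qed

text \<open>
  Integrating out the direction \<open>u\<close> against a probability density leaves the measure on the hyperplane. The
  normal density is chosen because it turns a Gaussian of the projection into a Gaussian of the whole
  vector (\<open>gauss_perp_proj\<close>).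
\<close>

lemma perp_lborel_eq_distr:
  assumes u: "norm u = 1"
  shows "perp_lborel u = distr (density lborel (\<lambda>x. ennreal (std_normal_density (x \<bullet> u)))) borel (perp_proj u)"
proof (rule measure_eqI)
  fix A assume "A \<in> sets (perp_lborel u)"
  then have [measurable]: "A \<in> sets borel" by simp
  have uu: "u \<bullet> u = 1" using u by (simp add: dot_square_norm)
  let ?D = "distr (density lborel (\<lambda>x. ennreal (std_normal_density (x \<bullet> u)))) borel (perp_proj u)"
  have "emeasure ?D A = (\<integral>\<^sup>+x. indicator A x \<partial>?D)"
    by simp
  also have "\<dots> = (\<integral>\<^sup>+x. ennreal (std_normal_density (x \<bullet> u)) * indicator A (perp_proj u x) \<partial>lborel)"
    by (subst nn_integral_distr, simp, simp, subst nn_integral_density) simp_all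
  also have "\<dots> = (\<integral>\<^sup>+w. (\<integral>\<^sup>+s. ennreal (std_normal_density ((w + s *\<^sub>R u) \<bullet> u)) * indicator A (perp_proj u (w + s *\<^sub>R u)) \<partial>lborel) \<partial>perp_lborel u)"
    by (rule nn_integral_lborel_perp_lborel[OF u]) simp
  also have "\<dots> = (\<integral>\<^sup>+w. (\<integral>\<^sup>+s. ennreal (std_normal_density s) \<partial>lborel) * indicator A w \<partial>perp_lborel u)"
  proof (rule nn_integral_cong_AE, use AE_perp_lborel_perp[OF u] in eventually_elim)
    fix w assume w: "w \<bullet> u = 0"
    have "perp_proj u (w + s *\<^sub>R u) = w" "(w + s *\<^sub>R u) \<bullet> u = s" for s
      by (simp_all add: perp_proj_def inner_add_left w uu)
    then show "(\<integral>\<^sup>+s. ennreal (std_normal_density ((w + s *\<^sub>R u) \<bullet> u)) * indicator A (perp_proj u (w + s *\<^sub>R u)) \<partial>lborel)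
        = (\<integral>\<^sup>+s. ennreal (std_normal_density s) \<partial>lborel) * indicator A w"
      by (simp add: nn_integral_multc)
  qed
  also have "(\<integral>\<^sup>+s. ennreal (std_normal_density s) \<partial>lborel) = 1"
    by (subst nn_integral_eq_integral) auto
  finally show "emeasure (perp_lborel u) A = emeasure ?D A" by simp
qed simp

lemma integral_perp_lborel:
  fixes u :: "'a::euclidean_space" and F :: "'a \<Rightarrow> real"
  assumes u: "norm u = 1" and [measurable]: "F \<in> borel_measurable borel"
  shows "(\<integral>w. F w \<partial>perp_lborel u) = (LBINT x. std_normal_density (x \<bullet> u) * F (perp_proj u x))"
    and "integrable (perp_lborel u) F \<longleftrightarrow> integrable lborel (\<lambda>x. std_normal_density (x \<bullet> u) * F (perp_proj u x))"
  by (simp_all add: perp_lborel_eq_distr[OF u] integral_distr integrable_distr_eq integral_density integrable_density)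

definition stretch :: "'a::euclidean_space \<Rightarrow> real \<Rightarrow> 'a \<Rightarrow> 'a" where
  "stretch u c x = perp_proj u x + (c * (x \<bullet> u)) *\<^sub>R u"

lemma stretch_measurable[measurable]: "stretch u c \<in> borel \<rightarrow>\<^sub>M borel"
  unfolding stretch_def[abs_def] by measurable

lemma distr_stretch:
  assumes u: "norm u = 1" and c: "0 < c"
  shows "distr lborel borel (stretch u c) = density lborel (\<lambda>_. ennreal (1 / c))"
proof (rule measure_eqI)
  fix A assume "A \<in> sets (distr lborel borel (stretch u c))"
  then have [measurable]: "A \<in> sets borel" by simp
  have uu: "u \<bullet> u = 1" using u by (simp add: dot_square_norm)
  have "emeasure (distr lborel borel (stretch u c)) A = (\<integral>\<^sup>+x. indicator A x \<partial>distr lborel borel (stretch u c))"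
    by simp
  also have "\<dots> = (\<integral>\<^sup>+x. indicator A (stretch u c x) \<partial>lborel)"
    by (subst nn_integral_distr) simp_all
  also have "\<dots> = (\<integral>\<^sup>+w. (\<integral>\<^sup>+s. indicator A (stretch u c (w + s *\<^sub>R u)) \<partial>lborel) \<partial>perp_lborel u)"
    by (rule nn_integral_lborel_perp_lborel[OF u]) simp
  also have "\<dots> = (\<integral>\<^sup>+w. ennreal (1 / c) * (\<integral>\<^sup>+s. indicator A (w + s *\<^sub>R u) \<partial>lborel) \<partial>perp_lborel u)"
  proof (rule nn_integral_cong_AE, use AE_perp_lborel_perp[OF u] in eventually_elim)
    fix w assume w: "w \<bullet> u = 0"
    have "stretch u c (w + s *\<^sub>R u) = w + (c * s) *\<^sub>R u" for s
      by (simp add: stretch_def perp_proj_def inner_add_left w uu)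
    then have "(\<integral>\<^sup>+s. indicator A (stretch u c (w + s *\<^sub>R u)) \<partial>lborel) = (\<integral>\<^sup>+s. indicator A (w + (c * s) *\<^sub>R u) \<partial>lborel)"
      by simp
    moreover have "(\<integral>\<^sup>+s. indicator A (w + s *\<^sub>R u) \<partial>lborel) = ennreal c * (\<integral>\<^sup>+s. indicator A (w + (c * s) *\<^sub>R u) \<partial>lborel)"
      using c by (subst nn_integral_real_affine[where c=c and t=0]) auto
    ultimately show "(\<integral>\<^sup>+s. indicator A (stretch u c (w + s *\<^sub>R u)) \<partial>lborel)
        = ennreal (1 / c) * (\<integral>\<^sup>+s. indicator A (w + s *\<^sub>R u) \<partial>lborel)"
      using c by (simp add: mult.assoc[symmetric] ennreal_mult[symmetric])
  qed
  also have "\<dots> = ennreal (1 / c) * (\<integral>\<^sup>+w. (\<integral>\<^sup>+s. indicator A (w + s *\<^sub>R u) \<partial>lborel) \<partial>perp_lborel u)"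
    by (rule nn_integral_cmult) simp
  also have "(\<integral>\<^sup>+w. (\<integral>\<^sup>+s. indicator A (w + s *\<^sub>R u) \<partial>lborel) \<partial>perp_lborel u) = (\<integral>\<^sup>+x. indicator A x \<partial>lborel)"
    by (rule nn_integral_lborel_perp_lborel[OF u, symmetric]) simp
  also have "ennreal (1 / c) * (\<integral>\<^sup>+x. indicator A x \<partial>lborel) = emeasure (density lborel (\<lambda>_. ennreal (1 / c))) A"
    by (simp add: emeasure_density nn_integral_cmult)
  finally show "emeasure (distr lborel borel (stretch u c)) A = emeasure (density lborel (\<lambda>_. ennreal (1 / c))) A" .
qed simp

lemma integral_stretch:
  fixes u :: "'a::euclidean_space" and F :: "'a \<Rightarrow> real"
  assumes u: "norm u = 1" and c: "0 < c" and [measurable]: "F \<in> borel_measurable borel"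
  shows "(LBINT x. F x) = c * (LBINT x. F (stretch u c x))"
proof -
  have "(LBINT x. F (stretch u c x)) = (\<integral>x. F x \<partial>distr lborel borel (stretch u c))"
    by (simp add: integral_distr)
  also have "\<dots> = (1 / c) * (LBINT x. F x)"
    unfolding distr_stretch[OF u c] using c by (simp add: integral_density)
  finally show ?thesis using c by simp
qed

section \<open>Gaussian weights and homogeneous functions\<close>

definition gauss :: "'a::euclidean_space \<Rightarrow> real" where
  "gauss x = exp (- (norm x)\<^sup>2 / 2)"

lemma gauss_measurable[measurable]: "gauss \<in> borel_measurable borel"
  unfolding gauss_def[abs_def] by simp

lemma gauss_pos[simp]: "0 < gauss x" by (simp add: gauss_def)

lemma integrable_gauss: "integrable lborel (gauss :: 'a::euclidean_space \<Rightarrow> real)"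
proof (rule integrableI_nonneg)
  have fin: "(\<integral>\<^sup>+s. ennreal (exp (- s\<^sup>2 / 2)) \<partial>(lborel :: real measure)) < \<infinity>"
  proof -
    have "integrable lborel (\<lambda>s. sqrt (2 * pi) * std_normal_density s)" by simp
    then have "integrable lborel (\<lambda>s::real. exp (- s\<^sup>2 / 2))"
      by (simp add: std_normal_density_def)
    then show ?thesis by (simp add: integrable_iff_bounded)
  qed
  have "gauss x = (\<Prod>b\<in>Basis. exp (- (x \<bullet> b)\<^sup>2 / 2))" for x :: 'a
    unfolding gauss_def power2_norm_eq_inner euclidean_inner[of x x]
    by (simp add: exp_sum[symmetric] sum_divide_distrib[symmetric] sum_negf power2_eq_square)
  then have "(\<integral>\<^sup>+x. ennreal (gauss (x::'a)) \<partial>lborel) = (\<integral>\<^sup>+x. (\<Prod>b\<in>Basis. ennreal (exp (- ((x::'a) \<bullet> b)\<^sup>2 / 2))) \<partial>lborel)"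
    by (simp add: prod_ennreal)
  also have "\<dots> = (\<Prod>b\<in>(Basis::'a set). (\<integral>\<^sup>+s. ennreal (exp (- s\<^sup>2 / 2)) \<partial>lborel))"
    by (rule nn_integral_lborel_prod) auto
  also have "\<dots> < \<infinity>" using fin by (simp add: power_less_top_ennreal)
  finally show "(\<integral>\<^sup>+x. ennreal (gauss (x::'a)) \<partial>lborel) < \<infinity>" .
qed (auto simp: gauss_def)

lemma norm_sq_decomp:
  assumes u: "norm u = 1"
  shows "(norm (perp_proj u x + t *\<^sub>R u))\<^sup>2 = (norm (perp_proj u x))\<^sup>2 + t\<^sup>2"
    and "(norm x)\<^sup>2 = (norm (perp_proj u x))\<^sup>2 + (x \<bullet> u)\<^sup>2"
proof -
  have uu: "u \<bullet> u = 1" using u by (simp add: dot_square_norm)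
  show *: "(norm (perp_proj u x + t *\<^sub>R u))\<^sup>2 = (norm (perp_proj u x))\<^sup>2 + t\<^sup>2" for t
    unfolding power2_norm_eq_inner perp_proj_def using uu
    by (simp add: inner_add_left inner_add_right inner_diff_left inner_diff_right inner_commute algebra_simps power2_eq_square)
  show "(norm x)\<^sup>2 = (norm (perp_proj u x))\<^sup>2 + (x \<bullet> u)\<^sup>2"
    using *[of "x \<bullet> u"] by (simp add: perp_proj_def)
qed

lemma gauss_perp_proj:
  assumes u: "norm u = 1"
  shows "std_normal_density (x \<bullet> u) * gauss (perp_proj u x) = gauss x / sqrt (2 * pi)"
  unfolding std_normal_density_def gauss_def norm_sq_decomp(2)[OF u, of x]
  by (simp add: exp_add[symmetric] add_divide_distrib)

lemma gauss_stretch_le: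
  assumes u: "norm u = 1"
  shows "gauss (stretch u c x) \<le> gauss (perp_proj u x)"
  unfolding gauss_def stretch_def norm_sq_decomp(1)[OF u] by simp

text \<open>
  Layer cake: for \<open>s \<le> 1\<close> the set \<open>{\<rho> \<ge> s}\<close> contains \<open>K = {\<rho> \<ge> 1}\<close>, and for \<open>s \<ge> 1\<close> it is \<open>K\<close> scaled by \<open>1/s\<close>, so the
  integral is \<open>|K| (1 + \<integral>\<^sub>1\<^sup>\<infinity> s\<^sup>-\<^sup>n ds)\<close>. It serves both for the radial function of a body and, with
  \<open>\<rho> y = 1/|y|\<close>, for the integrability of \<open>1/|y|\<close> at the origin.
\<close>

lemma nn_integral_homogeneous:
  fixes \<rho> :: "'a::euclidean_space \<Rightarrow> real"
  assumes [measurable]: "\<rho> \<in> borel_measurable borel" and dim: "2 \<le> DIM('a)"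
    and hom: "\<And>y t. 0 < t \<Longrightarrow> \<rho> (t *\<^sub>R y) = \<rho> y / t"
  shows "(\<integral>\<^sup>+y. ennreal (\<rho> y) * indicator {y. 1 \<le> \<rho> y} y \<partial>lborel)
    = ennreal (DIM('a) / (real DIM('a) - 1)) * emeasure lborel {y. 1 \<le> \<rho> y}"
proof -
  define K where "K = {y. 1 \<le> \<rho> y}"
  have [measurable]: "K \<in> sets borel" by (simp add: K_def)
  let ?n = "real DIM('a)"
  have "(\<integral>\<^sup>+y. ennreal (\<rho> y) * indicator K y \<partial>lborel)
      = (\<integral>\<^sup>+y. (\<integral>\<^sup>+s. indicator K y * indicator {0<..} s * indicator {y. s \<le> \<rho> y} y \<partial>lborel) \<partial>lborel)"
  proof (rule nn_integral_cong)
    fix y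
    show "ennreal (\<rho> y) * indicator K y = (\<integral>\<^sup>+s. indicator K y * indicator {0<..} s * indicator {y. s \<le> \<rho> y} y \<partial>lborel)"
    proof (cases "y \<in> K")
      case True
      then have "(\<integral>\<^sup>+s. indicator K y * indicator {0<..} s * indicator {y. s \<le> \<rho> y} y \<partial>lborel) = (\<integral>\<^sup>+s. indicator {0<..\<rho> y} s \<partial>lborel)"
        by (intro nn_integral_cong) (auto simp: indicator_def)
      then show ?thesis using True by (auto simp: K_def)
    qed simp
  qed
  also have "\<dots> = (\<integral>\<^sup>+s. (\<integral>\<^sup>+y. indicator K y * indicator {0<..} s * indicator {y. s \<le> \<rho> y} y \<partial>lborel) \<partial>lborel)"
    by (rule lborel_pair.Fubini') simp
  also have "\<dots> = (\<integral>\<^sup>+s. (indicator {0<..<1} s + ennreal (1 / s ^ DIM('a)) * indicator {1..} s) * emeasure lborel K \<partial>lborel)"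
  proof (rule nn_integral_cong)
    fix s :: real
    consider "s \<le> 0" | "0 < s" "s < 1" | "1 \<le> s" by linarith
    then show "(\<integral>\<^sup>+y. indicator K y * indicator {0<..} s * indicator {y. s \<le> \<rho> y} y \<partial>lborel)
       = (indicator {0<..<1} s + ennreal (1 / s ^ DIM('a)) * indicator {1..} s) * emeasure lborel K"
    proof cases
      case 2
      then have "(\<integral>\<^sup>+y. indicator K y * indicator {0<..} s * indicator {y. s \<le> \<rho> y} y \<partial>lborel) = (\<integral>\<^sup>+y. indicator K y \<partial>lborel)"
        by (intro nn_integral_cong) (auto simp: indicator_def K_def)
      then show ?thesis using 2 by simp
    next
      case 3
      have "(\<integral>\<^sup>+y. indicator K y * indicator {0<..} s * indicator {y. s \<le> \<rho> y} y \<partial>lborel) = (\<integral>\<^sup>+y. indicator K (s *\<^sub>R y) \<partial>lborel)"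
        using 3 by (intro nn_integral_cong) (auto simp: indicator_def K_def hom field_simps)
      also have "\<dots> = ennreal (1 / s ^ DIM('a)) * (\<integral>\<^sup>+y. indicator K y \<partial>lborel)"
        using 3 by (subst (2) lborel_affine[of s 0])
          (simp_all add: nn_integral_density nn_integral_distr nn_integral_cmult mult.assoc[symmetric] ennreal_mult[symmetric] del: nn_integral_indicator)
      finally show ?thesis using 3 by simp
    qed simp
  qed
  also have "\<dots> = (\<integral>\<^sup>+s. indicator {0<..<1} s + ennreal (1 / s ^ DIM('a)) * indicator {1..} s \<partial>lborel) * emeasure lborel K"
    by (rule nn_integral_multc) simp
  also have "(\<integral>\<^sup>+s. indicator {0<..<1} s + ennreal (1 / s ^ DIM('a)) * indicator {1..} s \<partial>lborel)
      = 1 + (\<integral>\<^sup>+s. ennreal (1 / s ^ DIM('a)) * indicator {1..} s \<partial>lborel)"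
    by (subst nn_integral_add) simp_all
  also have "(\<integral>\<^sup>+s. ennreal (1 / s ^ DIM('a)) * indicator {1..} s \<partial>lborel) = ennreal (0 - (- 1 / ((?n - 1) * 1 ^ (DIM('a) - 1))))"
  proof (rule nn_integral_FTC_atLeast[where F="\<lambda>s. - 1 / ((?n - 1) * s ^ (DIM('a) - 1))"])
    fix x :: real assume x: "1 \<le> x"
    define m where "m = DIM('a) - 1"
    have m: "DIM('a) = Suc m" "1 \<le> m" "?n - 1 = real m" using dim by (auto simp: m_def)
    show "DERIV (\<lambda>s. - 1 / ((?n - 1) * s ^ (DIM('a) - 1))) x :> 1 / x ^ DIM('a)"
    proof -
      obtain k where k: "m = Suc k" using m(2) by (cases m) auto
      have "DERIV (\<lambda>s. inverse (s ^ Suc k)) x :> - (inverse (x ^ Suc k) * (real (Suc k) * x ^ k) * inverse (x ^ Suc k))"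
        using x DERIV_pow[of "Suc k" x UNIV] by (intro DERIV_inverse') auto
      then have "DERIV (\<lambda>s. - 1 / real m * inverse (s ^ Suc k)) x :> - 1 / real m * - (inverse (x ^ Suc k) * (real m * x ^ k) * inverse (x ^ Suc k))"
        unfolding k by (rule DERIV_cmult)
      moreover have "- 1 / real m * - (inverse (x ^ Suc k) * (real m * x ^ k) * inverse (x ^ Suc k)) = 1 / x ^ DIM('a)"
      proof -
        have "- 1 / real m * - (inverse (x ^ Suc k) * (real m * x ^ k) * inverse (x ^ Suc k)) = inverse (x ^ Suc k) * (x ^ k * inverse (x ^ Suc k))"
          using m(2) by simp
        also have "\<dots> = 1 / x ^ DIM('a)" unfolding m(1) k using x by (simp add: field_simps)
        finally show ?thesis .
      qed
      moreover have "(\<lambda>s. - 1 / real m * inverse (s ^ Suc k)) = (\<lambda>s. - 1 / ((?n - 1) * s ^ (DIM('a) - 1)))"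
        unfolding m(3) by (simp add: m(1) k field_simps)
      ultimately show ?thesis by simp
    qed
    show "0 \<le> 1 / x ^ DIM('a)" using x by simp
  next
    have "((\<lambda>s::real. - 1 / (?n - 1) * inverse (s ^ (DIM('a) - 1))) \<longlongrightarrow> - 1 / (?n - 1) * 0) at_top"
      using dim by (intro tendsto_intros tendsto_inverse_0_at_top filterlim_pow_at_top filterlim_ident) auto
    then show "((\<lambda>s::real. - 1 / ((?n - 1) * s ^ (DIM('a) - 1))) \<longlongrightarrow> 0) at_top"
      by (simp add: field_simps)
  qed simp
  also have "1 + ennreal (0 - (- 1 / ((?n - 1) * 1 ^ (DIM('a) - 1)))) = ennreal (?n / (?n - 1))"
    using dim by (subst ennreal_1[symmetric], subst ennreal_plus[symmetric]) (auto simp: field_simps)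
  finally show ?thesis unfolding K_def .
qed

lemma integrable_gauss_div_norm:
  assumes dim: "2 \<le> DIM('a::euclidean_space)"
  shows "integrable lborel (\<lambda>x::'a. gauss x / norm x)"
proof -
  have "{y::'a. 1 \<le> 1 / norm y} \<subseteq> cball 0 1"
    by (auto simp: le_divide_eq_1)
  then have "emeasure lborel {y::'a. 1 \<le> 1 / norm y} \<le> emeasure lborel (cball (0::'a) 1)"
    by (rule emeasure_mono) simp
  also have "\<dots> < \<infinity>" by (simp add: emeasure_cball)
  finally have *: "(\<integral>\<^sup>+y. ennreal (1 / norm (y::'a)) * indicator {y. 1 \<le> 1 / norm y} y \<partial>lborel) < \<infinity>"
    by (subst nn_integral_homogeneous[OF _ dim]) (auto simp: ennreal_mult_less_top)
  then have 1: "integrable lborel (\<lambda>y::'a. 1 / norm y * indicator {y. 1 \<le> 1 / norm y} y)"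
  proof (intro integrableI_nonneg)
    have "(\<integral>\<^sup>+y. ennreal (1 / norm (y::'a) * indicator {y. 1 \<le> 1 / norm y} y) \<partial>lborel)
        = (\<integral>\<^sup>+y. ennreal (1 / norm (y::'a)) * indicator {y. 1 \<le> 1 / norm y} y \<partial>lborel)"
      by (intro nn_integral_cong) (simp split: split_indicator)
    then show "(\<integral>\<^sup>+y. ennreal (1 / norm (y::'a) * indicator {y. 1 \<le> 1 / norm y} y) \<partial>lborel) < \<infinity>"
      using * by simp
  qed auto
  show ?thesis
  proof (rule Bochner_Integration.integrable_bound[OF Bochner_Integration.integrable_add[OF 1 integrable_gauss]])
    show "AE x in lborel. norm (gauss x / norm x) \<le> norm (1 / norm x * indicator {y. 1 \<le> 1 / norm y} x + gauss (x::'a))"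
    proof (rule AE_I2)
      fix x :: 'a
      show "norm (gauss x / norm x) \<le> norm (1 / norm x * indicator {y. 1 \<le> 1 / norm y} x + gauss x)"
      proof (cases "1 \<le> 1 / norm x")
        case True
        have "gauss x \<le> 1" by (simp add: gauss_def)
        then have "gauss x / norm x \<le> 1 / norm x" by (intro divide_right_mono) auto
        then show ?thesis using True less_imp_le[OF gauss_pos[of x]] by (simp add: abs_of_nonneg)
      next
        case False
        then have "1 < norm x \<or> x = 0" by (auto simp: field_simps split: if_splits)
        then have "gauss x / norm x \<le> gauss x"
          using mult_left_mono[of 1 "norm x" "gauss x"] less_imp_le[OF gauss_pos[of x]]
          by (auto simp: divide_le_eq)
        then show ?thesis using False less_imp_le[OF gauss_pos[of x]] by simp
      qed
    qed
  qed simp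
qed

section \<open>The Prekopa-Leindler inequality\<close>

text \<open>
  The one-dimensional Brunn-Minkowski inequality for \<open>(A + B)/2\<close>. If \<open>a\<close> is close to \<open>sup A\<close> and \<open>b\<close> to \<open>inf B\<close>, the
  midpoints of \<open>A \<inter> {..a}\<close> with \<open>b\<close> and of \<open>a\<close> with \<open>B \<inter> {b<..}\<close> lie on different sides of \<open>(a + b)/2\<close>, so they
  contribute disjoint halves of \<open>A\<close> and \<open>B\<close> to \<open>C\<close>.
\<close>

lemma emeasure_midpoint_set_bounded:
  fixes A B C :: "real set"
  assumes [measurable]: "A \<in> sets borel" "B \<in> sets borel" "C \<in> sets borel"
    and ne: "A \<noteq> {}" "B \<noteq> {}" and bd: "bounded A" "bounded B"
    and mid: "\<And>x y. x \<in> A \<Longrightarrow> y \<in> B \<Longrightarrow> (x + y) / 2 \<in> C"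
  shows "emeasure lborel A + emeasure lborel B \<le> 2 * emeasure lborel C"
proof (rule ennreal_le_epsilon)
  fix e :: real assume e: "0 < e"
  have bdd: "bdd_above A" "bdd_below B"
    using bd by (auto intro: bounded_imp_bdd_above bounded_imp_bdd_below)
  obtain a where a: "a \<in> A" "Sup A - e/2 < a"
    using less_cSupE[of "Sup A - e/2" A] ne e by auto
  obtain b where b: "b \<in> B" "b < Inf B + e/2"
    using cInf_lessD[of B "Inf B + e/2"] ne e by auto
  define m where "m = (a + b) / 2"
  have "emeasure lborel A \<le> emeasure lborel ((A \<inter> {..a}) \<union> {Sup A - e/2..Sup A})"
    using a bdd by (intro emeasure_mono) (auto intro: cSup_upper)
  also have "\<dots> \<le> emeasure lborel (A \<inter> {..a}) + ennreal (e/2)"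
    using e emeasure_subadditive[of "A \<inter> {..a}" lborel "{Sup A - e/2..Sup A}"] by simp
  finally have 1: "emeasure lborel A \<le> emeasure lborel (A \<inter> {..a}) + ennreal (e/2)" .
  have "emeasure lborel B \<le> emeasure lborel ((B \<inter> {b<..}) \<union> {Inf B..Inf B + e/2})"
    using b bdd by (intro emeasure_mono) (auto intro: cInf_lower)
  also have "\<dots> \<le> emeasure lborel (B \<inter> {b<..}) + ennreal (e/2)"
    using e emeasure_subadditive[of "B \<inter> {b<..}" lborel "{Inf B..Inf B + e/2}"] by simp
  finally have 2: "emeasure lborel B \<le> emeasure lborel (B \<inter> {b<..}) + ennreal (e/2)" .
  have "emeasure lborel (A \<inter> {..a}) = (\<integral>\<^sup>+x. indicator (A \<inter> {..a}) x \<partial>lborel)"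
    by simp
  also have "\<dots> = 2 * (\<integral>\<^sup>+z. indicator (A \<inter> {..a}) (- b + 2 * z) \<partial>lborel)"
    by (subst nn_integral_real_affine[where c=2 and t="- b"]) auto
  also have "\<dots> \<le> 2 * (\<integral>\<^sup>+z. indicator (C \<inter> {..m}) z \<partial>lborel)"
  proof (intro mult_left_mono nn_integral_mono)
    fix z show "indicator (A \<inter> {..a}) (- b + 2 * z) \<le> (indicator (C \<inter> {..m}) z :: ennreal)"
      using mid[OF _ b(1), of "- b + 2 * z"] by (auto simp: indicator_def m_def)
  qed simp
  finally have 3: "emeasure lborel (A \<inter> {..a}) \<le> 2 * emeasure lborel (C \<inter> {..m})"
    by simp
  have "emeasure lborel (B \<inter> {b<..}) = (\<integral>\<^sup>+x. indicator (B \<inter> {b<..}) x \<partial>lborel)"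
    by simp
  also have "\<dots> = 2 * (\<integral>\<^sup>+z. indicator (B \<inter> {b<..}) (- a + 2 * z) \<partial>lborel)"
    by (subst nn_integral_real_affine[where c=2 and t="- a"]) auto
  also have "\<dots> \<le> 2 * (\<integral>\<^sup>+z. indicator (C \<inter> {m<..}) z \<partial>lborel)"
  proof (intro mult_left_mono nn_integral_mono)
    fix z show "indicator (B \<inter> {b<..}) (- a + 2 * z) \<le> (indicator (C \<inter> {m<..}) z :: ennreal)"
      using mid[OF a(1), of "- a + 2 * z"] by (auto simp: indicator_def m_def)
  qed simp
  finally have 4: "emeasure lborel (B \<inter> {b<..}) \<le> 2 * emeasure lborel (C \<inter> {m<..})"
    by simp
  have "emeasure lborel (C \<inter> {..m}) + emeasure lborel (C \<inter> {m<..}) = emeasure lborel C"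
    by (subst plus_emeasure) (auto intro!: arg_cong[where f="emeasure lborel"])
  then have 5: "2 * emeasure lborel (C \<inter> {..m}) + 2 * emeasure lborel (C \<inter> {m<..}) = 2 * emeasure lborel C"
    by (simp flip: distrib_left)
  have "emeasure lborel A + emeasure lborel B
      \<le> (emeasure lborel (A \<inter> {..a}) + ennreal (e/2)) + (emeasure lborel (B \<inter> {b<..}) + ennreal (e/2))"
    by (intro add_mono 1 2)
  also have "\<dots> = emeasure lborel (A \<inter> {..a}) + emeasure lborel (B \<inter> {b<..}) + (ennreal (e/2) + ennreal (e/2))"
    by (simp add: ac_simps)
  also have "ennreal (e/2) + ennreal (e/2) = ennreal e"
    using e by (simp flip: ennreal_plus)
  also have "emeasure lborel (A \<inter> {..a}) + emeasure lborel (B \<inter> {b<..}) + ennreal e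
      \<le> 2 * emeasure lborel C + ennreal e"
    unfolding 5[symmetric] by (intro add_mono 3 4 order_refl)
  finally show "emeasure lborel A + emeasure lborel B \<le> 2 * emeasure lborel C + ennreal e" .
qed

lemma emeasure_midpoint_set:
  fixes A B C :: "real set"
  assumes [measurable]: "A \<in> sets borel" "B \<in> sets borel" "C \<in> sets borel"
    and ne: "A \<noteq> {}" "B \<noteq> {}"
    and mid: "\<And>x y. x \<in> A \<Longrightarrow> y \<in> B \<Longrightarrow> (x + y) / 2 \<in> C"
  shows "emeasure lborel A + emeasure lborel B \<le> 2 * emeasure lborel C"
proof (rule LIMSEQ_le_const2)
  have lim: "(\<lambda>n. emeasure lborel (X \<inter> {- real n..real n})) \<longlonglongrightarrow> emeasure lborel X"
    if [measurable]: "X \<in> sets borel" for X :: "real set"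
  proof -
    have "(\<lambda>n. emeasure lborel (X \<inter> {- real n..real n})) \<longlonglongrightarrow> emeasure lborel (\<Union>n. X \<inter> {- real n..real n})"
      by (intro Lim_emeasure_incseq) (auto simp: incseq_def)
    also have "(\<Union>n. X \<inter> {- real n..real n}) = X"
    proof (intro equalityI subsetI)
      fix x assume "x \<in> X"
      moreover obtain n where "\<bar>x\<bar> \<le> real n" using real_arch_simple by blast
      ultimately show "x \<in> (\<Union>n. X \<inter> {- real n..real n})" by (intro UN_I[of n]) (auto simp: abs_le_iff)
    qed auto
    finally show ?thesis .
  qed
  show "(\<lambda>n. emeasure lborel (A \<inter> {- real n..real n}) + emeasure lborel (B \<inter> {- real n..real n}))
      \<longlonglongrightarrow> emeasure lborel A + emeasure lborel B"
    by (intro tendsto_add lim) auto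
  obtain a b where ab: "a \<in> A" "b \<in> B" using ne by auto
  obtain N where N: "\<bar>a\<bar> + \<bar>b\<bar> \<le> real N" using real_arch_simple by blast
  show "\<exists>N. \<forall>n\<ge>N. emeasure lborel (A \<inter> {- real n..real n}) + emeasure lborel (B \<inter> {- real n..real n})
      \<le> 2 * emeasure lborel C"
  proof (intro exI[of _ N] allI impI emeasure_midpoint_set_bounded)
    fix n assume "n \<ge> N"
    then have "real N \<le> real n" by simp
    then have "a \<in> {- real n..real n}" "b \<in> {- real n..real n}" using N by auto
    then show "A \<inter> {- real n..real n} \<noteq> {}" "B \<inter> {- real n..real n} \<noteq> {}" using ab by auto
  qed (auto intro: bounded_subset[OF bounded_closed_interval] mid)
qed

text \<open>
  The layer-cake formula with levels measured relative to an upper bound \<open>a\<close>, so that functions with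
  different suprema are compared at the same relative level.
\<close>

lemma nn_integral_level_sets:
  fixes f :: "real \<Rightarrow> real"
  assumes [measurable]: "f \<in> borel_measurable borel" and f: "\<And>x. 0 \<le> f x" "\<And>x. f x \<le> a" and a: "0 < a"
  shows "(\<integral>\<^sup>+x. ennreal (f x) \<partial>lborel) = ennreal a * (\<integral>\<^sup>+s. indicator {0<..<1} s * emeasure lborel {x. a * s < f x} \<partial>lborel)"
proof -
  have "(\<integral>\<^sup>+x. ennreal (f x) \<partial>lborel) = (\<integral>\<^sup>+x. (\<integral>\<^sup>+s. ennreal a * (indicator {0<..<1} s * indicator {x. a * s < f x} x) \<partial>lborel) \<partial>lborel)"
  proof (rule nn_integral_cong)
    fix x
    have "(\<integral>\<^sup>+s. ennreal a * (indicator {0<..<1} s * indicator {x. a * s < f x} x) \<partial>lborel)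
        = (\<integral>\<^sup>+s. ennreal a * indicator {0<..<f x / a} s \<partial>lborel)"
    proof (intro nn_integral_cong arg_cong2[where f="(*)"] refl)
      fix s
      have "f x / a \<le> 1" using f[of x] a by simp
      moreover have "a * s < f x \<longleftrightarrow> s < f x / a" using a by (simp add: field_simps)
      ultimately show "indicator {0<..<1} s * indicator {x. a * s < f x} x = (indicator {0<..<f x / a} s :: ennreal)"
        by (auto simp: indicator_def)
    qed
    also have "\<dots> = ennreal a * ennreal (f x / a)"
      using f[of x] a by (simp add: nn_integral_cmult)
    also have "\<dots> = ennreal (f x)" using a f[of x] by (simp flip: ennreal_mult)
    finally show "ennreal (f x) = (\<integral>\<^sup>+s. ennreal a * (indicator {0<..<1} s * indicator {x. a * s < f x} x) \<partial>lborel)" ..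
  qed
  also have "\<dots> = (\<integral>\<^sup>+s. (\<integral>\<^sup>+x. ennreal a * (indicator {0<..<1} s * indicator {x. a * s < f x} x) \<partial>lborel) \<partial>lborel)"
    by (rule lborel_pair.Fubini') simp
  also have "\<dots> = ennreal a * (\<integral>\<^sup>+s. indicator {0<..<1} s * emeasure lborel {x. a * s < f x} \<partial>lborel)"
    by (simp add: nn_integral_cmult)
  finally show ?thesis .
qed

text \<open>
  For \<open>s < 1\<close> the sets where \<open>f\<close> and \<open>g\<close> exceed the fraction \<open>s\<close> of their suprema \<open>a\<close> and \<open>b\<close> are nonempty, and their
  midpoints lie where \<open>h\<close> exceeds \<open>s \<surd>(a b)\<close>. Brunn-Minkowski on the line, integrated over \<open>s\<close>, gives
  \<open>\<integral>h \<ge> \<surd>(a b) (\<integral>f/a + \<integral>g/b)/2\<close>, and the inequality of the means finishes the proof.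
\<close>

lemma Prekopa_Leindler_real_bounded:
  fixes f g :: "real \<Rightarrow> real" and h :: "real \<Rightarrow> ennreal"
  assumes [measurable]: "f \<in> borel_measurable borel" "g \<in> borel_measurable borel" "h \<in> borel_measurable borel"
    and f: "\<And>x. 0 \<le> f x" "\<And>x. f x \<le> M" and g: "\<And>x. 0 \<le> g x" "\<And>x. g x \<le> M"
    and mid: "\<And>x y. ennreal (f x * g y) \<le> (h ((x + y) / 2))\<^sup>2"
  shows "(\<integral>\<^sup>+x. ennreal (f x) \<partial>lborel) * (\<integral>\<^sup>+x. ennreal (g x) \<partial>lborel) \<le> (\<integral>\<^sup>+x. h x \<partial>lborel)\<^sup>2"
proof -
  define a where "a = Sup (range f)"
  define b where "b = Sup (range g)"
  have fa: "f x \<le> a" for x unfolding a_def using f by (intro cSup_upper) (auto intro!: bdd_aboveI[of _ M])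
  have gb: "g x \<le> b" for x unfolding b_def using g by (intro cSup_upper) (auto intro!: bdd_aboveI[of _ M])
  have "0 \<le> a" "0 \<le> b" using f(1) fa g(1) gb by (meson order_trans)+
  show ?thesis
  proof (cases "a = 0 \<or> b = 0")
    case True
    then have "(\<forall>x. f x = 0) \<or> (\<forall>x. g x = 0)"
      using fa gb f(1) g(1) by (metis order_antisym)
    then show ?thesis by auto
  next
    case False
    then have a: "0 < a" and b: "0 < b" using \<open>0 \<le> a\<close> \<open>0 \<le> b\<close> by auto
    define c where "c = sqrt (a * b)"
    have c: "0 < c" "c\<^sup>2 = a * b" using a b by (auto simp: c_def)
    define I where "I k a = (\<integral>\<^sup>+s. indicator {0<..<1} s * emeasure lborel {x. a * s < k x} \<partial>lborel)"
      for k :: "real \<Rightarrow> real" and a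
    define F G where "F = (\<integral>\<^sup>+x. ennreal (f x) \<partial>lborel)" and "G = (\<integral>\<^sup>+x. ennreal (g x) \<partial>lborel)"
    have F: "F = ennreal a * I f a" unfolding I_def F_def
      by (rule nn_integral_level_sets) (auto simp: f fa a)
    have G: "G = ennreal b * I g b" unfolding I_def G_def
      by (rule nn_integral_level_sets) (auto simp: g gb b)
    \<comment> \<open>Capping \<open>h\<close> at \<open>c\<close> keeps the relevant level sets and makes the layer-cake formula applicable.\<close>
    define h' where "h' x = enn2real (min (h x) (ennreal c))" for x
    have [measurable]: "h' \<in> borel_measurable borel" unfolding h'_def by measurable
    have h'0: "0 \<le> h' x" and h'c: "h' x \<le> c" and h'h: "ennreal (h' x) \<le> h x" for x
    proof -
      have "min (h x) (ennreal c) < \<infinity>" by (rule le_less_trans[OF min.cobounded2]) simp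
      then have eq: "ennreal (h' x) = min (h x) (ennreal c)"
        by (simp add: h'_def)
      then show "ennreal (h' x) \<le> h x" by simp
      show "0 \<le> h' x" by (simp add: h'_def)
      show "h' x \<le> c" using eq c(1) by (metis ennreal_le_iff less_imp_le min.cobounded2)
    qed
    have level: "emeasure lborel {x. a * s < f x} + emeasure lborel {x. b * s < g x}
        \<le> 2 * emeasure lborel {x. c * s < h' x}" if s: "0 < s" "s < 1" for s
    proof (rule emeasure_midpoint_set)
      have "a * s < a" "b * s < b" using s a b by auto
      then show "{x. a * s < f x} \<noteq> {}" "{x. b * s < g x} \<noteq> {}"
        unfolding a_def b_def
        by (auto dest!: less_cSupD[rotated])
      fix x y assume "x \<in> {x. a * s < f x}" "y \<in> {x. b * s < g x}"
      then have "(a * s) * (b * s) < f x * g y"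
        using a b s f(1)[of x] by (intro mult_strict_mono') auto
      then have *: "(c * s)\<^sup>2 < f x * g y"
        by (simp add: power_mult_distrib c(2)) (simp add: power2_eq_square ac_simps)
      have "c * s < h' ((x + y) / 2)"
      proof (rule ccontr)
        let ?z = "(x + y) / 2"
        assume n: "\<not> c * s < h' ?z"
        have "h' ?z < c" using n s c by (smt (verit) mult_less_cancel_left2)
        have "min (h ?z) (ennreal c) < \<infinity>" by (rule le_less_trans[OF min.cobounded2]) simp
        then have eq: "ennreal (h' ?z) = min (h ?z) (ennreal c)"
          by (simp add: h'_def)
        have "ennreal (h' ?z) < ennreal c" using \<open>h' ?z < c\<close> c h'0 by (simp add: ennreal_less_iff)
        then have "ennreal (h' ?z) = h ?z" using eq by (metis min_def order_less_irrefl)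
        then have "ennreal (f x * g y) \<le> ennreal ((h' ?z)\<^sup>2)"
          using mid[of x y] by (metis ennreal_power h'0)
        then have "f x * g y \<le> (h' ?z)\<^sup>2" by (simp add: ennreal_le_iff)
        also have "\<dots> \<le> (c * s)\<^sup>2" using n h'0 by (intro power_mono) auto
        finally show False using * by simp
      qed
      then show "(x + y) / 2 \<in> {x. c * s < h' x}" by simp
    qed auto
    have "I f a + I g b \<le> 2 * I h' c"
      unfolding I_def
      by (subst nn_integral_add[symmetric], simp, simp, subst nn_integral_cmult[symmetric], simp,
          intro nn_integral_mono) (use level in \<open>auto simp: indicator_def\<close>)
    also have "ennreal c * I h' c = (\<integral>\<^sup>+x. ennreal (h' x) \<partial>lborel)"
      unfolding I_def by (rule nn_integral_level_sets[symmetric]) (auto simp: h'0 h'c c)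
    then have "ennreal c * I h' c \<le> (\<integral>\<^sup>+x. h x \<partial>lborel)"
      using h'h by (auto intro!: nn_integral_mono)
    have main: "ennreal c * (I f a + I g b) \<le> 2 * (\<integral>\<^sup>+x. h x \<partial>lborel)"
    proof -
      have "ennreal c * (I f a + I g b) \<le> ennreal c * (2 * I h' c)"
        by (intro mult_left_mono \<open>I f a + I g b \<le> 2 * I h' c\<close>) simp
      also have "\<dots> = 2 * (ennreal c * I h' c)" by (simp add: ac_simps)
      also have "\<dots> \<le> 2 * (\<integral>\<^sup>+x. h x \<partial>lborel)"
        by (intro mult_left_mono \<open>ennreal c * I h' c \<le> (\<integral>\<^sup>+x. h x \<partial>lborel)\<close>) simp
      finally show ?thesis .
    qed
    have amgm: "4 * (p * q) \<le> (p + q)\<^sup>2" for p q :: ennreal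
    proof (cases "p = \<infinity> \<or> q = \<infinity>")
      case True then show ?thesis by (auto simp: power2_eq_square ennreal_mult_top ennreal_top_mult)
    next
      case False
      then obtain p' q' where pq: "p = ennreal p'" "q = ennreal q'" "0 \<le> p'" "0 \<le> q'"
        by (metis ennreal_cases infinity_ennreal_def)
      have "4 * (p' * q') \<le> (p' + q')\<^sup>2"
        using zero_le_power2[of "p' - q'"] by (simp add: power2_eq_square algebra_simps)
      then have "ennreal (4 * (p' * q')) \<le> ennreal ((p' + q')\<^sup>2)" by (rule ennreal_leI)
      then show ?thesis using pq
        by (simp add: ennreal_mult ennreal_power[symmetric] flip: ennreal_plus)
    qed
    have c2: "(ennreal c)\<^sup>2 = ennreal a * ennreal b"
      using a b c by (simp add: ennreal_power ennreal_mult)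
    have "4 * (F * G) = (ennreal c)\<^sup>2 * (4 * (I f a * I g b))"
      unfolding F G c2 by (simp only: ac_simps)
    moreover have "(ennreal c)\<^sup>2 * (4 * (I f a * I g b)) \<le> (ennreal c)\<^sup>2 * (I f a + I g b)\<^sup>2"
      by (intro mult_left_mono amgm) simp
    moreover have "(ennreal c)\<^sup>2 * (I f a + I g b)\<^sup>2 \<le> 4 * (\<integral>\<^sup>+x. h x \<partial>lborel)\<^sup>2"
      using power_mono[OF main, of 2] by (simp add: power_mult_distrib)
    ultimately have "4 * (F * G) \<le> 4 * (\<integral>\<^sup>+x. h x \<partial>lborel)\<^sup>2" by order
    then show ?thesis
      by (subst (asm) ennreal_mult_le_mult_iff) (auto simp: F_def G_def)
  qed
qed

lemma Prekopa_Leindler_real: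
  fixes f g h :: "real \<Rightarrow> ennreal"
  assumes [measurable]: "f \<in> borel_measurable borel" "g \<in> borel_measurable borel" "h \<in> borel_measurable borel"
    and mid: "\<And>x y. f x * g y \<le> (h ((x + y) / 2))\<^sup>2"
  shows "(\<integral>\<^sup>+x. f x \<partial>lborel) * (\<integral>\<^sup>+x. g x \<partial>lborel) \<le> (\<integral>\<^sup>+x. h x \<partial>lborel)\<^sup>2"
proof (rule LIMSEQ_le_const2)
  define t where "t k n x = enn2real (min (k x) (of_nat n))" for k :: "real \<Rightarrow> ennreal" and n x
  have eq: "ennreal (t k n x) = min (k x) (of_nat n)" for k n x
  proof -
    have "min (k x) (of_nat n) < \<infinity>"
      by (rule le_less_trans[OF min.cobounded2]) (simp add: of_nat_less_top)
    then show ?thesis by (simp add: t_def)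
  qed
  have [measurable]: "t k n \<in> borel_measurable borel" if [measurable]: "k \<in> borel_measurable borel" for k n
    unfolding t_def by measurable
  have lim: "(\<lambda>n. \<integral>\<^sup>+x. ennreal (t k n x) \<partial>lborel) \<longlonglongrightarrow> (\<integral>\<^sup>+x. k x \<partial>lborel)"
    if [measurable]: "k \<in> borel_measurable borel" for k
  proof (rule nn_integral_LIMSEQ)
    show "incseq (\<lambda>n x. ennreal (t k n x))"
      unfolding eq by (auto simp: incseq_def le_fun_def intro: min.coboundedI2)
    show "(\<lambda>n. ennreal (t k n x)) \<longlonglongrightarrow> k x" for x
    proof -
      have "(\<lambda>n. min (k x) (of_nat n)) \<longlonglongrightarrow> min (k x) top"
        by (intro tendsto_min tendsto_const of_nat_tendsto_top_ennreal)
      then show ?thesis unfolding eq by (simp add: min_def)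
    qed
  qed auto
  show "(\<lambda>n. (\<integral>\<^sup>+x. ennreal (t f n x) \<partial>lborel) * (\<integral>\<^sup>+x. ennreal (t g n x) \<partial>lborel))
      \<longlonglongrightarrow> (\<integral>\<^sup>+x. f x \<partial>lborel) * (\<integral>\<^sup>+x. g x \<partial>lborel)"
  proof (cases "(\<integral>\<^sup>+x. f x \<partial>lborel) = 0 \<or> (\<integral>\<^sup>+x. g x \<partial>lborel) = 0")
    case True
    have le: "(\<integral>\<^sup>+x. ennreal (t k n x) \<partial>lborel) \<le> (\<integral>\<^sup>+x. k x \<partial>lborel)" for k n
      unfolding eq by (intro nn_integral_mono) auto
    have "(\<integral>\<^sup>+x. ennreal (t f n x) \<partial>lborel) * (\<integral>\<^sup>+x. ennreal (t g n x) \<partial>lborel) = 0" for n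
      using True le[of f n] le[of g n] by auto
    moreover have "(\<integral>\<^sup>+x. f x \<partial>lborel) * (\<integral>\<^sup>+x. g x \<partial>lborel) = 0" using True by auto
    ultimately show ?thesis by (simp only: tendsto_const)
  next
    case False
    then show ?thesis by (intro tendsto_mult_ennreal lim) auto
  qed
  show "\<exists>N. \<forall>n\<ge>N. (\<integral>\<^sup>+x. ennreal (t f n x) \<partial>lborel) * (\<integral>\<^sup>+x. ennreal (t g n x) \<partial>lborel)
      \<le> (\<integral>\<^sup>+x. h x \<partial>lborel)\<^sup>2"
  proof (intro exI[of _ 0] allI impI Prekopa_Leindler_real_bounded)
    fix n :: nat and k :: "real \<Rightarrow> ennreal" and x y :: real
    have bd: "t k n x \<le> real n" for k x
      using eq[of k n x] by (metis ennreal_le_iff ennreal_of_nat_eq_real_of_nat min.cobounded2 of_nat_0_le_iff)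
    show "t f n x \<le> real n" "t g n x \<le> real n" by (rule bd)+
    show "0 \<le> t f n x" "0 \<le> t g n x" by (simp_all add: t_def)
    have "ennreal (t f n x * t g n y) = ennreal (t f n x) * ennreal (t g n y)"
      by (intro ennreal_mult) (simp_all add: t_def)
    also have "\<dots> \<le> f x * g y" unfolding eq by (intro mult_mono) auto
    finally show "ennreal (t f n x * t g n y) \<le> (h ((x + y) / 2))\<^sup>2" using mid[of x y] by simp
  qed auto
qed

text \<open>
  Integrating out one coordinate preserves the hypothesis, by the one-dimensional case.
\<close>

lemma Prekopa_Leindler_PiM:
  fixes f g h :: "('i \<Rightarrow> real) \<Rightarrow> ennreal"
  assumes "finite I"
    and "f \<in> borel_measurable (\<Pi>\<^sub>M i\<in>I. lborel)" "g \<in> borel_measurable (\<Pi>\<^sub>M i\<in>I. lborel)"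
      "h \<in> borel_measurable (\<Pi>\<^sub>M i\<in>I. lborel)"
    and "\<And>x y. x \<in> space (\<Pi>\<^sub>M i\<in>I. lborel) \<Longrightarrow> y \<in> space (\<Pi>\<^sub>M i\<in>I. lborel) \<Longrightarrow>
      f x * g y \<le> (h (\<lambda>i\<in>I. (x i + y i) / 2))\<^sup>2"
  shows "(\<integral>\<^sup>+x. f x \<partial>(\<Pi>\<^sub>M i\<in>I. lborel)) * (\<integral>\<^sup>+x. g x \<partial>(\<Pi>\<^sub>M i\<in>I. lborel)) \<le> (\<integral>\<^sup>+x. h x \<partial>(\<Pi>\<^sub>M i\<in>I. lborel))\<^sup>2"
  using assms
proof (induction I arbitrary: f g h)
  case empty
  interpret product_sigma_finite "\<lambda>_::'i. lborel :: real measure" by standard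
  show ?case
    using empty.prems(4)[of "\<lambda>_. undefined" "\<lambda>_. undefined"]
    by (simp add: PiM_empty nn_integral_count_space_finite space_PiM restrict_def)
next
  case (insert i I)
  interpret product_sigma_finite "\<lambda>_::'i. lborel :: real measure" by standard
  note [measurable] = insert.prems(1-3)
  define S where "S k x = (\<integral>\<^sup>+s. k (x(i := s)) \<partial>lborel)" for k :: "('i \<Rightarrow> real) \<Rightarrow> ennreal" and x
  have [measurable]: "S k \<in> borel_measurable (\<Pi>\<^sub>M i\<in>I. lborel)"
    if [measurable]: "k \<in> borel_measurable (\<Pi>\<^sub>M i\<in>insert i I. lborel)" for k
    unfolding S_def by measurable
  have ins: "(\<integral>\<^sup>+x. k x \<partial>(\<Pi>\<^sub>M i\<in>insert i I. lborel)) = (\<integral>\<^sup>+x. S k x \<partial>(\<Pi>\<^sub>M i\<in>I. lborel))"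
    if "k \<in> borel_measurable (\<Pi>\<^sub>M i\<in>insert i I. lborel)" for k
    unfolding S_def using insert.hyps that by (intro product_nn_integral_insert) auto
  have "S f x * S g y \<le> (S h (\<lambda>i\<in>I. (x i + y i) / 2))\<^sup>2"
    if xy: "x \<in> space (\<Pi>\<^sub>M i\<in>I. lborel)" "y \<in> space (\<Pi>\<^sub>M i\<in>I. lborel)" for x y
    unfolding S_def
  proof (rule Prekopa_Leindler_real)
    have upd[measurable]: "(\<lambda>s. z(i := s)) \<in> borel \<rightarrow>\<^sub>M (\<Pi>\<^sub>M i\<in>insert i I. lborel)"
      if "z \<in> space (\<Pi>\<^sub>M i\<in>I. lborel)" for z
      using measurable_component_update[OF that, of i] insert.hyps by simp
    have z: "(\<lambda>i\<in>I. (x i + y i) / 2) \<in> space (\<Pi>\<^sub>M i\<in>I. lborel)" by (simp add: space_PiM)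
    show "(\<lambda>s. f (x(i := s))) \<in> borel_measurable borel" "(\<lambda>s. g (y(i := s))) \<in> borel_measurable borel"
      "(\<lambda>s. h ((\<lambda>i\<in>I. (x i + y i) / 2)(i := s))) \<in> borel_measurable borel"
      using upd[OF xy(1)] upd[OF xy(2)] upd[OF z] by (auto intro: measurable_compose)
    fix s t
    have "(\<lambda>j\<in>insert i I. ((x(i := s)) j + (y(i := t)) j) / 2) = (\<lambda>i\<in>I. (x i + y i) / 2)(i := (s + t) / 2)"
      using insert.hyps by (auto simp: fun_eq_iff restrict_def)
    moreover have "x(i := s) \<in> space (\<Pi>\<^sub>M i\<in>insert i I. lborel)" "y(i := t) \<in> space (\<Pi>\<^sub>M i\<in>insert i I. lborel)"
      using xy by (auto simp: space_PiM PiE_iff extensional_def)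
    ultimately show "f (x(i := s)) * g (y(i := t)) \<le> (h ((\<lambda>i\<in>I. (x i + y i) / 2)(i := (s + t) / 2)))\<^sup>2"
      using insert.prems(4)[of "x(i := s)" "y(i := t)"] by metis
  qed
  then show ?case
    using insert.IH[of "S f" "S g" "S h"] insert.prems(1-3) by (simp only: ins) measurable
qed

theorem Prekopa_Leindler:
  fixes f g h :: "'a::euclidean_space \<Rightarrow> ennreal"
  assumes [measurable]: "f \<in> borel_measurable borel" "g \<in> borel_measurable borel" "h \<in> borel_measurable borel"
    and mid: "\<And>x y. f x * g y \<le> (h ((1/2) *\<^sub>R (x + y)))\<^sup>2"
  shows "(\<integral>\<^sup>+x. f x \<partial>lborel) * (\<integral>\<^sup>+x. g x \<partial>lborel) \<le> (\<integral>\<^sup>+x. h x \<partial>lborel)\<^sup>2"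
proof -
  let ?e = "\<lambda>x. \<Sum>b\<in>Basis. x b *\<^sub>R b :: 'a"
  have eq: "(\<integral>\<^sup>+x. k x \<partial>lborel) = (\<integral>\<^sup>+x. k (?e x) \<partial>(\<Pi>\<^sub>M b\<in>Basis. lborel))"
    if [measurable]: "k \<in> borel_measurable borel" for k :: "'a \<Rightarrow> ennreal"
    by (subst lborel_eq, subst nn_integral_distr) auto
  have "?e (\<lambda>b\<in>Basis. (x b + y b) / 2) = (1/2) *\<^sub>R (?e x + ?e y)" for x y
    by (simp add: scaleR_sum_right sum.distrib[symmetric] algebra_simps add_divide_distrib)
  then show ?thesis
    using mid by (simp add: eq Prekopa_Leindler_PiM)
qed

section \<open>Self-adjointness of the Radon transform\<close>

text \<open>
  A class containing both the densities restricted to convex bodies and the Gaussian times a bounded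
  continuous function. The Gaussian bound dominates all integrands uniformly in the direction; almost
  everywhere continuity along the projection is what survives of continuity at the boundary of a body.
\<close>

definition admissible :: "('a::euclidean_space \<Rightarrow> real) \<Rightarrow> bool" where
  "admissible F \<longleftrightarrow> F \<in> borel_measurable borel \<and> (\<exists>C. \<forall>x. \<bar>F x\<bar> \<le> C * gauss x) \<and>
    (\<forall>u. norm u = 1 \<longrightarrow> (AE x in lborel. isCont F (perp_proj u x)))"

lemma integrable_gauss_scaled: "integrable lborel (\<lambda>x::'a::euclidean_space. C * (gauss x / sqrt (2 * pi)))"
  by (intro integrable_mult_right integrable_divide_zero impI integrable_gauss)

lemma admissible_measurable[measurable_dest]: "admissible F \<Longrightarrow> F \<in> borel_measurable borel"
  by (simp add: admissible_def)

lemma admissible_bound: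
  fixes F :: "'a::euclidean_space \<Rightarrow> real"
  assumes "admissible F"
  shows "\<exists>C\<ge>0. \<forall>x. \<bar>F x\<bar> \<le> C * gauss x"
proof -
  obtain C where C: "\<bar>F x\<bar> \<le> C * gauss x" for x using assms by (auto simp: admissible_def)
  have "0 \<le> C * gauss (0::'a)" using C[of 0] by linarith
  then have "0 \<le> C" by (simp add: zero_le_mult_iff gauss_def)
  then show ?thesis using C by blast
qed

lemma admissible_integrable:
  assumes "admissible F"
  shows "integrable lborel F"
proof -
  obtain C where "\<And>x. \<bar>F x\<bar> \<le> C * gauss x" using admissible_bound[OF assms] by blast
  then show ?thesis
    using assms integrable_gauss
    by (intro Bochner_Integration.integrable_bound[of lborel "\<lambda>x. C * gauss x" F]) (auto intro: order_trans[OF _ abs_ge_self] dest: admissible_measurable)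
qed

lemma admissible_add:
  assumes "admissible F" "admissible G"
  shows "admissible (\<lambda>x. F x + G x)"
proof -
  obtain C D where "\<And>x. \<bar>F x\<bar> \<le> C * gauss x" "\<And>x. \<bar>G x\<bar> \<le> D * gauss x"
    using assms[THEN admissible_bound] by blast
  then have "\<bar>F x + G x\<bar> \<le> (C + D) * gauss x" for x
    by (smt (verit) distrib_right)
  moreover have "AE x in lborel. isCont (\<lambda>x. F x + G x) (perp_proj u x)" if "norm u = 1" for u
  proof -
    have "AE x in lborel. isCont F (perp_proj u x)" "AE x in lborel. isCont G (perp_proj u x)"
      using assms that by (auto simp: admissible_def)
    then show ?thesis by eventually_elim (rule isCont_add)
  qed
  ultimately show ?thesis
    using assms by (auto simp: admissible_def)
qed

lemma admissible_cmult:
  assumes "admissible F"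
  shows "admissible (\<lambda>x. c * F x)"
proof -
  obtain C where C: "\<And>x. \<bar>F x\<bar> \<le> C * gauss x" using assms[THEN admissible_bound] by blast
  then have "\<bar>c * F x\<bar> \<le> (\<bar>c\<bar> * C) * gauss x" for x
    using mult_left_mono[OF C[of x], of "\<bar>c\<bar>"] by (simp add: abs_mult)
  moreover have "AE x in lborel. isCont (\<lambda>x. c * F x) (perp_proj u x)" if "norm u = 1" for u
  proof -
    have "AE x in lborel. isCont F (perp_proj u x)" using assms that by (auto simp: admissible_def)
    then show ?thesis by eventually_elim (auto intro: continuous_intros)
  qed
  ultimately show ?thesis
    using assms by (auto simp: admissible_def)
qed

lemma convex_body_measurable: "convex_body K \<Longrightarrow> K \<in> sets borel"
  by (auto simp: convex_body_def intro: borel_compact)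

text \<open>
  The cylinder over the section \<open>K \<inter> u\<^sup>\<bottom>\<close> is convex, so its frontier is a null set. An interior point of the
  cylinder can be pushed outwards a little, which puts its projection in the interior of \<open>K\<close>, not just of
  the section.
\<close>

lemma AE_perp_proj_notin_frontier:
  assumes K: "convex_body K" and u: "norm u = 1"
  shows "AE x in lborel. perp_proj u x \<notin> frontier K"
proof -
  define C where "C = perp_proj u -` K"
  have lin: "linear (perp_proj u)"
    by (intro linearI) (simp_all add: perp_proj_def algebra_simps inner_add_left)
  have "convex C"
    unfolding C_def using K lin by (auto simp: convex_body_def intro: convex_linear_vimage)
  then have "negligible (frontier C)" by (rule negligible_convex_frontier)
  then have "frontier C \<in> null_sets lborel"
    by (simp add: negligible_iff_null_sets null_sets_completion_iff)
  then have "AE x in lborel. x \<notin> frontier C" by (rule AE_not_in)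
  then show ?thesis
  proof eventually_elim
    fix x assume x: "x \<notin> frontier C"
    have clos: "closed K" and conv: "convex K" and int0: "0 \<in> interior K"
      using K by (auto simp: convex_body_def compact_imp_closed)
    show "perp_proj u x \<notin> frontier K"
    proof (cases "x \<in> interior C")
      case True
      \<comment> \<open>Shrinking \<open>(1 + \<delta>) x\<close> towards the interior point \<open>0\<close> will put the projection in the interior of \<open>K\<close>.\<close>
      have "\<exists>\<delta>>0. (1 + \<delta>) *\<^sub>R x \<in> C"
      proof -
        have "((\<lambda>\<delta>. (1 + \<delta>) *\<^sub>R x) \<longlongrightarrow> (1 + 0) *\<^sub>R x) (at_right (0::real))"
          by (intro tendsto_intros)
        then have "\<forall>\<^sub>F \<delta> in at_right (0::real). (1 + \<delta>) *\<^sub>R x \<in> interior C"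
          using True by (auto dest: topological_tendstoD[OF _ open_interior])
        moreover have "\<forall>\<^sub>F \<delta> in at_right (0::real). 0 < \<delta>" by (simp add: eventually_at_right_less)
        ultimately have "\<forall>\<^sub>F \<delta> in at_right (0::real). 0 < \<delta> \<and> (1 + \<delta>) *\<^sub>R x \<in> interior C"
          by eventually_elim simp
        then show ?thesis
          using eventually_happens interior_subset by (metis (no_types, lifting) subsetD trivial_limit_at_right_real)
      qed
      then obtain \<delta> where \<delta>: "0 < \<delta>" "(1 + \<delta>) *\<^sub>R perp_proj u x \<in> K"
        using lin by (auto simp: C_def linear_scale)
      have "(1 + \<delta>) *\<^sub>R perp_proj u x - (\<delta> / (1 + \<delta>)) *\<^sub>R ((1 + \<delta>) *\<^sub>R perp_proj u x - 0) \<in> interior K"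
        using \<delta> by (intro mem_interior_convex_shrink[OF conv int0]) auto
      also have "(1 + \<delta>) *\<^sub>R perp_proj u x - (\<delta> / (1 + \<delta>)) *\<^sub>R ((1 + \<delta>) *\<^sub>R perp_proj u x - 0) = perp_proj u x"
        using \<delta> by (simp add: scaleR_diff_left[symmetric])
      finally show ?thesis by (simp add: frontier_def)
    next
      case False
      then have "x \<notin> C" using x closure_subset by (auto simp: frontier_def)
      then show ?thesis using clos by (auto simp: frontier_def C_def)
    qed
  qed
qed

lemma admissible_body:
  fixes f :: "'a::euclidean_space \<Rightarrow> real"
  assumes K: "convex_body K" and f: "continuous_on UNIV f"
  shows "admissible (\<lambda>x. indicator K x * f x)"
proof -
  have cK: "compact K" using K by (simp add: convex_body_def)
  have [measurable]: "K \<in> sets borel" using cK by (simp add: compact_imp_closed borel_closed)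
  have [measurable]: "f \<in> borel_measurable borel" using f by (rule borel_measurable_continuous_onI)
  have "continuous_on K (\<lambda>x. f x / gauss x)"
    unfolding gauss_def using f by (intro continuous_intros) (auto intro: continuous_on_subset)
  then have "bounded ((\<lambda>x. f x / gauss x) ` K)"
    using cK by (simp add: compact_continuous_image compact_imp_bounded)
  then obtain C where C: "\<And>x. x \<in> K \<Longrightarrow> \<bar>f x / gauss x\<bar> \<le> C" unfolding bounded_iff by auto
  have "\<bar>indicator K x * f x\<bar> \<le> \<bar>C\<bar> * gauss x" for x
  proof (cases "x \<in> K")
    case True
    then have "\<bar>f x\<bar> \<le> C * gauss x" using C[OF True] gauss_pos[of x] by (simp add: abs_divide pos_divide_le_eq)
    also have "\<dots> \<le> \<bar>C\<bar> * gauss x" by (intro mult_right_mono) (auto intro: less_imp_le)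
    finally show ?thesis using True by simp
  qed (simp add: less_imp_le)
  moreover have "AE x in lborel. isCont (\<lambda>x. indicator K x * f x) (perp_proj u x)" if "norm u = 1" for u
    using AE_perp_proj_notin_frontier[OF K that]
  proof eventually_elim
    fix x assume "perp_proj u x \<notin> frontier K"
    then have "isCont (indicator K :: _ \<Rightarrow> real) (perp_proj u x)" by (simp add: isCont_indicator)
    then show "isCont (\<lambda>x. indicator K x * f x) (perp_proj u x)"
      using f by (intro isCont_mult) (auto simp: continuous_on_eq_continuous_at)
  qed
  ultimately show ?thesis by (auto simp: admissible_def)
qed

lemma admissible_gauss_times:
  fixes w :: "'a::euclidean_space \<Rightarrow> real"
  assumes w: "continuous_on UNIV w" and b: "\<And>x. \<bar>w x\<bar> \<le> C"
  shows "admissible (\<lambda>x. gauss x * w x)"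
proof -
  have [measurable]: "w \<in> borel_measurable borel" using w by (rule borel_measurable_continuous_onI)
  have "\<bar>gauss x * w x\<bar> \<le> C * gauss x" for x
    using mult_left_mono[OF b[of x], of "gauss x"] less_imp_le[OF gauss_pos[of x]] by (simp add: abs_mult mult.commute)
  moreover have "isCont (\<lambda>x. gauss x * w x) y" for y
    using w unfolding gauss_def by (intro continuous_intros) (auto simp: continuous_on_eq_continuous_at)
  ultimately show ?thesis by (auto simp: admissible_def)
qed

text \<open>
  By \<open>integral_perp_lborel\<close> the direction occurs only in the integrand of an integral over the whole space,
  so dominated convergence applies.
\<close>

lemma continuous_on_perp_lborel_integral:
  fixes F :: "'a::euclidean_space \<Rightarrow> real"
  assumes F: "admissible F"
  shows "continuous_on (sphere 0 1) (\<lambda>u. \<integral>w. F w \<partial>perp_lborel u)"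
  unfolding continuous_on_sequentially comp_def
proof (intro ballI allI impI, elim conjE)
  fix u :: 'a and v :: "nat \<Rightarrow> 'a"
  assume u: "u \<in> sphere 0 1" and v: "\<forall>n. v n \<in> sphere 0 1" and lim: "v \<longlonglongrightarrow> u"
  have [measurable]: "F \<in> borel_measurable borel" using F by (rule admissible_measurable)
  obtain C where C: "0 \<le> C" "\<And>x. \<bar>F x\<bar> \<le> C * gauss x" using admissible_bound[OF F] by blast
  have "(\<lambda>n. LBINT x. std_normal_density (x \<bullet> v n) * F (perp_proj (v n) x)) \<longlonglongrightarrow> (LBINT x. std_normal_density (x \<bullet> u) * F (perp_proj u x))"
  proof (rule integral_dominated_convergence[where w="\<lambda>x. C * (gauss x / sqrt (2 * pi))"])
    show "integrable lborel (\<lambda>x. C * (gauss x / sqrt (2 * pi)) :: real)"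
      by (rule integrable_gauss_scaled)
    have "AE x in lborel. isCont F (perp_proj u x)" using F u by (simp add: admissible_def)
    then show "AE x in lborel. (\<lambda>n. std_normal_density (x \<bullet> v n) * F (perp_proj (v n) x)) \<longlonglongrightarrow> std_normal_density (x \<bullet> u) * F (perp_proj u x)"
    proof eventually_elim
      fix x assume c: "isCont F (perp_proj u x)"
      have "(\<lambda>n. perp_proj (v n) x) \<longlonglongrightarrow> perp_proj u x"
        unfolding perp_proj_def by (intro tendsto_intros lim)
      then have "(\<lambda>n. F (perp_proj (v n) x)) \<longlonglongrightarrow> F (perp_proj u x)" by (rule isCont_tendsto_compose[OF c])
      then show "(\<lambda>n. std_normal_density (x \<bullet> v n) * F (perp_proj (v n) x)) \<longlonglongrightarrow> std_normal_density (x \<bullet> u) * F (perp_proj u x)"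
        unfolding std_normal_density_def by (intro tendsto_intros lim) auto
    qed
    fix n
    have vn: "norm (v n) = 1" using v by simp
    show "AE x in lborel. norm (std_normal_density (x \<bullet> v n) * F (perp_proj (v n) x)) \<le> C * (gauss x / sqrt (2 * pi))"
    proof (rule AE_I2)
      fix x
      have "norm (std_normal_density (x \<bullet> v n) * F (perp_proj (v n) x)) = std_normal_density (x \<bullet> v n) * \<bar>F (perp_proj (v n) x)\<bar>"
        by (simp add: abs_mult)
      also have "\<dots> \<le> std_normal_density (x \<bullet> v n) * (C * gauss (perp_proj (v n) x))"
        by (intro mult_left_mono C) simp
      also have "\<dots> = C * (gauss x / sqrt (2 * pi))" using gauss_perp_proj[OF vn, of x] by (simp add: mult.left_commute)
      finally show "norm (std_normal_density (x \<bullet> v n) * F (perp_proj (v n) x)) \<le> C * (gauss x / sqrt (2 * pi))" .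
    qed
  qed measurable
  then show "(\<lambda>n. \<integral>w. F w \<partial>perp_lborel (v n)) \<longlonglongrightarrow> (\<integral>w. F w \<partial>perp_lborel u)"
    using u v by (simp add: integral_perp_lborel)
qed

text \<open>
  The integral of \<open>F\<close> against the delta function of \<open>\<xi> \<bullet> y\<close>: the hyperplane integral, extended from the sphere to
  all \<open>\<xi>\<close> as a homogeneous function of degree \<open>-1\<close>.
\<close>

definition radon :: "('a::euclidean_space \<Rightarrow> real) \<Rightarrow> 'a \<Rightarrow> real" where
  "radon F \<xi> = (\<integral>w. F w \<partial>perp_lborel (sgn \<xi>)) / norm \<xi>"

text \<open>
  The Radon transform with the delta function replaced by a normal density of width \<open>\<epsilon>\<close>. Applied to the
  indicator of a body, it is the mass of a central Gaussian slab.
\<close>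

definition smooth_radon :: "real \<Rightarrow> ('a::euclidean_space \<Rightarrow> real) \<Rightarrow> 'a \<Rightarrow> real" where
  "smooth_radon \<epsilon> F \<xi> = (LBINT y. F y * normal_density 0 \<epsilon> (\<xi> \<bullet> y))"

text \<open>
  Contracting the direction of \<open>\<xi>\<close> by \<open>\<epsilon>/|\<xi>|\<close> turns the narrow normal density into the standard one and makes
  the limit \<open>\<epsilon> \<longrightarrow> 0\<close> visible in the argument of \<open>F\<close>.
\<close>

lemma smooth_radon_eq:
  fixes F :: "'a::euclidean_space \<Rightarrow> real"
  assumes [measurable]: "F \<in> borel_measurable borel" and \<xi>: "\<xi> \<noteq> 0" and \<epsilon>: "0 < \<epsilon>"
  shows "smooth_radon \<epsilon> F \<xi> =
    (LBINT x. std_normal_density (x \<bullet> sgn \<xi>) * F (stretch (sgn \<xi>) (\<epsilon> / norm \<xi>) x)) / norm \<xi>"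
proof -
  define u c where "u = sgn \<xi>" and "c = \<epsilon> / norm \<xi>"
  have u: "norm u = 1" and c: "0 < c" using \<xi> \<epsilon> by (auto simp: u_def c_def norm_sgn)
  have uu: "u \<bullet> u = 1" using u by (simp add: dot_square_norm)
  have \<xi>u: "\<xi> = norm \<xi> *\<^sub>R u" using \<xi> by (simp add: u_def sgn_div_norm)
  have dot: "\<xi> \<bullet> stretch u c x = \<epsilon> * (x \<bullet> u)" for x
  proof -
    have "\<xi> \<bullet> stretch u c x = norm \<xi> * (u \<bullet> stretch u c x)" by (subst \<xi>u) simp
    also have "u \<bullet> stretch u c x = c * (x \<bullet> u)"
      by (simp add: stretch_def perp_proj_def inner_add_right inner_diff_right uu inner_commute)
    finally show ?thesis using \<xi> by (simp add: c_def)
  qed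
  have "smooth_radon \<epsilon> F \<xi> = c * (LBINT x. F (stretch u c x) * normal_density 0 \<epsilon> (\<xi> \<bullet> stretch u c x))"
    unfolding smooth_radon_def by (rule integral_stretch[OF u c]) measurable
  also have "\<dots> = (LBINT x. std_normal_density (x \<bullet> u) * F (stretch u c x) / norm \<xi>)"
  proof (subst integral_mult_right_zero[symmetric], rule Bochner_Integration.integral_cong[OF refl])
    fix x
    have "normal_density 0 \<epsilon> (\<epsilon> * (x \<bullet> u)) = std_normal_density (x \<bullet> u) / \<epsilon>"
      using \<epsilon> by (simp add: normal_density_def power_mult_distrib real_sqrt_mult)
    then show "c * (F (stretch u c x) * normal_density 0 \<epsilon> (\<xi> \<bullet> stretch u c x)) = std_normal_density (x \<bullet> u) * F (stretch u c x) / norm \<xi>"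
      unfolding dot using \<epsilon> by (simp add: c_def)
  qed
  finally show ?thesis by (simp add: u_def c_def)
qed

text \<open>
  The integral of the Gaussian over any hyperplane through the origin.
\<close>

definition gauss_mass :: "'a::euclidean_space itself \<Rightarrow> real" where
  "gauss_mass _ = (LBINT x. gauss (x::'a)) / sqrt (2 * pi)"

lemma smooth_radon_integrand_bound:
  fixes F :: "'a::euclidean_space \<Rightarrow> real"
  assumes u: "norm u = 1" and C: "0 \<le> C" "\<And>x. \<bar>F x\<bar> \<le> C * gauss x"
  shows "norm (std_normal_density (x \<bullet> u) * F (stretch u c x)) \<le> C * (gauss x / sqrt (2 * pi))"
proof -
  have "norm (std_normal_density (x \<bullet> u) * F (stretch u c x)) = std_normal_density (x \<bullet> u) * \<bar>F (stretch u c x)\<bar>"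
    by (simp add: abs_mult)
  also have "\<dots> \<le> std_normal_density (x \<bullet> u) * (C * gauss (perp_proj u x))"
    by (intro mult_left_mono order_trans[OF C(2)] gauss_stretch_le[OF u] C(1)) simp
  also have "\<dots> = C * (gauss x / sqrt (2 * pi))" using gauss_perp_proj[OF u, of x] by (simp add: mult.left_commute)
  finally show ?thesis .
qed

lemma smooth_radon_bound:
  fixes F :: "'a::euclidean_space \<Rightarrow> real"
  assumes F: "admissible F" and C: "0 \<le> C" "\<And>x. \<bar>F x\<bar> \<le> C * gauss x" and \<xi>: "\<xi> \<noteq> 0" and \<epsilon>: "0 < \<epsilon>"
  shows "\<bar>smooth_radon \<epsilon> F \<xi>\<bar> \<le> C * gauss_mass TYPE('a) / norm \<xi>"
proof -
  have [measurable]: "F \<in> borel_measurable borel" using F by (rule admissible_measurable)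
  let ?u = "sgn \<xi>"
  have u: "norm ?u = 1" using \<xi> by (simp add: norm_sgn)
  have "\<bar>LBINT x. std_normal_density (x \<bullet> ?u) * F (stretch ?u (\<epsilon> / norm \<xi>) x)\<bar>
      \<le> (LBINT x. norm (std_normal_density (x \<bullet> ?u) * F (stretch ?u (\<epsilon> / norm \<xi>) x)))"
    using integral_norm_bound[of lborel "\<lambda>x. std_normal_density (x \<bullet> ?u) * F (stretch ?u (\<epsilon> / norm \<xi>) x)"]
    by (simp only: real_norm_def)
  also have "\<dots> \<le> (LBINT x. C * (gauss (x::'a) / sqrt (2 * pi)))"
  proof (rule integral_mono'[OF integrable_gauss_scaled])
    fix x
    show "norm (std_normal_density (x \<bullet> ?u) * F (stretch ?u (\<epsilon> / norm \<xi>) x)) \<le> C * (gauss x / sqrt (2 * pi))"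
      by (rule smooth_radon_integrand_bound[OF u C])
    then show "0 \<le> C * (gauss x / sqrt (2 * pi))" by (rule order_trans[OF norm_ge_zero])
  qed
  also have "\<dots> = C * gauss_mass TYPE('a)" by (simp add: gauss_mass_def)
  finally show ?thesis
    unfolding smooth_radon_eq[OF admissible_measurable[OF F] \<xi> \<epsilon>] by (simp add: divide_right_mono)
qed

lemma smooth_radon_tendsto:
  assumes F: "admissible F" and \<xi>: "\<xi> \<noteq> 0"
  shows "(\<lambda>k. smooth_radon (1 / real (Suc k)) F \<xi>) \<longlonglongrightarrow> radon F \<xi>"
proof -
  have [measurable]: "F \<in> borel_measurable borel" using F by (rule admissible_measurable)
  obtain C where C: "0 \<le> C" "\<And>x. \<bar>F x\<bar> \<le> C * gauss x" using admissible_bound[OF F] by blast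
  define u where "u = sgn \<xi>"
  have u: "norm u = 1" using \<xi> by (simp add: norm_sgn u_def)
  have "(\<lambda>k. LBINT x. std_normal_density (x \<bullet> u) * F (stretch u (1 / real (Suc k) / norm \<xi>) x)) \<longlonglongrightarrow> (LBINT x. std_normal_density (x \<bullet> u) * F (perp_proj u x))"
  proof (rule integral_dominated_convergence[where w="\<lambda>x. C * (gauss x / sqrt (2 * pi))"])
    show "integrable lborel (\<lambda>x. C * (gauss x / sqrt (2 * pi)) :: real)"
      by (rule integrable_gauss_scaled)
    have "AE x in lborel. isCont F (perp_proj u x)" using F u by (simp add: admissible_def)
    then show "AE x in lborel. (\<lambda>k. std_normal_density (x \<bullet> u) * F (stretch u (1 / real (Suc k) / norm \<xi>) x)) \<longlonglongrightarrow> std_normal_density (x \<bullet> u) * F (perp_proj u x)"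
    proof eventually_elim
      fix x assume c: "isCont F (perp_proj u x)"
      have z: "(\<lambda>k. 1 / real (Suc k)) \<longlonglongrightarrow> 0" using LIMSEQ_inverse_real_of_nat by (simp add: inverse_eq_divide)
      have "(\<lambda>k. stretch u (1 / real (Suc k) / norm \<xi>) x) \<longlonglongrightarrow> perp_proj u x + (0 / norm \<xi> * (x \<bullet> u)) *\<^sub>R u"
        unfolding stretch_def using \<xi> by (intro tendsto_intros z) auto
      then have "(\<lambda>k. F (stretch u (1 / real (Suc k) / norm \<xi>) x)) \<longlonglongrightarrow> F (perp_proj u x)" by (intro isCont_tendsto_compose[OF c]) simp
      then show "(\<lambda>k. std_normal_density (x \<bullet> u) * F (stretch u (1 / real (Suc k) / norm \<xi>) x)) \<longlonglongrightarrow> std_normal_density (x \<bullet> u) * F (perp_proj u x)"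
        by (intro tendsto_intros)
    qed
    show "AE x in lborel. norm (std_normal_density (x \<bullet> u) * F (stretch u (1 / real (Suc k) / norm \<xi>) x)) \<le> C * (gauss x / sqrt (2 * pi))" for k
      using smooth_radon_integrand_bound[OF u C] by (intro AE_I2)
  qed measurable
  then have "(\<lambda>k. (LBINT x. std_normal_density (x \<bullet> u) * F (stretch u (1 / real (Suc k) / norm \<xi>) x)) / norm \<xi>)
      \<longlonglongrightarrow> (LBINT x. std_normal_density (x \<bullet> u) * F (perp_proj u x)) / norm \<xi>"
    using \<xi> by (intro tendsto_intros) auto
  then show ?thesis
    unfolding radon_def by (simp add: smooth_radon_eq[OF admissible_measurable[OF F] \<xi>] integral_perp_lborel u u_def[symmetric])
qed

lemma smooth_radon_measurable[measurable]:
  fixes F :: "'a::euclidean_space \<Rightarrow> real"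
  assumes [measurable]: "F \<in> borel_measurable borel"
  shows "smooth_radon \<epsilon> F \<in> borel_measurable borel"
  unfolding smooth_radon_def[abs_def] by measurable

lemma radon_measurable:
  assumes F: "admissible F"
  shows "radon F \<in> borel_measurable borel"
proof (rule borel_measurable_LIMSEQ_real)
  have [measurable]: "F \<in> borel_measurable borel" using F by (rule admissible_measurable)
  show "(\<lambda>\<xi>. smooth_radon (1 / real (Suc k)) F \<xi> * indicator (- {0}) \<xi>) \<in> borel_measurable borel" for k
    by measurable
  show "(\<lambda>k. smooth_radon (1 / real (Suc k)) F \<xi> * indicator (- {0}) \<xi>) \<longlonglongrightarrow> radon F \<xi>" for \<xi>
    using smooth_radon_tendsto[OF F, of \<xi>] by (cases "\<xi> = 0") (auto simp: radon_def)
qed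

text \<open>
  Boundedness of the kernel reduces joint integrability to the integrability of the two factors.
\<close>

lemma Fubini_bounded_kernel:
  fixes F G :: "'a::euclidean_space \<Rightarrow> real" and k :: "'a \<Rightarrow> 'a \<Rightarrow> real"
  assumes iF: "integrable lborel F" and iG: "integrable lborel G"
    and k[measurable]: "(\<lambda>(x, y). k x y) \<in> borel_measurable (lborel \<Otimes>\<^sub>M lborel)"
    and N: "\<And>x y. \<bar>k x y\<bar> \<le> N"
  shows "(LBINT x. G x * (LBINT y. F y * k x y)) = (LBINT y. F y * (LBINT x. G x * k x y))"
proof -
  have [measurable]: "F \<in> borel_measurable borel" "G \<in> borel_measurable borel"
    using iF iG by auto
  have N0: "0 \<le> N" using N[of 0 0] by linarith
  define h where "h x y = G x * (F y * k x y)" for x y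
  have [measurable]: "(\<lambda>(x, y). h x y) \<in> borel_measurable (lborel \<Otimes>\<^sub>M lborel)"
    unfolding h_def[abs_def] by measurable
  have hb: "norm (h x y) \<le> \<bar>G x\<bar> * N * \<bar>F y\<bar>" for x y
    using mult_left_mono[OF N[of x y], of "\<bar>G x\<bar> * \<bar>F y\<bar>"] by (simp add: h_def abs_mult ac_simps)
  have ih: "integrable lborel (h x)" for x
  proof (rule Bochner_Integration.integrable_bound)
    show "integrable lborel (\<lambda>y. \<bar>G x\<bar> * N * \<bar>F y\<bar>)"
      using iF by (intro integrable_mult_right) simp
    show "AE y in lborel. norm (h x y) \<le> norm (\<bar>G x\<bar> * N * \<bar>F y\<bar>)"
      by (intro AE_I2 order_trans[OF hb]) simp
  qed measurable
  have int: "integrable (lborel \<Otimes>\<^sub>M lborel) (\<lambda>(x, y). h x y)"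
  proof (rule lborel_pair.Fubini_integrable)
    show "AE x in lborel. integrable lborel (\<lambda>y. case (x, y) of (x, y) \<Rightarrow> h x y)" using ih by simp
    have b: "norm (LBINT y. norm (h x y)) \<le> norm (\<bar>G x\<bar> * (N * (LBINT y. \<bar>F y\<bar>)))" for x
    proof -
      have "(LBINT y. norm (h x y)) \<le> (LBINT y. \<bar>G x\<bar> * N * \<bar>F y\<bar>)"
        using iF by (intro integral_mono integrable_norm ih hb) simp
      also have "\<dots> = \<bar>G x\<bar> * (N * (LBINT y. \<bar>F y\<bar>))"
        by simp
      finally show ?thesis using N0 by (simp add: abs_of_nonneg)
    qed
    have i: "integrable lborel (\<lambda>x. \<bar>G x\<bar> * (N * (LBINT y. \<bar>F y\<bar>)))"
      using iG by (intro integrable_mult_left) simp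
    have m: "(\<lambda>x. LBINT y. norm (h x y)) \<in> borel_measurable lborel"
      by measurable
    show "integrable lborel (\<lambda>x. LBINT y. norm (case (x, y) of (x, y) \<Rightarrow> h x y))"
      unfolding prod.case by (rule Bochner_Integration.integrable_bound[OF i m AE_I2[OF b]])
  qed measurable
  have "(LBINT x. G x * (LBINT y. F y * k x y)) = (LBINT x. (LBINT y. h x y))"
    unfolding h_def by (simp only: integral_mult_right_zero)
  also have "\<dots> = (LBINT y. (LBINT x. h x y))"
    by (rule lborel_pair.Fubini_integral[OF int, unfolded prod.case, symmetric])
  also have "\<dots> = (LBINT y. F y * (LBINT x. G x * k x y))"
    unfolding h_def mult.left_commute[of "G _" "F _"] by (simp only: integral_mult_right_zero)
  finally show ?thesis .
qed

lemma normal_density_le: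
  assumes "0 < \<epsilon>"
  shows "normal_density \<mu> \<epsilon> s \<le> 1 / sqrt (2 * pi * \<epsilon>\<^sup>2)"
proof -
  have "exp (- (s - \<mu>)\<^sup>2 / (2 * \<epsilon>\<^sup>2)) \<le> 1" by simp
  then show ?thesis unfolding normal_density_def
    using mult_left_mono[of "exp (- (s - \<mu>)\<^sup>2 / (2 * \<epsilon>\<^sup>2))" 1 "1 / sqrt (2 * pi * \<epsilon>\<^sup>2)"] by simp
qed

lemma smooth_radon_selfadjoint:
  fixes F G :: "'a::euclidean_space \<Rightarrow> real"
  assumes F: "integrable lborel F" and G: "integrable lborel G" and \<epsilon>: "0 < \<epsilon>"
  shows "(LBINT \<xi>. G \<xi> * smooth_radon \<epsilon> F \<xi>) = (LBINT y. F y * smooth_radon \<epsilon> G y)"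
proof -
  have "(LBINT \<xi>. G \<xi> * smooth_radon \<epsilon> F \<xi>)
      = (LBINT y. F y * (LBINT \<xi>. G \<xi> * normal_density 0 \<epsilon> (\<xi> \<bullet> y)))"
    unfolding smooth_radon_def
    by (rule Fubini_bounded_kernel[OF F G, where N="1 / sqrt (2 * pi * \<epsilon>\<^sup>2)"])
       (use normal_density_le[OF \<epsilon>, of 0] in simp_all)
  then show ?thesis unfolding smooth_radon_def by (simp only: inner_commute)
qed

lemma smooth_radon_integral_tendsto:
  fixes F G :: "'a::euclidean_space \<Rightarrow> real"
  assumes F: "admissible F" and G: "admissible G" and dim: "2 \<le> DIM('a)"
  shows "(\<lambda>k. LBINT \<xi>. G \<xi> * smooth_radon (1 / real (Suc k)) F \<xi>) \<longlonglongrightarrow> (LBINT \<xi>. G \<xi> * radon F \<xi>)"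
proof -
  have [measurable]: "F \<in> borel_measurable borel" "G \<in> borel_measurable borel" "radon F \<in> borel_measurable borel"
    using F G by (auto dest: admissible_measurable radon_measurable)
  obtain C where C: "0 \<le> C" "\<And>x. \<bar>F x\<bar> \<le> C * gauss x" using admissible_bound[OF F] by blast
  obtain D where D: "0 \<le> D" "\<And>x. \<bar>G x\<bar> \<le> D * gauss x" using admissible_bound[OF G] by blast
  have ne: "AE \<xi> in lborel. (\<xi>::'a) \<noteq> 0" by (rule AE_lborel_singleton)
  show ?thesis
  proof (rule integral_dominated_convergence[where w="\<lambda>\<xi>. D * C * gauss_mass TYPE('a) * (gauss \<xi> / norm \<xi>)"])
    show "integrable lborel (\<lambda>\<xi>::'a. D * C * gauss_mass TYPE('a) * (gauss \<xi> / norm \<xi>))"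
      by (intro integrable_mult_right integrable_gauss_div_norm[OF dim])
    show "AE \<xi> in lborel. (\<lambda>k. G \<xi> * smooth_radon (1 / real (Suc k)) F \<xi>) \<longlonglongrightarrow> G \<xi> * radon F \<xi>"
      using ne by eventually_elim (intro tendsto_intros smooth_radon_tendsto F)
    show "AE \<xi> in lborel. norm (G \<xi> * smooth_radon (1 / real (Suc k)) F \<xi>) \<le> D * C * gauss_mass TYPE('a) * (gauss \<xi> / norm \<xi>)" for k
      using ne
    proof eventually_elim
      fix \<xi> :: 'a assume "\<xi> \<noteq> 0"
      then have "\<bar>G \<xi>\<bar> * \<bar>smooth_radon (1 / real (Suc k)) F \<xi>\<bar> \<le> (D * gauss \<xi>) * (C * gauss_mass TYPE('a) / norm \<xi>)"
        by (intro mult_mono D smooth_radon_bound[OF F C]) (simp_all add: D less_imp_le)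
      then show "norm (G \<xi> * smooth_radon (1 / real (Suc k)) F \<xi>) \<le> D * C * gauss_mass TYPE('a) * (gauss \<xi> / norm \<xi>)"
        by (simp add: abs_mult ac_simps)
    qed
  qed measurable
qed

text \<open>
  The smoothed transform has the symmetric kernel \<open>normal_density 0 \<epsilon> (\<xi> \<bullet> y)\<close>, and both sides are limits for
  \<open>\<epsilon> \<longrightarrow> 0\<close>. The dimension enters through the integrability of the majorant \<open>gauss \<xi> / norm \<xi>\<close>.
\<close>

theorem radon_selfadjoint:
  fixes F G :: "'a::euclidean_space \<Rightarrow> real"
  assumes F: "admissible F" and G: "admissible G" and dim: "2 \<le> DIM('a)"
  shows "(LBINT \<xi>. G \<xi> * radon F \<xi>) = (LBINT y. F y * radon G y)"
proof (rule LIMSEQ_unique)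
  show "(\<lambda>k. LBINT \<xi>. G \<xi> * smooth_radon (1 / real (Suc k)) F \<xi>) \<longlonglongrightarrow> (LBINT \<xi>. G \<xi> * radon F \<xi>)"
    by (rule smooth_radon_integral_tendsto[OF F G dim])
  show "(\<lambda>k. LBINT \<xi>. G \<xi> * smooth_radon (1 / real (Suc k)) F \<xi>) \<longlonglongrightarrow> (LBINT y. F y * radon G y)"
    using smooth_radon_integral_tendsto[OF G F dim] by (simp add: smooth_radon_selfadjoint[OF F[THEN admissible_integrable] G[THEN admissible_integrable]])
qed

section \<open>Central slabs of a symmetric convex body\<close>

lemma nn_integral_lborel_uminus:
  fixes f :: "'a::euclidean_space \<Rightarrow> ennreal"
  assumes [measurable]: "f \<in> borel_measurable borel"
  shows "(\<integral>\<^sup>+x. f (- x) \<partial>lborel) = (\<integral>\<^sup>+x. f x \<partial>lborel)"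
proof -
  have "orthogonal_transformation (uminus :: 'a \<Rightarrow> 'a)"
    by (simp add: orthogonal_transformation_neg)
  then have "(\<integral>\<^sup>+x. f x \<partial>lborel) = (\<integral>\<^sup>+x. f x \<partial>distr lborel borel uminus)"
    by (simp add: lborel_distr_orthogonal)
  also have "\<dots> = (\<integral>\<^sup>+x. f (- x) \<partial>lborel)"
    by (rule nn_integral_distr) simp_all
  finally show ?thesis by simp
qed

lemma admissible_indicator:
  fixes K :: "'a::euclidean_space set"
  assumes "convex_body K"
  shows "admissible (indicator K :: 'a \<Rightarrow> real)"
  using admissible_body[OF assms, of "\<lambda>_. 1"] by simp

lemma smooth_radon_indicator_ennreal:
  fixes K :: "'a::euclidean_space set"
  assumes K: "convex_body K" and a: "0 < a"
  shows "ennreal (smooth_radon a (indicator K) \<xi>) = (\<integral>\<^sup>+x. indicator K x * ennreal (normal_density 0 a (\<xi> \<bullet> x)) \<partial>lborel)"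
proof -
  have [measurable]: "K \<in> sets borel" by (rule convex_body_measurable[OF K])
  have iK: "integrable lborel (indicator K :: 'a \<Rightarrow> real)"
    by (rule admissible_integrable[OF admissible_indicator[OF K]])
  have "integrable lborel (\<lambda>x. indicator K x * normal_density 0 a (\<xi> \<bullet> x))"
  proof (rule Bochner_Integration.integrable_bound)
    show "integrable lborel (\<lambda>x. 1 / sqrt (2 * pi * a\<^sup>2) * indicator K x :: real)"
      using iK by (rule integrable_mult_right)
    show "AE x in lborel. norm (indicator K x * normal_density 0 a (\<xi> \<bullet> x)) \<le> norm (1 / sqrt (2 * pi * a\<^sup>2) * indicator K x)"
      using normal_density_le[OF a, of 0] by (intro AE_I2) (simp split: split_indicator)
  qed measurable
  then have "ennreal (smooth_radon a (indicator K) \<xi>) = (\<integral>\<^sup>+x. ennreal (indicator K x * normal_density 0 a (\<xi> \<bullet> x)) \<partial>lborel)"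
    unfolding smooth_radon_def by (intro nn_integral_eq_integral[symmetric]) auto
  also have "\<dots> = (\<integral>\<^sup>+x. indicator K x * ennreal (normal_density 0 a (\<xi> \<bullet> x)) \<partial>lborel)"
    by (intro nn_integral_cong) (simp split: split_indicator)
  finally show ?thesis .
qed

lemma smooth_radon_indicator_nonneg:
  "0 < a \<Longrightarrow> 0 \<le> smooth_radon a (indicator K) \<xi>"
  unfolding smooth_radon_def by (intro integral_nonneg_AE AE_I2) auto

text \<open>
  Let \<open>g t\<close> be the mass of the Gaussian slab around \<open>\<xi> \<bullet> x = t\<close>. Prekopa-Leindler gives \<open>g t g(-t) \<le> (g 0)\<^sup>2\<close>, and
  \<open>g(-t) = g t\<close> as \<open>K\<close> is symmetric.
\<close>

lemma slab_central_max:
  assumes K: "convex_body K" and sym: "origin_symmetric K" and a: "0 < a"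
  shows "(\<integral>\<^sup>+x. indicator K x * ennreal (normal_density 0 a (\<xi> \<bullet> x - t)) \<partial>lborel)
    \<le> (\<integral>\<^sup>+x. indicator K x * ennreal (normal_density 0 a (\<xi> \<bullet> x)) \<partial>lborel)"
proof -
  have [measurable]: "K \<in> sets borel" by (rule convex_body_measurable[OF K])
  have neg: "- x \<in> K \<longleftrightarrow> x \<in> K" for x
    using sym unfolding origin_symmetric_def by (metis imageI minus_minus)
  define g where "g t = (\<integral>\<^sup>+x. indicator K x * ennreal (normal_density 0 a (\<xi> \<bullet> x - t)) \<partial>lborel)" for t
  have gm: "g (- t) = g t"
  proof -
    have "g (- t) = (\<integral>\<^sup>+x. indicator K (- x) * ennreal (normal_density 0 a (\<xi> \<bullet> (- x) - (- t))) \<partial>lborel)"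
      unfolding g_def by (rule nn_integral_lborel_uminus[symmetric]) simp
    also have "\<dots> = g t"
      unfolding g_def
      by (intro nn_integral_cong) (simp add: indicator_def neg normal_density_def power2_commute)
    finally show ?thesis .
  qed
  have "g t * g (- t) \<le> (g 0)\<^sup>2"
    unfolding g_def
  proof (rule Prekopa_Leindler)
    fix x y
    show "indicator K x * ennreal (normal_density 0 a (\<xi> \<bullet> x - t)) * (indicator K y * ennreal (normal_density 0 a (\<xi> \<bullet> y - - t)))
        \<le> (indicator K ((1 / 2) *\<^sub>R (x + y)) * ennreal (normal_density 0 a (\<xi> \<bullet> ((1 / 2) *\<^sub>R (x + y)) - 0)))\<^sup>2"
    proof (cases "x \<in> K \<and> y \<in> K")
      case True
      then have m: "(1 / 2) *\<^sub>R (x + y) \<in> K"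
        using K convexD[of K x y "1/2" "1/2"] by (auto simp: convex_body_def scaleR_add_right)
      define p q where "p = \<xi> \<bullet> x" and "q = \<xi> \<bullet> y"
      have "0 \<le> (p - q - 2 * t)\<^sup>2" by simp
      then have "2 * (((p + q) / 2)\<^sup>2) \<le> (p - t)\<^sup>2 + (q + t)\<^sup>2"
        by (simp add: power2_eq_square field_simps)
      then have "- (p - t)\<^sup>2 / (2 * a\<^sup>2) + - (q + t)\<^sup>2 / (2 * a\<^sup>2) \<le> - ((p + q) / 2)\<^sup>2 / (2 * a\<^sup>2) + - ((p + q) / 2)\<^sup>2 / (2 * a\<^sup>2)"
        unfolding add_divide_distrib[symmetric] by (intro divide_right_mono) auto
      then have "exp (- (p - t)\<^sup>2 / (2 * a\<^sup>2)) * exp (- (q + t)\<^sup>2 / (2 * a\<^sup>2)) \<le> (exp (- ((p + q) / 2)\<^sup>2 / (2 * a\<^sup>2)))\<^sup>2"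
        unfolding power2_eq_square[of "exp _"] exp_add[symmetric] by simp
      then have "normal_density 0 a (p - t) * normal_density 0 a (q + t) \<le> (normal_density 0 a ((p + q) / 2))\<^sup>2"
        unfolding normal_density_def
        using mult_left_mono[of "exp (- (p - t)\<^sup>2 / (2 * a\<^sup>2)) * exp (- (q + t)\<^sup>2 / (2 * a\<^sup>2))" "(exp (- ((p + q) / 2)\<^sup>2 / (2 * a\<^sup>2)))\<^sup>2" "(1 / sqrt (2 * pi * a\<^sup>2))\<^sup>2"]
        by (simp add: power_mult_distrib power2_eq_square[of "1 / _"] power_divide)
      then have "ennreal (normal_density 0 a (p - t) * normal_density 0 a (q + t)) \<le> ennreal ((normal_density 0 a ((p + q) / 2))\<^sup>2)"
        by (rule ennreal_leI)
      then show ?thesis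
        using True m by (simp add: ennreal_mult ennreal_power inner_add_right p_def q_def)
    qed auto
  qed measurable
  then have sq: "(g t)\<^sup>2 \<le> (g 0)\<^sup>2" by (simp add: gm power2_eq_square)
  have g0: "g 0 = ennreal (smooth_radon a (indicator K) \<xi>)"
    unfolding smooth_radon_indicator_ennreal[OF K a] g_def by simp
  have "g t \<le> g 0"
  proof (cases "g t" rule: ennreal_cases)
    case (real r)
    then have "ennreal (r\<^sup>2) \<le> ennreal ((smooth_radon a (indicator K) \<xi>)\<^sup>2)"
      using sq real(1) smooth_radon_indicator_nonneg[OF a, of K \<xi>]
      unfolding g0 real(2) by (simp only: ennreal_power)
    then have "r\<^sup>2 \<le> (smooth_radon a (indicator K) \<xi>)\<^sup>2"
      by (subst (asm) ennreal_le_iff) simp_all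
    then have "r \<le> smooth_radon a (indicator K) \<xi>"
      using smooth_radon_indicator_nonneg[OF a] by (rule power2_le_imp_le)
    then show ?thesis using real g0 by (simp add: ennreal_leI)
  next
    case top
    then show ?thesis using sq g0 smooth_radon_indicator_nonneg[OF a] by (simp add: ennreal_power top_unique power2_eq_square ennreal_mult_eq_top_iff)
  qed
  then show ?thesis by (simp add: g_def)
qed

text \<open>
  The wider normal density is the convolution of two copies of the narrower one, so the wider slab is an
  average of translates of the narrower slab.
\<close>

lemma slab_mono:
  assumes K: "convex_body K" and sym: "origin_symmetric K" and a: "0 < a"
  shows "smooth_radon (sqrt 2 * a) (indicator K) \<xi> \<le> smooth_radon a (indicator K) \<xi>"
proof -
  have [measurable]: "K \<in> sets borel" by (rule convex_body_measurable[OF K])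
  define g where "g t = (\<integral>\<^sup>+x. indicator K x * ennreal (normal_density 0 a (\<xi> \<bullet> x - t)) \<partial>lborel)" for t
  have s2: "sqrt (a\<^sup>2 + a\<^sup>2) = sqrt 2 * a" using a by (simp add: real_sqrt_mult flip: mult_2)
  have "ennreal (smooth_radon (sqrt 2 * a) (indicator K) \<xi>) = (\<integral>\<^sup>+x. indicator K x * ennreal (normal_density 0 (sqrt 2 * a) (\<xi> \<bullet> x)) \<partial>lborel)"
    using a by (intro smooth_radon_indicator_ennreal K) simp
  also have "\<dots> = (\<integral>\<^sup>+x. (\<integral>\<^sup>+t. indicator K x * ennreal (normal_density 0 a (\<xi> \<bullet> x - t)) * ennreal (normal_density 0 a t) \<partial>lborel) \<partial>lborel)"
  proof (rule nn_integral_cong)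
    fix x
    have "ennreal (normal_density 0 (sqrt 2 * a) (\<xi> \<bullet> x)) = (\<integral>\<^sup>+t. ennreal (normal_density 0 a (\<xi> \<bullet> x - t) * normal_density 0 a t) \<partial>lborel)"
      using fun_cong[OF conv_normal_density_zero_mean[OF a a], of "\<xi> \<bullet> x"] by (simp only: s2)
    then show "indicator K x * ennreal (normal_density 0 (sqrt 2 * a) (\<xi> \<bullet> x)) = (\<integral>\<^sup>+t. indicator K x * ennreal (normal_density 0 a (\<xi> \<bullet> x - t)) * ennreal (normal_density 0 a t) \<partial>lborel)"
      by (simp add: ennreal_mult mult.assoc nn_integral_cmult)
  qed
  also have "\<dots> = (\<integral>\<^sup>+t. (\<integral>\<^sup>+x. indicator K x * ennreal (normal_density 0 a (\<xi> \<bullet> x - t)) * ennreal (normal_density 0 a t) \<partial>lborel) \<partial>lborel)"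
    by (rule lborel_pair.Fubini') simp
  also have "\<dots> = (\<integral>\<^sup>+t. g t * ennreal (normal_density 0 a t) \<partial>lborel)"
    unfolding g_def by (simp add: nn_integral_multc)
  also have "\<dots> \<le> (\<integral>\<^sup>+t. g 0 * ennreal (normal_density 0 a t) \<partial>lborel)"
    using slab_central_max[OF K sym a, of \<xi>] by (intro nn_integral_mono mult_right_mono) (auto simp: g_def)
  also have "\<dots> = g 0 * (\<integral>\<^sup>+t. ennreal (normal_density 0 a t) \<partial>lborel)"
    by (rule nn_integral_cmult) simp
  also have "(\<integral>\<^sup>+t. ennreal (normal_density 0 a t) \<partial>lborel) = 1"
    using a by (subst nn_integral_eq_integral) auto
  also have "g 0 * 1 = ennreal (smooth_radon a (indicator K) \<xi>)"
    unfolding smooth_radon_indicator_ennreal[OF K a] g_def by simp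
  finally show ?thesis
    by (subst (asm) ennreal_le_iff) (simp_all add: smooth_radon_indicator_nonneg[OF a])
qed

lemma smooth_radon_bounded_continuous:
  fixes F :: "'a::euclidean_space \<Rightarrow> real"
  assumes F: "integrable lborel F" and a: "0 < a"
  shows "\<bar>smooth_radon a F \<xi>\<bar> \<le> (LBINT x. \<bar>F x\<bar>) / sqrt (2 * pi * a\<^sup>2)"
    and "continuous_on UNIV (smooth_radon a F)"
proof -
  have [measurable]: "F \<in> borel_measurable borel" using F by auto
  have b: "norm (F x * normal_density 0 a (\<xi> \<bullet> x)) \<le> \<bar>F x\<bar> / sqrt (2 * pi * a\<^sup>2)" for x \<xi>
    using mult_left_mono[OF normal_density_le[OF a, of 0 "\<xi> \<bullet> x"], of "\<bar>F x\<bar>"] by (simp add: abs_mult)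
  have i: "integrable lborel (\<lambda>x. \<bar>F x\<bar> / sqrt (2 * pi * a\<^sup>2))"
    using F by (intro integrable_divide_zero impI) simp
  have "\<bar>smooth_radon a F \<xi>\<bar> \<le> (LBINT x. norm (F x * normal_density 0 a (\<xi> \<bullet> x)))"
    unfolding smooth_radon_def
    using integral_norm_bound[of lborel "\<lambda>x. F x * normal_density 0 a (\<xi> \<bullet> x)"] by (simp only: real_norm_def)
  also have "\<dots> \<le> (LBINT x. \<bar>F x\<bar> / sqrt (2 * pi * a\<^sup>2))"
    by (rule integral_mono'[OF i b]) simp
  finally show "\<bar>smooth_radon a F \<xi>\<bar> \<le> (LBINT x. \<bar>F x\<bar>) / sqrt (2 * pi * a\<^sup>2)" by simp
  show "continuous_on UNIV (smooth_radon a F)"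
    unfolding continuous_on_sequentially comp_def
  proof (intro ballI allI impI, elim conjE)
    fix \<xi> and v :: "nat \<Rightarrow> 'a" assume lim: "v \<longlonglongrightarrow> \<xi>"
    show "(\<lambda>n. smooth_radon a F (v n)) \<longlonglongrightarrow> smooth_radon a F \<xi>"
      unfolding smooth_radon_def
    proof (rule integral_dominated_convergence[OF _ _ i])
      show "AE x in lborel. (\<lambda>n. F x * normal_density 0 a (v n \<bullet> x)) \<longlonglongrightarrow> F x * normal_density 0 a (\<xi> \<bullet> x)"
        unfolding normal_density_def using a by (intro AE_I2 tendsto_intros lim) auto
      show "AE x in lborel. norm (F x * normal_density 0 a (v n \<bullet> x)) \<le> \<bar>F x\<bar> / sqrt (2 * pi * a\<^sup>2)" for n
        by (intro AE_I2 b)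
    qed measurable
  qed
qed

text \<open>
  Along \<open>v\<close> the product of the Gaussian with the slab density is again a Gaussian of smaller width, that is,
  the Gaussian composed with a stretch by \<open>b = \<surd>(1 + (a/|v|)\<^sup>2)\<close> after the contraction in \<open>smooth_radon_eq\<close>.
\<close>

lemma smooth_radon_gauss:
  fixes v :: "'a::euclidean_space"
  assumes a: "0 < a"
  shows "smooth_radon a gauss v = gauss_mass TYPE('a) / sqrt (a\<^sup>2 + (norm v)\<^sup>2)"
proof (cases "v = 0")
  case True
  then show ?thesis using a
    by (simp add: smooth_radon_def gauss_mass_def normal_density_def real_sqrt_mult)
next
  case False
  define u c b where "u = sgn v" and "c = a / norm v" and "b = sqrt (1 + c\<^sup>2)"
  have u: "norm u = 1" using False by (simp add: u_def norm_sgn)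
  have b: "0 < b" "b\<^sup>2 = 1 + c\<^sup>2" by (auto simp: b_def add_pos_nonneg)
  have "std_normal_density (x \<bullet> u) * gauss (stretch u c x) = gauss (stretch u b x) / sqrt (2 * pi)" for x
    unfolding std_normal_density_def gauss_def stretch_def norm_sq_decomp(1)[OF u]
    by (simp add: power_mult_distrib b(2) exp_add[symmetric] field_simps)
  then have "smooth_radon a gauss v = (LBINT x. gauss (stretch u b x) / sqrt (2 * pi)) / norm v"
    by (subst smooth_radon_eq[OF gauss_measurable False a]) (simp add: u_def c_def)
  also have "\<dots> = (LBINT x. gauss (x::'a)) / b / sqrt (2 * pi) / norm v"
    using integral_stretch[OF u b(1) gauss_measurable] b(1) by simp
  also have "\<dots> = gauss_mass TYPE('a) / (b * norm v)" by (simp add: gauss_mass_def)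
  also have "b * norm v = sqrt (a\<^sup>2 + (norm v)\<^sup>2)"
  proof -
    have "b * norm v = sqrt ((1 + c\<^sup>2) * (norm v)\<^sup>2)" by (simp add: b_def real_sqrt_mult)
    also have "(1 + c\<^sup>2) * (norm v)\<^sup>2 = a\<^sup>2 + (norm v)\<^sup>2"
      using False by (simp add: c_def power_divide distrib_right)
    finally show ?thesis .
  qed
  finally show ?thesis .
qed

lemma perp_proj_inner: "perp_proj u z \<bullet> x = perp_proj u x \<bullet> z"
  by (simp add: perp_proj_def inner_diff_left inner_diff_right inner_commute)

lemma gauss_mass_pos: "0 < gauss_mass TYPE('a::euclidean_space)"
proof -
  have "(LBINT x. gauss (x::'a)) \<noteq> 0"
  proof
    assume "(LBINT x. gauss (x::'a)) = 0"
    then have "AE x::'a in lborel. gauss x = 0"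
      by (subst (asm) integral_nonneg_eq_0_iff_AE[OF integrable_gauss]) (simp_all add: less_imp_le)
    then have "AE x::'a in lborel. False"
      by eventually_elim (simp add: gauss_def)
    then have "emeasure lborel (UNIV :: 'a set) = 0"
      by (subst (asm) AE_iff_measurable[where N=UNIV]) auto
    then show False by simp
  qed
  moreover have "0 \<le> (LBINT x. gauss (x::'a))"
    by (intro integral_nonneg_AE AE_I2) (simp add: less_imp_le)
  ultimately show ?thesis by (simp add: gauss_mass_def)
qed

text \<open>
  Exchanging the integrals over \<open>w\<close> and over \<open>x \<in> K\<close> leaves a Gaussian integral in which \<open>x\<close> occurs only through
  its projection, so the slabs of \<open>K\<close> turn into a function of the distance to the axis \<open>\<real> u\<close>.
\<close>

lemma perp_lborel_gauss_slab:
  fixes K :: "'a::euclidean_space set"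
  assumes K: "convex_body K" and u: "norm u = 1" and a: "0 < a"
  shows "(\<integral>w. gauss w * smooth_radon a (indicator K) w \<partial>perp_lborel u)
    = gauss_mass TYPE('a) / sqrt (2 * pi) * (LBINT x. indicator K x / sqrt (a\<^sup>2 + (norm (perp_proj u x))\<^sup>2))"
proof -
  have [measurable]: "K \<in> sets borel" by (rule convex_body_measurable[OF K])
  have iK: "integrable lborel (indicator K :: 'a \<Rightarrow> real)"
    by (rule admissible_integrable[OF admissible_indicator[OF K]])
  have "(\<integral>w. gauss w * smooth_radon a (indicator K) w \<partial>perp_lborel u)
      = (LBINT z. std_normal_density (z \<bullet> u) * (gauss (perp_proj u z) * smooth_radon a (indicator K) (perp_proj u z)))"
    by (rule integral_perp_lborel(1)[OF u]) measurable
  also have "\<dots> = (LBINT z. gauss z / sqrt (2 * pi) * (LBINT x. indicator K x * normal_density 0 a (perp_proj u z \<bullet> x)))"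
    unfolding mult.assoc[symmetric] gauss_perp_proj[OF u] smooth_radon_def ..
  also have "\<dots> = (LBINT x. indicator K x * (LBINT z. gauss z / sqrt (2 * pi) * normal_density 0 a (perp_proj u z \<bullet> x)))"
    using normal_density_le[OF a, of 0]
    by (intro Fubini_bounded_kernel[where N="1 / sqrt (2 * pi * a\<^sup>2)"] iK integrable_divide_zero impI integrable_gauss) auto
  also have "\<dots> = (LBINT x. gauss_mass TYPE('a) / sqrt (2 * pi) * (indicator K x / sqrt (a\<^sup>2 + (norm (perp_proj u x))\<^sup>2)))"
  proof (rule Bochner_Integration.integral_cong[OF refl])
    fix x
    have "(LBINT z. gauss z / sqrt (2 * pi) * normal_density 0 a (perp_proj u z \<bullet> x)) = smooth_radon a gauss (perp_proj u x) / sqrt (2 * pi)"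
      unfolding smooth_radon_def perp_proj_inner[of u _ x] by simp
    then show "indicator K x * (LBINT z. gauss z / sqrt (2 * pi) * normal_density 0 a (perp_proj u z \<bullet> x))
        = gauss_mass TYPE('a) / sqrt (2 * pi) * (indicator K x / sqrt (a\<^sup>2 + (norm (perp_proj u x))\<^sup>2))"
      by (simp add: smooth_radon_gauss[OF a] ac_simps)
  qed
  finally show ?thesis by (simp only: integral_mult_right_zero)
qed

lemma admissible_integrable_perp_lborel:
  assumes F: "admissible F" and u: "norm u = 1"
  shows "integrable (perp_lborel u) F"
proof -
  have [measurable]: "F \<in> borel_measurable borel" using F by (rule admissible_measurable)
  obtain C where C: "0 \<le> C" "\<And>x. \<bar>F x\<bar> \<le> C * gauss x" using admissible_bound[OF F] by blast
  have "integrable lborel (\<lambda>x. std_normal_density (x \<bullet> u) * F (perp_proj u x))"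
  proof (rule Bochner_Integration.integrable_bound[OF integrable_gauss_scaled])
    have "stretch u 0 x = perp_proj u x" for x by (simp add: stretch_def)
    then show "AE x in lborel. norm (std_normal_density (x \<bullet> u) * F (perp_proj u x)) \<le> norm (C * (gauss x / sqrt (2 * pi)))"
      using smooth_radon_integrand_bound[OF u C, of _ 0]
      by (intro AE_I2) (metis abs_ge_self order_trans real_norm_def)
  qed measurable
  then show ?thesis by (simp add: integral_perp_lborel(2)[OF u])
qed

text \<open>
  The kernel that arises from the difference of the slabs of widths \<open>a\<close> and \<open>\<surd>2 a\<close>; \<open>v\<close> is the component
  orthogonal to the axis. Taking two widths of fixed ratio makes it decay like \<open>a\<^sup>2/|v|\<^sup>3\<close> instead of \<open>1/|v|\<close>.
\<close>

definition slab_kernel :: "real \<Rightarrow> 'a::euclidean_space \<Rightarrow> real" where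
  "slab_kernel a v = 1 / sqrt (a\<^sup>2 + (norm v)\<^sup>2) - 1 / sqrt (2 * a\<^sup>2 + (norm v)\<^sup>2)"

lemma slab_kernel_measurable[measurable]: "slab_kernel a \<in> borel_measurable borel"
  unfolding slab_kernel_def[abs_def] by measurable

definition axis_mass :: "real \<Rightarrow> 'a::euclidean_space set \<Rightarrow> 'a \<Rightarrow> real" where
  "axis_mass a K u = (LBINT x. indicator K x * slab_kernel a (perp_proj u x))"

lemma integrable_indicator_div_sqrt:
  fixes K :: "'a::euclidean_space set"
  assumes K: "integrable lborel (indicator K :: 'a \<Rightarrow> real)" and [measurable]: "K \<in> sets borel" and a: "0 < a"
  shows "integrable lborel (\<lambda>x. indicator K x / sqrt (a\<^sup>2 + (norm (perp_proj u x))\<^sup>2))"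
proof (rule Bochner_Integration.integrable_bound)
  show "integrable lborel (\<lambda>x. 1 / a * indicator K x :: real)"
    using K by (rule integrable_mult_right)
  have "1 / sqrt (a\<^sup>2 + (norm (perp_proj u x))\<^sup>2) \<le> 1 / a" for x
    using a by (intro divide_left_mono real_le_rsqrt) (auto intro!: mult_pos_pos add_pos_nonneg)
  then show "AE x in lborel. norm (indicator K x / sqrt (a\<^sup>2 + (norm (perp_proj u x))\<^sup>2)) \<le> norm (1 / a * indicator K x)"
    using a by (intro AE_I2) (auto split: split_indicator)
qed measurable

lemma slab_kernel_alt:
  "0 < a \<Longrightarrow> slab_kernel a v = 1 / sqrt (a\<^sup>2 + (norm v)\<^sup>2) - 1 / sqrt ((sqrt 2 * a)\<^sup>2 + (norm v)\<^sup>2)"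
  by (simp add: slab_kernel_def power_mult_distrib)

lemma axis_mass_eq:
  fixes K :: "'a::euclidean_space set"
  assumes K: "integrable lborel (indicator K :: 'a \<Rightarrow> real)" and m: "K \<in> sets borel" and a: "0 < a"
  shows "axis_mass a K u = (LBINT x. indicator K x / sqrt (a\<^sup>2 + (norm (perp_proj u x))\<^sup>2))
    - (LBINT x. indicator K x / sqrt ((sqrt 2 * a)\<^sup>2 + (norm (perp_proj u x))\<^sup>2))"
    and "integrable lborel (\<lambda>x. indicator K x * slab_kernel a (perp_proj u x))"
proof -
  have a': "0 < sqrt 2 * a" using a by simp
  have eq: "indicator K x * slab_kernel a (perp_proj u x)
      = indicator K x / sqrt (a\<^sup>2 + (norm (perp_proj u x))\<^sup>2) - indicator K x / sqrt ((sqrt 2 * a)\<^sup>2 + (norm (perp_proj u x))\<^sup>2)" for x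
    unfolding slab_kernel_alt[OF a] right_diff_distrib times_divide_eq_right mult_1_right ..
  note i = integrable_indicator_div_sqrt[OF K m a, of u] integrable_indicator_div_sqrt[OF K m a', of u]
  show "axis_mass a K u = (LBINT x. indicator K x / sqrt (a\<^sup>2 + (norm (perp_proj u x))\<^sup>2))
    - (LBINT x. indicator K x / sqrt ((sqrt 2 * a)\<^sup>2 + (norm (perp_proj u x))\<^sup>2))"
    unfolding axis_mass_def eq by (rule Bochner_Integration.integral_diff[OF i])
  show "integrable lborel (\<lambda>x. indicator K x * slab_kernel a (perp_proj u x))"
    unfolding eq by (rule Bochner_Integration.integrable_diff[OF i])
qed

text \<open>
  Self-adjointness moves the Radon transform from the Gaussian weight times the difference of the slabs,
  which is nonnegative, to \<open>H\<close>, where it is nonpositive by assumption.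
\<close>

lemma axis_mass_inequality:
  fixes K :: "'a::euclidean_space set"
  assumes K: "convex_body K" and sym: "origin_symmetric K" and a: "0 < a" and dim: "2 \<le> DIM('a)"
    and H: "admissible H" and neg: "\<And>u. norm u = 1 \<Longrightarrow> (\<integral>w. H w \<partial>perp_lborel u) \<le> 0"
  shows "(LBINT y. H y * (axis_mass a K (sgn y) / norm y)) \<le> 0"
proof -
  have m: "K \<in> sets borel" by (rule convex_body_measurable[OF K])
  have iK: "integrable lborel (indicator K :: 'a \<Rightarrow> real)"
    by (rule admissible_integrable[OF admissible_indicator[OF K]])
  have a': "0 < sqrt 2 * a" using a by simp
  define S where "S b x = gauss x * smooth_radon b (indicator K) x" for b and x :: 'a
  have S: "admissible (S b)" if "0 < b" for b
    unfolding S_def using smooth_radon_bounded_continuous[OF iK that] by (intro admissible_gauss_times) auto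
  define G where "G x = S a x + (- 1) * S (sqrt 2 * a) x" for x
  have G: "admissible G"
    unfolding G_def by (intro admissible_add admissible_cmult S a a')
  have G0: "0 \<le> G x" for x
  proof -
    have "0 \<le> gauss x * (smooth_radon a (indicator K) x - smooth_radon (sqrt 2 * a) (indicator K) x)"
      using slab_mono[OF K sym a, of x] by (intro mult_nonneg_nonneg) (auto simp: less_imp_le)
    then show ?thesis by (simp add: G_def S_def right_diff_distrib)
  qed
  define c where "c = gauss_mass TYPE('a) / sqrt (2 * pi)"
  have c: "0 < c" using gauss_mass_pos[where 'a='a] by (simp add: c_def)
  have radG: "radon G y = c * (axis_mass a K (sgn y) / norm y)" if "y \<noteq> 0" for y
  proof -
    have u: "norm (sgn y) = 1" using that by (simp add: norm_sgn)
    have "(\<integral>w. G w \<partial>perp_lborel (sgn y)) = (\<integral>w. S a w \<partial>perp_lborel (sgn y)) - (\<integral>w. S (sqrt 2 * a) w \<partial>perp_lborel (sgn y))"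
      unfolding G_def using admissible_integrable_perp_lborel[OF S u] a a' by simp
    also have "\<dots> = c * axis_mass a K (sgn y)"
      unfolding S_def perp_lborel_gauss_slab[OF K u a] perp_lborel_gauss_slab[OF K u a'] axis_mass_eq[OF iK m a] c_def[symmetric]
      by (simp add: right_diff_distrib)
    finally show ?thesis by (simp add: radon_def)
  qed
  have "(LBINT \<xi>. G \<xi> * radon H \<xi>) \<le> 0"
  proof -
    have "radon H \<xi> \<le> 0" for \<xi>
    proof (cases "\<xi> = 0")
      case False
      then show ?thesis using neg[of "sgn \<xi>"] by (simp add: radon_def norm_sgn divide_nonpos_pos)
    qed (simp add: radon_def)
    then have "0 \<le> (LBINT \<xi>. - (G \<xi> * radon H \<xi>))"
      using G0 by (intro integral_nonneg_AE AE_I2) (simp add: mult_nonneg_nonpos)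
    then show ?thesis by simp
  qed
  then have "0 \<ge> (LBINT y. H y * radon G y)"
    by (simp add: radon_selfadjoint[OF H G dim])
  also have "(LBINT y. H y * radon G y) = (LBINT y. c * (H y * (axis_mass a K (sgn y) / norm y)))"
  proof (rule Bochner_Integration.integral_cong_AE)
    have [measurable]: "H \<in> borel_measurable borel" "radon G \<in> borel_measurable borel" "K \<in> sets borel"
      using H G m by (auto intro: admissible_measurable radon_measurable)
    show "(\<lambda>y. H y * radon G y) \<in> borel_measurable lborel" by measurable
    show "(\<lambda>y. c * (H y * (axis_mass a K (sgn y) / norm y))) \<in> borel_measurable lborel"
      unfolding axis_mass_def perp_proj_def by measurable
    have "AE y in lborel. (y::'a) \<noteq> 0" by (rule AE_lborel_singleton)
    then show "AE y in lborel. H y * radon G y = c * (H y * (axis_mass a K (sgn y) / norm y))"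
      by eventually_elim (simp add: radG)
  qed
  also have "(LBINT y. c * (H y * (axis_mass a K (sgn y) / norm y))) = c * (LBINT y. H y * (axis_mass a K (sgn y) / norm y))"
    by (rule integral_mult_right_zero)
  finally show ?thesis using c by (simp only: mult_le_0_iff) auto
qed

section \<open>Mass of the kernels near an axis\<close>

text \<open>
  Rationalizing the difference of the reciprocal roots exhibits the order \<open>a\<^sup>2/|v|\<^sup>3\<close> of the kernel.
\<close>

lemma slab_kernel_product_form:
  assumes a: "0 < a" and v: "v \<noteq> 0"
  obtains A B where "slab_kernel a v = a\<^sup>2 / (A * B * (A + B))" "norm v \<le> A" "norm v \<le> B" "0 < A" "0 < B"
    "a \<le> norm v \<Longrightarrow> A \<le> 2 * norm v" "a \<le> norm v \<Longrightarrow> B \<le> 2 * norm v"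
proof -
  define A B where "A = sqrt (a\<^sup>2 + (norm v)\<^sup>2)" and "B = sqrt (2 * a\<^sup>2 + (norm v)\<^sup>2)"
  have AB: "0 < A" "0 < B" using a by (auto simp: A_def B_def add_pos_nonneg)
  have "B\<^sup>2 - A\<^sup>2 = a\<^sup>2" by (simp add: A_def B_def)
  then have "slab_kernel a v = (B\<^sup>2 - A\<^sup>2) / (A * B * (A + B)) \<and> B\<^sup>2 - A\<^sup>2 = a\<^sup>2"
    using AB unfolding slab_kernel_def A_def[symmetric] B_def[symmetric]
    by (simp add: divide_simps) (simp add: algebra_simps power2_eq_square)
  moreover have "norm v \<le> A" "norm v \<le> B" by (auto simp: A_def B_def intro!: real_le_rsqrt)
  moreover have "A \<le> 2 * norm v" "B \<le> 2 * norm v" if "a \<le> norm v"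
  proof -
    have "a\<^sup>2 \<le> (norm v)\<^sup>2" using that a by (intro power_mono) auto
    then show "A \<le> 2 * norm v" "B \<le> 2 * norm v"
      unfolding A_def B_def using zero_le_power2[of "norm v"]
      by (intro real_le_lsqrt; simp add: power_mult_distrib; linarith)+
  qed
  ultimately show thesis using that[of A B] AB by auto
qed

lemma slab_kernel_nonneg: "0 < a \<Longrightarrow> 0 \<le> slab_kernel a v"
  unfolding slab_kernel_def by (auto intro!: divide_left_mono mult_pos_pos add_pos_nonneg)

lemma slab_kernel_le:
  assumes a: "0 < a" and d: "0 < d" "d \<le> norm v"
  shows "slab_kernel a v \<le> a\<^sup>2 / (2 * d ^ 3)"
proof -
  have v: "v \<noteq> 0" using d by auto
  obtain A B where *: "slab_kernel a v = a\<^sup>2 / (A * B * (A + B))" "norm v \<le> A" "norm v \<le> B" "0 < A" "0 < B"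
    using slab_kernel_product_form[OF a v] by metis
  have "d * d * (d + d) \<le> A * B * (A + B)"
    using * d by (intro mult_mono add_mono) auto
  then have "2 * d ^ 3 \<le> A * B * (A + B)" by (simp add: power3_eq_cube)
  then show ?thesis unfolding *(1) using d * by (intro divide_left_mono mult_pos_pos) auto
qed

lemma slab_kernel_ge:
  assumes a: "0 < a" "a \<le> norm v"
  shows "a\<^sup>2 / (16 * norm v ^ 3) \<le> slab_kernel a v"
proof -
  have v: "v \<noteq> 0" using a by auto
  obtain A B where *: "slab_kernel a v = a\<^sup>2 / (A * B * (A + B))" "0 < A" "0 < B" "A \<le> 2 * norm v" "B \<le> 2 * norm v"
    using slab_kernel_product_form[OF a(1) v] a(2) by metis
  have "A * B * (A + B) \<le> (2 * norm v) * (2 * norm v) * (2 * norm v + 2 * norm v)"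
    using * by (intro mult_mono add_mono) auto
  then have "A * B * (A + B) \<le> 16 * norm v ^ 3" by (simp add: power3_eq_cube)
  then show ?thesis unfolding *(1) using * v by (intro divide_left_mono mult_pos_pos) auto
qed

text \<open>
  Cylinders with axis \<open>\<real> u\<close> serve as test sets: their mass is proportional to \<open>c\<close>, and near the axis a
  convex body looks like a cylinder.
\<close>

definition cylinder :: "'a::euclidean_space \<Rightarrow> real \<Rightarrow> real \<Rightarrow> 'a set" where
  "cylinder u c r = {x. \<bar>x \<bullet> u\<bar> \<le> c \<and> norm (perp_proj u x) \<le> r}"

lemma cylinder_measurable[measurable]: "cylinder u c r \<in> sets borel"
  unfolding cylinder_def by measurable

lemma integrable_indicator_bounded:
  fixes S :: "'a::euclidean_space set"
  assumes "S \<in> sets borel" "bounded S"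
  shows "integrable lborel (indicator S :: 'a \<Rightarrow> real)"
  using assms emeasure_bounded_finite[of S] by (simp add: integrable_indicator_iff less_top)

lemma bounded_cylinder: "norm u = 1 \<Longrightarrow> bounded (cylinder u c r)"
proof (rule boundedI)
  fix x assume u: "norm u = 1" and x: "x \<in> cylinder u c r"
  have "norm x \<le> norm (perp_proj u x) + norm ((x \<bullet> u) *\<^sub>R u)"
    using norm_triangle_ineq[of "perp_proj u x" "(x \<bullet> u) *\<^sub>R u"] by (simp add: perp_proj_def)
  then show "norm x \<le> r + c" using x u by (auto simp: cylinder_def)
qed

lemma integrable_cylinder: "norm u = 1 \<Longrightarrow> integrable lborel (indicator (cylinder u c r) :: _ \<Rightarrow> real)"
  by (intro integrable_indicator_bounded bounded_cylinder cylinder_measurable)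

lemma measure_cylinder:
  fixes u :: "'a::euclidean_space"
  assumes u: "norm u = 1" and r: "0 < r"
  shows "measure lborel (cylinder u 1 r) = 2 * unit_ball_vol (real (DIM('a) - 1)) * r ^ (DIM('a) - 1)"
proof -
  have uu: "u \<bullet> u = 1" using u by (simp add: dot_square_norm)
  have "emeasure lborel (cylinder u 1 r) = (\<integral>\<^sup>+x. indicator (cylinder u 1 r) x \<partial>lborel)" by simp
  also have "\<dots> = (\<integral>\<^sup>+w. (\<integral>\<^sup>+s. indicator (cylinder u 1 r) (w + s *\<^sub>R u) \<partial>lborel) \<partial>perp_lborel u)"
    by (rule nn_integral_lborel_perp_lborel[OF u]) simp
  also have "\<dots> = (\<integral>\<^sup>+w. 2 * indicator (cball 0 r) w \<partial>perp_lborel u)"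
  proof (rule nn_integral_cong_AE, use AE_perp_lborel_perp[OF u] in eventually_elim)
    fix w assume w: "w \<bullet> u = 0"
    have "perp_proj u (w + s *\<^sub>R u) = w" "(w + s *\<^sub>R u) \<bullet> u = s" for s
      by (simp_all add: perp_proj_def inner_add_left w uu)
    then have "(\<integral>\<^sup>+s. indicator (cylinder u 1 r) (w + s *\<^sub>R u) \<partial>lborel) = (\<integral>\<^sup>+s. indicator {-1..1::real} s * indicator (cball 0 r) w \<partial>lborel)"
      by (intro nn_integral_cong) (auto simp: cylinder_def indicator_def)
    then show "(\<integral>\<^sup>+s. indicator (cylinder u 1 r) (w + s *\<^sub>R u) \<partial>lborel) = 2 * indicator (cball 0 r) w"
      by (simp add: nn_integral_multc)
  qed
  also have "\<dots> = 2 * (\<integral>\<^sup>+w. indicator (cball 0 r) w \<partial>perp_lborel u)"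
    by (rule nn_integral_cmult, rule borel_measurable_indicator) simp
  also have "(\<integral>\<^sup>+w. indicator (cball 0 r) w \<partial>perp_lborel u) = ennreal (unit_ball_vol (real (DIM('a) - 1)) * r ^ (DIM('a) - 1))"
    using emeasure_perp_lborel_cball[OF u r] by (subst nn_integral_indicator) simp_all
  also have "2 * ennreal (unit_ball_vol (real (DIM('a) - 1)) * r ^ (DIM('a) - 1)) = ennreal (2 * unit_ball_vol (real (DIM('a) - 1)) * r ^ (DIM('a) - 1))"
    using r by (simp add: ennreal_mult mult.assoc)
  finally show ?thesis using r by (simp add: measure_def)
qed

lemma axis_mass_cylinder_scale:
  assumes u: "norm u = 1" and c: "0 < c"
  shows "axis_mass a (cylinder u c r) u = c * axis_mass a (cylinder u 1 r) u"
proof -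
  have uu: "u \<bullet> u = 1" using u by (simp add: dot_square_norm)
  have st: "perp_proj u (stretch u c x) = perp_proj u x" "stretch u c x \<bullet> u = c * (x \<bullet> u)" for x
    by (simp_all add: stretch_def perp_proj_def inner_add_left inner_diff_left uu algebra_simps)
  have "indicator (cylinder u c r) (stretch u c x) = (indicator (cylinder u 1 r) x :: real)" for x
    using c by (simp add: indicator_def cylinder_def st abs_mult)
  moreover have "axis_mass a (cylinder u c r) u = c * (LBINT x. indicator (cylinder u c r) (stretch u c x) * slab_kernel a (perp_proj u (stretch u c x)))"
    unfolding axis_mass_def by (rule integral_stretch[OF u c]) measurable
  ultimately show ?thesis by (simp add: st axis_mass_def)
qed

text \<open>
  The reflection in the hyperplane orthogonal to \<open>u - v\<close>.
\<close>

lemma orthogonal_transformation_unit_vectors: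
  fixes u v :: "'a::euclidean_space"
  assumes u: "norm u = 1" and v: "norm v = 1"
  obtains T :: "'a \<Rightarrow> 'a" where "orthogonal_transformation T" "T u = v"
proof (cases "u = v")
  case True
  then show thesis using that[of "\<lambda>x. x"] by simp
next
  case False
  define d where "d = u - v"
  have d: "d \<bullet> d \<noteq> 0" using False by (simp add: d_def)
  define T where "T x = x - (2 * (x \<bullet> d) / (d \<bullet> d)) *\<^sub>R d" for x
  have "linear T"
    unfolding T_def by (intro linearI) (simp_all add: algebra_simps inner_add_left add_divide_distrib)
  moreover have "T x \<bullet> T y = x \<bullet> y" for x y
    using d unfolding T_def
    by (simp add: inner_diff_left inner_diff_right inner_commute field_simps)
  ultimately have "orthogonal_transformation T" by (simp add: orthogonal_transformation_def)
  moreover have "T u = v"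
  proof -
    have "u \<bullet> u = 1" "v \<bullet> v = 1" using u v by (simp_all add: dot_square_norm)
    then have "2 * (u \<bullet> d) = d \<bullet> d" by (simp add: d_def inner_diff_left inner_diff_right inner_commute)
    then show ?thesis using d by (simp add: T_def d_def)
  qed
  ultimately show thesis by (rule that)
qed

lemma axis_mass_cylinder_rotate:
  fixes u v :: "'a::euclidean_space"
  assumes u: "norm u = 1" and v: "norm v = 1"
  shows "axis_mass a (cylinder v c r) v = axis_mass a (cylinder u c r) u"
proof -
  obtain T :: "'a \<Rightarrow> 'a" where T: "orthogonal_transformation T" "T u = v"
    using orthogonal_transformation_unit_vectors[OF u v] by metis
  have lin: "linear T" using T(1) by (rule orthogonal_transformation_linear)
  have [measurable]: "T \<in> borel \<rightarrow>\<^sub>M borel"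
    using lin by (intro borel_measurable_continuous_onI linear_continuous_on) (simp add: linear_conv_bounded_linear)
  have dot: "T x \<bullet> v = x \<bullet> u" for x
    using T by (metis orthogonal_transformation_def)
  have pr: "norm (perp_proj v (T x)) = norm (perp_proj u x)" for x
  proof -
    have "perp_proj v (T x) = T (perp_proj u x)"
      using lin by (simp add: perp_proj_def dot linear_diff linear_scale T(2))
    then show ?thesis using T(1) by (simp add: orthogonal_transformation_norm)
  qed
  have "axis_mass a (cylinder v c r) v = (\<integral>x. indicator (cylinder v c r) x * slab_kernel a (perp_proj v x) \<partial>distr lborel borel T)"
    unfolding axis_mass_def lborel_distr_orthogonal[OF T(1)] ..
  also have "\<dots> = (LBINT x. indicator (cylinder v c r) (T x) * slab_kernel a (perp_proj v (T x)))"
    by (rule integral_distr) measurable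
  also have "\<dots> = axis_mass a (cylinder u c r) u"
    unfolding axis_mass_def by (simp add: cylinder_def slab_kernel_def dot pr indicator_def)
  finally show ?thesis .
qed

text \<open>
  This is where \<open>n \<le> 4\<close> is essential. At distance about \<open>2\<^sup>-\<^sup>k\<close> from the axis the kernel is at least \<open>8\<^sup>k a\<^sup>2/16\<close>, and
  the shell has volume at least \<open>\<kappa> 2\<^sup>-\<^sup>k\<^sup>(\<^sup>n\<^sup>-\<^sup>1\<^sup>) \<ge> \<kappa> 8\<^sup>-\<^sup>k\<close>. So every dyadic shell contributes at least
  \<open>\<kappa> a\<^sup>2/16\<close>, where \<open>\<kappa>\<close> is the volume of the unit ball of dimension \<open>n - 1\<close>.
\<close>

lemma axis_mass_shell:
  fixes u :: "'a::euclidean_space"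
  assumes u: "norm u = 1" and a: "0 < a" "a \<le> (1/2) ^ Suc k" and dim: "2 \<le> DIM('a)" "DIM('a) \<le> 4"
  shows "axis_mass a (cylinder u 1 ((1/2) ^ Suc k)) u + a\<^sup>2 / 16 * unit_ball_vol (real (DIM('a) - 1)) \<le> axis_mass a (cylinder u 1 ((1/2) ^ k)) u"
proof -
  define C where "C k = cylinder u 1 ((1/2) ^ k)" for k :: nat
  define \<kappa> where "\<kappa> = unit_ball_vol (real (DIM('a) - 1))"
  have \<kappa>: "0 < \<kappa>" by (simp add: \<kappa>_def)
  define n where "n = DIM('a) - 1"
  have n: "1 \<le> n" "n \<le> 3" using dim by (auto simp: n_def)
  have sub: "C (Suc k) \<subseteq> C k"
    unfolding C_def cylinder_def using order_trans[OF _ power_decreasing[of k "Suc k" "1/2::real"]]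
    by (auto simp del: power_Suc)
  have iC: "integrable lborel (indicator (C j) :: 'a \<Rightarrow> real)" for j
    unfolding C_def by (rule integrable_cylinder[OF u])
  have [measurable]: "C j \<in> sets borel" for j by (simp add: C_def)
  have i: "integrable lborel (\<lambda>x. indicator (C j) x * slab_kernel a (perp_proj u x))" for j
    by (rule axis_mass_eq(2)[OF iC _ a(1)]) simp
  have mC: "measure lborel (C j) = 2 * \<kappa> * ((1/2) ^ j) ^ n" for j
    unfolding C_def \<kappa>_def n_def by (rule measure_cylinder[OF u]) simp
  have e8: "8 ^ k * ((1/2::real) ^ k) ^ 3 = 1"
  proof -
    have "((1/2::real) ^ k) ^ 3 = ((1/2) ^ 3) ^ k" by (simp only: power_mult[symmetric] mult.commute)
    then have "8 ^ k * ((1/2::real) ^ k) ^ 3 = (8 * (1/2) ^ 3) ^ k" by (simp only: power_mult_distrib)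
    then show ?thesis by (simp add: power3_eq_cube)
  qed
  have "\<kappa> \<le> 8 ^ k * (measure lborel (C k) - measure lborel (C (Suc k)))"
  proof -
    have "((1/2::real) ^ Suc k) ^ n = (1/2) ^ n * ((1/2) ^ k) ^ n"
      unfolding power_Suc power_mult_distrib ..
    also have "\<dots> \<le> 1/2 * ((1/2) ^ k) ^ n"
      using n power_decreasing[of 1 n "1/2::real"] by (intro mult_right_mono) auto
    finally have "2 * \<kappa> * ((1/2) ^ Suc k) ^ n \<le> \<kappa> * ((1/2) ^ k) ^ n"
      using \<kappa> by simp
    then have "\<kappa> * ((1/2) ^ k) ^ n \<le> measure lborel (C k) - measure lborel (C (Suc k))"
      unfolding mC by simp
    moreover have "1 \<le> 8 ^ k * ((1/2::real) ^ k) ^ n"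
    proof -
      note e8
      moreover have "((1/2::real) ^ k) ^ 3 \<le> ((1/2::real) ^ k) ^ n"
        using n by (intro power_decreasing) (auto simp: power_le_one)
      ultimately show ?thesis by (metis mult_left_mono zero_le_numeral zero_le_power)
    qed
    then have "\<kappa> \<le> 8 ^ k * (\<kappa> * ((1/2) ^ k) ^ n)"
      using \<kappa> mult_left_mono[of 1 "8 ^ k * ((1/2::real) ^ k) ^ n" \<kappa>] by (simp add: ac_simps)
    ultimately show ?thesis
      by (meson mult_left_mono order_trans zero_le_numeral zero_le_power)
  qed
  then have "a\<^sup>2 / 16 * \<kappa> \<le> a\<^sup>2 / 16 * (8 ^ k * (measure lborel (C k) - measure lborel (C (Suc k))))"
    by (intro mult_left_mono) auto
  also have "\<dots> = (LBINT x. (a\<^sup>2 / 16 * 8 ^ k) * (indicator (C k) x - indicator (C (Suc k)) x))"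
    using iC by simp
  also have "axis_mass a (C (Suc k)) u + \<dots> = (LBINT x. indicator (C (Suc k)) x * slab_kernel a (perp_proj u x) + (a\<^sup>2 / 16 * 8 ^ k) * (indicator (C k) x - indicator (C (Suc k)) x))"
    unfolding axis_mass_def
    by (rule Bochner_Integration.integral_add[symmetric, OF i integrable_mult_right[OF Bochner_Integration.integrable_diff[OF iC iC]]])
  also have "\<dots> \<le> axis_mass a (C k) u"
    unfolding axis_mass_def
  proof (rule integral_mono)
    show "integrable lborel (\<lambda>x. indicator (C (Suc k)) x * slab_kernel a (perp_proj u x) + (a\<^sup>2 / 16 * 8 ^ k) * (indicator (C k) x - indicator (C (Suc k)) x))"
      by (rule Bochner_Integration.integrable_add[OF i integrable_mult_right[OF Bochner_Integration.integrable_diff[OF iC iC]]])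
    show "integrable lborel (\<lambda>x. indicator (C k) x * slab_kernel a (perp_proj u x))" by (rule i)
    fix x
    consider "x \<in> C (Suc k)" | "x \<notin> C k" | "x \<in> C k" "x \<notin> C (Suc k)" by auto
    then show "indicator (C (Suc k)) x * slab_kernel a (perp_proj u x) + (a\<^sup>2 / 16 * 8 ^ k) * (indicator (C k) x - indicator (C (Suc k)) x)
        \<le> indicator (C k) x * slab_kernel a (perp_proj u x)"
    proof cases
      case 2
      then have "x \<notin> C (Suc k)" using sub by blast
      then show ?thesis using 2 by simp
    next
      case 1
      then have "x \<in> C k" using sub by blast
      then show ?thesis using 1 by simp
    next
      case 3
      then have h: "norm (perp_proj u x) \<le> (1/2) ^ k" "(1/2) ^ Suc k < norm (perp_proj u x)"
        by (auto simp: C_def cylinder_def)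
      have "8 ^ k * norm (perp_proj u x) ^ 3 \<le> 8 ^ k * ((1/2) ^ k) ^ 3"
        using h by (intro mult_left_mono power_mono) auto
      also note e8
      finally have "8 ^ k * norm (perp_proj u x) ^ 3 \<le> 1" .
      moreover have "0 < norm (perp_proj u x)" using h(2) by (rule less_trans[rotated]) simp
      ultimately have "8 ^ k \<le> 1 / norm (perp_proj u x) ^ 3" by (simp add: field_simps)
      then have "a\<^sup>2 / 16 * 8 ^ k \<le> a\<^sup>2 / 16 * (1 / norm (perp_proj u x) ^ 3)"
        by (intro mult_left_mono) auto
      also have "\<dots> \<le> slab_kernel a (perp_proj u x)"
        using slab_kernel_ge[of a "perp_proj u x"] a h by simp
      finally show ?thesis using 3 by simp
    qed
  qed
  finally show ?thesis by (simp add: C_def \<kappa>_def)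
qed

text \<open>
  The normalizing constant, by rotation invariance the same for all axes; an arbitrary basis vector
  represents them.
\<close>

definition unit_axis_mass :: "'a::euclidean_space itself \<Rightarrow> real \<Rightarrow> real" where
  "unit_axis_mass _ a = axis_mass a (cylinder (SOME b. b \<in> Basis) 1 1) (SOME b. b \<in> (Basis :: 'a set))"

lemma unit_axis_mass_eq:
  fixes u :: "'a::euclidean_space"
  assumes u: "norm u = 1"
  shows "axis_mass a (cylinder u 1 1) u = unit_axis_mass TYPE('a) a"
  unfolding unit_axis_mass_def using u by (intro axis_mass_cylinder_rotate) (auto simp: some_in_eq)

text \<open>
  For \<open>a \<le> 2\<^sup>-\<^sup>N\<close> there are \<open>N\<close> dyadic shells at distance at least \<open>a\<close> from the axis.
\<close>

lemma unit_axis_mass_ge: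
  assumes dim: "2 \<le> DIM('a::euclidean_space)" "DIM('a) \<le> 4" and a: "0 < a" "a \<le> (1/2) ^ N"
  shows "real N * (a\<^sup>2 / 16 * unit_ball_vol (real (DIM('a) - 1))) \<le> unit_axis_mass TYPE('a) a"
proof -
  define u where "u = (SOME b. b \<in> (Basis :: 'a set))"
  have u: "norm u = 1" unfolding u_def by (auto simp: some_in_eq)
  define q where "q = a\<^sup>2 / 16 * unit_ball_vol (real (DIM('a) - 1))"
  have "real k * q + axis_mass a (cylinder u 1 ((1/2) ^ k)) u \<le> axis_mass a (cylinder u 1 1) u" if "k \<le> N" for k
    using that
  proof (induction k)
    case (Suc k)
    have "(1/2::real) ^ N \<le> (1/2) ^ Suc k" using Suc.prems by (intro power_decreasing) auto
    then have "a \<le> (1/2) ^ Suc k" using a by linarith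
    from axis_mass_shell[OF u a(1) this dim]
    have "axis_mass a (cylinder u 1 ((1/2) ^ Suc k)) u + q \<le> axis_mass a (cylinder u 1 ((1/2) ^ k)) u"
      by (simp only: q_def)
    moreover have "real k * q + axis_mass a (cylinder u 1 ((1/2) ^ k)) u \<le> axis_mass a (cylinder u 1 1) u"
      using Suc by simp
    ultimately show ?case unfolding of_nat_Suc distrib_right by linarith
  qed simp
  from this[of N] have "real N * q + axis_mass a (cylinder u 1 ((1/2) ^ N)) u \<le> axis_mass a (cylinder u 1 1) u"
    by simp
  moreover have "0 \<le> axis_mass a (cylinder u 1 ((1/2) ^ N)) u"
    unfolding axis_mass_def by (intro integral_nonneg_AE AE_I2 mult_nonneg_nonneg slab_kernel_nonneg a) simp
  ultimately show ?thesis unfolding unit_axis_mass_eq[OF u] q_def by linarith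
qed

text \<open>
  The mass near the axis outgrows \<open>a\<^sup>2\<close>, the order of the mass far from the axis.
\<close>

lemma unit_axis_mass_tendsto:
  assumes dim: "2 \<le> DIM('a::euclidean_space)" "DIM('a) \<le> 4"
  shows "(\<lambda>j. (1 / real (Suc j))\<^sup>2 / unit_axis_mass TYPE('a) (1 / real (Suc j))) \<longlonglongrightarrow> 0"
    and "\<forall>\<^sub>F j in sequentially. 0 < unit_axis_mass TYPE('a) (1 / real (Suc j))"
proof -
  define \<kappa> where "\<kappa> = unit_ball_vol (real (DIM('a) - 1))"
  have \<kappa>: "0 < \<kappa>" by (simp add: \<kappa>_def)
  let ?m = "unit_axis_mass TYPE('a)"
  have z: "(\<lambda>k. 1 / real (Suc k)) \<longlonglongrightarrow> 0" using LIMSEQ_inverse_real_of_nat by (simp add: inverse_eq_divide)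
  have ev: "\<forall>\<^sub>F j in sequentially. real N * ((1 / real (Suc j))\<^sup>2 / 16 * \<kappa>) \<le> ?m (1 / real (Suc j))" for N
  proof -
    have "\<forall>\<^sub>F j in sequentially. 1 / real (Suc j) < (1/2) ^ N"
      using z by (rule order_tendstoD) simp
    then show ?thesis
    proof eventually_elim
      fix j assume "1 / real (Suc j) < (1/2) ^ N"
      then show "real N * ((1 / real (Suc j))\<^sup>2 / 16 * \<kappa>) \<le> ?m (1 / real (Suc j))"
        unfolding \<kappa>_def by (intro unit_axis_mass_ge[OF dim] less_imp_le) simp_all
    qed
  qed
  show pos: "\<forall>\<^sub>F j in sequentially. 0 < ?m (1 / real (Suc j))"
    using ev[of 1]
  proof eventually_elim
    fix j assume "real 1 * ((1 / real (Suc j))\<^sup>2 / 16 * \<kappa>) \<le> ?m (1 / real (Suc j))"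
    moreover have "0 < real 1 * ((1 / real (Suc j))\<^sup>2 / 16 * \<kappa>)" using \<kappa> by simp
    ultimately show "0 < ?m (1 / real (Suc j))" by linarith
  qed
  show "(\<lambda>j. (1 / real (Suc j))\<^sup>2 / ?m (1 / real (Suc j))) \<longlonglongrightarrow> 0"
  proof (rule tendstoI)
    fix e :: real assume e: "0 < e"
    \<comment> \<open>So many shells push the quotient below \<open>e\<close>.\<close>
    obtain N where N: "16 / (\<kappa> * e) < real N" using reals_Archimedean2 by blast
    show "\<forall>\<^sub>F j in sequentially. dist ((1 / real (Suc j))\<^sup>2 / ?m (1 / real (Suc j))) 0 < e"
      using ev[of N] pos
    proof eventually_elim
      fix j assume 1: "real N * ((1 / real (Suc j))\<^sup>2 / 16 * \<kappa>) \<le> ?m (1 / real (Suc j))" and 2: "0 < ?m (1 / real (Suc j))"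
      define q where "q = (1 / real (Suc j))\<^sup>2"
      have q: "0 < q" by (simp add: q_def)
      have "16 < real N * \<kappa> * e" using N \<kappa> e by (simp add: field_simps)
      then have "q * 16 < q * (real N * \<kappa> * e)" using q by (rule mult_strict_left_mono)
      also have "\<dots> = (real N * (q / 16 * \<kappa>)) * (16 * e)" by simp
      also have "\<dots> \<le> ?m (1 / real (Suc j)) * (16 * e)"
        using 1 e unfolding q_def by (intro mult_right_mono) auto
      finally have "q < e * ?m (1 / real (Suc j))" by (simp add: mult.commute)
      then show "dist (q / ?m (1 / real (Suc j))) 0 < e"
        using 2 q by (simp add: divide_less_eq abs_of_pos)
    qed
  qed
qed

section \<open>The radial function of a symmetric convex body\<close>

text \<open>
  At \<open>y = 0\<close> the set is unbounded and its supremum meaningless; the value \<open>0\<close> keeps \<open>radial_scale\<close> true there and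
  makes \<open>{radial K \<ge> 1}\<close> equal to \<open>K - {0}\<close>.
\<close>

definition radial :: "'a::euclidean_space set \<Rightarrow> 'a \<Rightarrow> real" where
  "radial K y = (if y = 0 then 0 else Sup {s. s *\<^sub>R y \<in> K})"

lemma le_radial_iff:
  assumes K: "convex_body K" and y: "y \<noteq> 0" and s: "0 \<le> s"
  shows "s \<le> radial K y \<longleftrightarrow> s *\<^sub>R y \<in> K"
proof -
  define S where "S = {s. s *\<^sub>R y \<in> K}"
  have cK: "compact K" "convex K" and 0: "0 \<in> K"
    using K interior_subset by (auto simp: convex_body_def)
  have "0 \<in> S" using 0 by (simp add: S_def)
  obtain R where R: "\<And>x. x \<in> K \<Longrightarrow> norm x \<le> R"
    using compact_imp_bounded[OF cK(1)] unfolding bounded_iff by auto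
  have bdd: "bdd_above S"
  proof (rule bdd_aboveI)
    fix s assume "s \<in> S"
    then have "\<bar>s\<bar> * norm y \<le> R" using R[of "s *\<^sub>R y"] by (simp add: S_def)
    then have "\<bar>s\<bar> \<le> R / norm y" using y by (simp add: field_simps)
    then show "s \<le> R / norm y" by linarith
  qed
  have "closed S"
  proof -
    have "S = (\<lambda>s. s *\<^sub>R y) -` K" by (auto simp: S_def)
    then show ?thesis
      using compact_imp_closed[OF cK(1)] by (auto intro!: closed_vimage continuous_intros)
  qed
  then have "Sup S \<in> S"
    using \<open>0 \<in> S\<close> bdd by (intro closed_contains_Sup) auto
  moreover have "0 \<le> Sup S" using \<open>0 \<in> S\<close> bdd by (rule cSup_upper)
  have rad: "radial K y = Sup S" using y by (simp add: radial_def S_def)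
  show ?thesis
  proof
    assume "s \<le> radial K y"
    then have le: "s \<le> Sup S" by (simp add: rad)
    show "s *\<^sub>R y \<in> K"
    proof (cases "s = 0")
      case False
      then have p: "0 < Sup S" using le s by linarith
      have "(s / Sup S) *\<^sub>R (Sup S *\<^sub>R y) + (1 - s / Sup S) *\<^sub>R 0 \<in> K"
        using \<open>Sup S \<in> S\<close> 0 le s p by (intro convexD[OF cK(2)]) (auto simp: S_def)
      then show ?thesis using p by simp
    qed (simp add: 0)
  next
    assume "s *\<^sub>R y \<in> K"
    then have "s \<in> S" by (simp add: S_def)
    then show "s \<le> radial K y" unfolding rad using bdd by (rule cSup_upper)
  qed
qed

lemma radial_nonneg: "convex_body K \<Longrightarrow> 0 \<le> radial K y"
proof (cases "y = 0")
  case False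
  assume K: "convex_body K"
  then have "0 \<in> K" using interior_subset by (auto simp: convex_body_def)
  then show ?thesis using le_radial_iff[OF K False, of 0] by simp
qed (simp add: radial_def)

lemma radial_pos:
  assumes K: "convex_body K" and y: "y \<noteq> 0"
  shows "0 < radial K y"
proof -
  obtain e where e: "0 < e" "ball 0 e \<subseteq> K" using K unfolding convex_body_def mem_interior by auto
  have "(e / (2 * norm y)) *\<^sub>R y \<in> ball 0 e" using e y by (simp add: dist_norm)
  then have "e / (2 * norm y) \<le> radial K y"
    using le_radial_iff[OF K y, of "e / (2 * norm y)"] e by auto
  moreover have "0 < e / (2 * norm y)" using e y by simp
  ultimately show ?thesis by linarith
qed

lemma radial_scale:
  assumes K: "convex_body K" and t: "0 < t"
  shows "radial K (t *\<^sub>R y) = radial K y / t"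
proof (cases "y = 0")
  case False
  then have ty: "t *\<^sub>R y \<noteq> 0" using t by simp
  have iff: "s \<le> radial K (t *\<^sub>R y) \<longleftrightarrow> s \<le> radial K y / t" if "0 \<le> s" for s
    using le_radial_iff[OF K ty that] le_radial_iff[OF K False, of "s * t"] that t
    by (simp add: pos_le_divide_eq)
  show ?thesis
    using iff[of "radial K (t *\<^sub>R y)"] iff[of "radial K y / t"] radial_nonneg[OF K, of "t *\<^sub>R y"] radial_nonneg[OF K, of y] t
    by (intro order_antisym) auto
qed (simp add: radial_def)

lemma radial_sgn:
  assumes K: "convex_body K" and y: "y \<noteq> 0"
  shows "radial K (sgn y) / norm y = radial K y"
  using radial_scale[OF K, of "inverse (norm y)" y] y by (simp add: sgn_div_norm divide_inverse)

lemma one_le_radial_iff: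
  assumes K: "convex_body K"
  shows "1 \<le> radial K y \<longleftrightarrow> y \<in> K - {0}"
  using le_radial_iff[OF K, of y 1] by (cases "y = 0") (auto simp: radial_def)

lemma radial_measurable:
  assumes K: "convex_body K"
  shows "radial K \<in> borel_measurable borel"
  unfolding borel_measurable_iff_ge
proof
  have [measurable]: "K \<in> sets borel" by (rule convex_body_measurable[OF K])
  fix a :: real
  have "{w. a \<le> radial K w} = (if a \<le> 0 then UNIV else {w. a *\<^sub>R w \<in> K} - {0})"
  proof (cases "a \<le> 0")
    case True
    then show ?thesis using radial_nonneg[OF K] by (auto intro: order_trans)
  next
    case False
    have "a \<le> radial K w \<longleftrightarrow> a *\<^sub>R w \<in> K \<and> w \<noteq> 0" for w
      using False le_radial_iff[OF K, of w a] by (cases "w = 0") (auto simp: radial_def)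
    then show ?thesis using False by auto
  qed
  moreover have "{w. a *\<^sub>R w \<in> K} \<in> sets borel" by measurable
  ultimately show "{w \<in> space borel. a \<le> radial K w} \<in> sets borel" by simp
qed

lemma radial_le:
  assumes K: "convex_body K" and R: "\<And>x. x \<in> K \<Longrightarrow> norm x \<le> R"
  shows "radial K y \<le> R / norm y"
proof (cases "y = 0")
  case False
  have "radial K y *\<^sub>R y \<in> K"
    using le_radial_iff[OF K False radial_nonneg[OF K, of y]] by simp
  then have "radial K y * norm y \<le> R" using R radial_nonneg[OF K, of y] by fastforce
  then show ?thesis using False by (simp add: field_simps)
qed (simp add: radial_def)

text \<open>
  A point near the axis with \<open>|x \<bullet> u| \<le> c\<close> is a convex combination of points of the same distance from the axis
  near \<open>c u\<close> and near \<open>-c u\<close>, both interior to \<open>K\<close>.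
\<close>

lemma thin_cylinder_in_body:
  fixes K :: "'a::euclidean_space set"
  assumes K: "convex_body K" and sym: "origin_symmetric K" and u: "norm u = 1" and c: "0 < c" "c < radial K u"
  obtains \<delta> where "0 < \<delta>" "\<And>x. \<bar>x \<bullet> u\<bar> \<le> c \<Longrightarrow> norm (perp_proj u x) < \<delta> \<Longrightarrow> x \<in> K"
proof -
  have cK: "convex K" "0 \<in> interior K" using K by (auto simp: convex_body_def)
  have u0: "u \<noteq> 0" using u by auto
  have neg: "- x \<in> K" if "x \<in> K" for x
    using sym that unfolding origin_symmetric_def by (metis imageI)
  define r where "r = radial K u"
  have r: "c < r" using c by (simp add: r_def)
  have "r *\<^sub>R u \<in> K" using le_radial_iff[OF K u0, of r] c r by (simp add: r_def)
  then have "r *\<^sub>R u - (1 - c / r) *\<^sub>R (r *\<^sub>R u - 0) \<in> interior K"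
    using c r by (intro mem_interior_convex_shrink[OF cK]) auto
  also have "r *\<^sub>R u - (1 - c / r) *\<^sub>R (r *\<^sub>R u - 0) = c *\<^sub>R u"
  proof -
    have "(1 - c / r) * r = r - c" using c r by (simp add: left_diff_distrib)
    then show ?thesis by (simp add: scaleR_diff_left)
  qed
  finally obtain e where e: "0 < e" "ball (c *\<^sub>R u) e \<subseteq> K" unfolding mem_interior by auto
  show thesis
  proof
    show "0 < e" by (rule e)
    fix x assume x: "\<bar>x \<bullet> u\<bar> \<le> c" "norm (perp_proj u x) < e"
    define w where "w = perp_proj u x"
    define l where "l = ((x \<bullet> u) / c + 1) / 2"
    have "- 1 \<le> (x \<bullet> u) / c" "(x \<bullet> u) / c \<le> 1"
      using x(1) c(1) by (auto simp: pos_le_divide_eq pos_divide_le_eq abs_le_iff)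
    then have l: "0 \<le> l" "l \<le> 1" by (auto simp: l_def)
    have "c *\<^sub>R u + w \<in> K" using x by (intro subsetD[OF e(2)]) (auto simp: dist_norm w_def)
    moreover have "c *\<^sub>R u - w \<in> K" using x by (intro subsetD[OF e(2)]) (auto simp: dist_norm w_def)
    then have "- (c *\<^sub>R u) + w \<in> K" using neg by fastforce
    ultimately have "l *\<^sub>R (c *\<^sub>R u + w) + (1 - l) *\<^sub>R (- (c *\<^sub>R u) + w) \<in> K"
      using l by (intro convexD[OF cK(1)]) auto
    also have "l *\<^sub>R (c *\<^sub>R u + w) + (1 - l) *\<^sub>R (- (c *\<^sub>R u) + w) = (l * c - (1 - l) * c) *\<^sub>R u + (l + (1 - l)) *\<^sub>R w"
      by (simp only: scaleR_add_right scaleR_add_left scaleR_diff_left scaleR_minus_right scaleR_scaleR add.assoc diff_conv_add_uminus)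
         (simp only: ac_simps scaleR_minus_left)
    also have "l * c - (1 - l) * c = x \<bullet> u" using c by (simp add: l_def field_simps)
    also have "(x \<bullet> u) *\<^sub>R u + (l + (1 - l)) *\<^sub>R w = x" by (simp add: w_def perp_proj_def)
    finally show "x \<in> K" .
  qed
qed

text \<open>
  The part of \<open>K\<close> with \<open>|x \<bullet> u| \<ge> c\<close> is compact and misses the axis, so it has positive distance from it.
\<close>

lemma body_in_thin_cylinder:
  fixes K :: "'a::euclidean_space set"
  assumes K: "convex_body K" and sym: "origin_symmetric K" and u: "norm u = 1" and c: "radial K u < c"
  obtains \<delta> where "0 < \<delta>" "\<delta> \<le> 1" "\<And>x. x \<in> K \<Longrightarrow> norm (perp_proj u x) < \<delta> \<Longrightarrow> \<bar>x \<bullet> u\<bar> \<le> c"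
proof -
  have u0: "u \<noteq> 0" using u by auto
  have uu: "u \<bullet> u = 1" using u by (simp add: dot_square_norm)
  define E where "E = K \<inter> {x. c \<le> \<bar>x \<bullet> u\<bar>}"
  have "closed {x. c \<le> \<bar>x \<bullet> u\<bar>}" by (intro closed_Collect_le continuous_intros)
  then have cE: "compact E" unfolding E_def using K by (intro compact_Int_closed) (auto simp: convex_body_def)
  show thesis
  proof (cases "E = {}")
    case True
    then show thesis using that[of 1] by (force simp: E_def)
  next
    case False
    have "continuous_on E (\<lambda>x. norm (perp_proj u x))" unfolding perp_proj_def by (intro continuous_intros)
    then obtain z where z: "z \<in> E" "\<And>x. x \<in> E \<Longrightarrow> norm (perp_proj u z) \<le> norm (perp_proj u x)"
      using continuous_attains_inf[OF cE False] by metis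
    have pos: "0 < norm (perp_proj u z)"
    proof (rule ccontr)
      assume "\<not> 0 < norm (perp_proj u z)"
      then have eq: "z = (z \<bullet> u) *\<^sub>R u" by (simp add: perp_proj_def)
      have "\<bar>z \<bullet> u\<bar> *\<^sub>R u \<in> K"
      proof (cases "0 \<le> z \<bullet> u")
        case True
        then show ?thesis using eq z(1) by (simp add: E_def)
      next
        case False
        have "- z \<in> K" using z(1) sym unfolding E_def origin_symmetric_def by (metis IntD1 imageI)
        moreover have "- z = \<bar>z \<bullet> u\<bar> *\<^sub>R u" by (subst eq) (use False in simp)
        ultimately show ?thesis by simp
      qed
      then have "\<bar>z \<bullet> u\<bar> \<le> radial K u" using le_radial_iff[OF K u0, of "\<bar>z \<bullet> u\<bar>"] by simp
      then show False using z(1) c by (simp add: E_def)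
    qed
    show thesis
    proof
      show "0 < min (norm (perp_proj u z)) 1" "min (norm (perp_proj u z)) 1 \<le> 1" using pos by auto
      fix x assume x: "x \<in> K" "norm (perp_proj u x) < min (norm (perp_proj u z)) 1"
      then have "x \<notin> E" using z(2)[of x] by auto
      then show "\<bar>x \<bullet> u\<bar> \<le> c" using x(1) by (simp add: E_def)
    qed
  qed
qed

text \<open>
  Points of \<open>A\<close> near the axis are accounted for by \<open>B\<close>, and at the others the kernel is at most \<open>a\<^sup>2/(2 \<delta>\<^sup>3)\<close>.
\<close>

lemma axis_mass_compare:
  fixes A B :: "'a::euclidean_space set"
  assumes A: "integrable lborel (indicator A :: 'a \<Rightarrow> real)" "A \<in> sets borel"
    and B: "integrable lborel (indicator B :: 'a \<Rightarrow> real)" "B \<in> sets borel"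
    and a: "0 < a" and \<delta>: "0 < \<delta>" "\<And>x. x \<in> A \<Longrightarrow> norm (perp_proj u x) < \<delta> \<Longrightarrow> x \<in> B"
  shows "axis_mass a A u \<le> axis_mass a B u + a\<^sup>2 / (2 * \<delta> ^ 3) * measure lborel A"
proof -
  note iA = axis_mass_eq(2)[OF A a, of u] and iB = axis_mass_eq(2)[OF B a, of u]
  have "axis_mass a A u \<le> (LBINT x. indicator B x * slab_kernel a (perp_proj u x) + a\<^sup>2 / (2 * \<delta> ^ 3) * indicator A x)"
    unfolding axis_mass_def
  proof (rule integral_mono[OF iA Bochner_Integration.integrable_add[OF iB integrable_mult_right[OF A(1)]]])
    fix x
    have g0: "0 \<le> slab_kernel a (perp_proj u x)" by (rule slab_kernel_nonneg[OF a])
    show "indicator A x * slab_kernel a (perp_proj u x) \<le> indicator B x * slab_kernel a (perp_proj u x) + a\<^sup>2 / (2 * \<delta> ^ 3) * indicator A x"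
    proof (cases "x \<in> A \<and> \<delta> \<le> norm (perp_proj u x)")
      case True
      then have "slab_kernel a (perp_proj u x) \<le> a\<^sup>2 / (2 * \<delta> ^ 3)" using slab_kernel_le[OF a \<delta>(1), of "perp_proj u x"] by simp
      then show ?thesis using True g0 by (simp add: add_increasing)
    next
      case False
      then have "x \<in> A \<Longrightarrow> x \<in> B" using \<delta> by auto
      moreover have "0 \<le> a\<^sup>2 / (2 * \<delta> ^ 3)" using \<delta> by simp
      ultimately show ?thesis using g0 by (auto simp: indicator_def)
    qed
  qed
  also have "\<dots> = axis_mass a B u + a\<^sup>2 / (2 * \<delta> ^ 3) * measure lborel A"
    by (subst Bochner_Integration.integral_add[OF iB integrable_mult_right[OF A(1)]]) (simp add: axis_mass_def)
  finally show ?thesis .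
qed

lemma axis_mass_cylinder_eq:
  fixes u :: "'a::euclidean_space"
  assumes u: "norm u = 1" and c: "0 < c"
  shows "axis_mass a (cylinder u c 1) u = c * unit_axis_mass TYPE('a) a"
  by (simp add: axis_mass_cylinder_scale[OF u c] unit_axis_mass_eq[OF u])

lemma axis_mass_upper:
  fixes K :: "'a::euclidean_space set"
  assumes K: "convex_body K" and u: "norm u = 1" and a: "0 < a" and c: "0 < c"
    and \<delta>: "0 < \<delta>" "\<delta> \<le> 1" "\<And>x. x \<in> K \<Longrightarrow> norm (perp_proj u x) < \<delta> \<Longrightarrow> \<bar>x \<bullet> u\<bar> \<le> c"
  shows "axis_mass a K u \<le> c * unit_axis_mass TYPE('a) a + a\<^sup>2 / (2 * \<delta> ^ 3) * measure lborel K"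
  unfolding axis_mass_cylinder_eq[OF u c, symmetric]
proof (rule axis_mass_compare)
  show "x \<in> cylinder u c 1" if "x \<in> K" "norm (perp_proj u x) < \<delta>" for x
    using \<delta>(2) \<delta>(3)[OF that] that(2) by (simp add: cylinder_def)
qed (use K u a \<delta>(1) in \<open>simp_all add: integrable_cylinder convex_body_measurable admissible_integrable admissible_indicator\<close>)

lemma axis_mass_lower:
  fixes K :: "'a::euclidean_space set"
  assumes K: "convex_body K" and u: "norm u = 1" and a: "0 < a" and c: "0 < c"
    and \<delta>: "0 < \<delta>" "\<And>x. \<bar>x \<bullet> u\<bar> \<le> c \<Longrightarrow> norm (perp_proj u x) < \<delta> \<Longrightarrow> x \<in> K"
  shows "c * unit_axis_mass TYPE('a) a \<le> axis_mass a K u + a\<^sup>2 / (2 * \<delta> ^ 3) * measure lborel (cylinder u c 1)"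
  unfolding axis_mass_cylinder_eq[OF u c, symmetric]
proof (rule axis_mass_compare)
  show "x \<in> K" if "x \<in> cylinder u c 1" "norm (perp_proj u x) < \<delta>" for x
    using \<delta>(2)[OF _ that(2)] that(1) by (simp add: cylinder_def)
qed (use K u a \<delta>(1) in \<open>simp_all add: integrable_cylinder convex_body_measurable admissible_integrable admissible_indicator\<close>)

text \<open>
  For every \<open>c\<close> below and every \<open>c\<close> above the radial function, \<open>K\<close> contains, or is contained in, the cylinder of
  half-length \<open>c\<close> within some distance \<open>\<delta>\<close> of the axis; the remainder has mass \<open>O(a\<^sup>2)\<close>, which is negligible against the
  normalizing constant.
\<close>

lemma axis_mass_tendsto_radial:
  fixes K :: "'a::euclidean_space set"
  assumes K: "convex_body K" and sym: "origin_symmetric K" and u: "norm u = 1"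
    and dim: "2 \<le> DIM('a)" "DIM('a) \<le> 4"
  shows "(\<lambda>j. axis_mass (1 / real (Suc j)) K u / unit_axis_mass TYPE('a) (1 / real (Suc j))) \<longlonglongrightarrow> radial K u"
proof -
  let ?m = "unit_axis_mass TYPE('a)"
  note q = unit_axis_mass_tendsto(1)[OF dim] and pos = unit_axis_mass_tendsto(2)[OF dim]
  have u0: "u \<noteq> 0" using u by auto
  have r: "0 < radial K u" by (rule radial_pos[OF K u0])
  show ?thesis
  proof (rule order_tendstoI)
    fix l assume l: "l < radial K u"
    \<comment> \<open>The maximum with \<open>0\<close> keeps \<open>c\<close> positive, as the half-length of a cylinder must be.\<close>
    define c where "c = (max l 0 + radial K u) / 2"
    have c: "0 < c" "l < c" "c < radial K u" using l r by (auto simp: c_def)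
    obtain \<delta> where \<delta>: "0 < \<delta>" "\<And>x. \<bar>x \<bullet> u\<bar> \<le> c \<Longrightarrow> norm (perp_proj u x) < \<delta> \<Longrightarrow> x \<in> K"
      using thin_cylinder_in_body[OF K sym u c(1,3)] by metis
    define T where "T = measure lborel (cylinder u c 1) / (2 * \<delta> ^ 3)"
    have "(\<lambda>j. c - (1 / real (Suc j))\<^sup>2 / ?m (1 / real (Suc j)) * T) \<longlonglongrightarrow> c - 0 * T"
      by (intro tendsto_intros q)
    then have "\<forall>\<^sub>F j in sequentially. l < c - (1 / real (Suc j))\<^sup>2 / ?m (1 / real (Suc j)) * T"
      using c by (intro order_tendstoD) auto
    then show "\<forall>\<^sub>F j in sequentially. l < axis_mass (1 / real (Suc j)) K u / ?m (1 / real (Suc j))"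
      using pos
    proof eventually_elim
      fix j assume 1: "l < c - (1 / real (Suc j))\<^sup>2 / ?m (1 / real (Suc j)) * T" and 2: "0 < ?m (1 / real (Suc j))"
      define a where "a = 1 / real (Suc j)"
      have a: "0 < a" by (simp add: a_def)
      have m: "0 < ?m a" using 2 by (simp only: a_def)
      have "c * ?m a \<le> axis_mass a K u + a\<^sup>2 * T"
        using axis_mass_lower[OF K u a c(1) \<delta>] by (simp add: T_def)
      then have "(c * ?m a - a\<^sup>2 * T) / ?m a \<le> axis_mass a K u / ?m a"
        using m by (intro divide_right_mono) auto
      then have "c - a\<^sup>2 / ?m a * T \<le> axis_mass a K u / ?m a"
        using m by (simp add: diff_divide_distrib)
      then show "l < axis_mass a K u / ?m a" using 1 unfolding a_def by linarith
    qed
  next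
    fix l assume l: "radial K u < l"
    define c where "c = (l + radial K u) / 2"
    have c: "0 < c" "c < l" "radial K u < c" using l r by (auto simp: c_def)
    obtain \<delta> where \<delta>: "0 < \<delta>" "\<delta> \<le> 1" "\<And>x. x \<in> K \<Longrightarrow> norm (perp_proj u x) < \<delta> \<Longrightarrow> \<bar>x \<bullet> u\<bar> \<le> c"
      using body_in_thin_cylinder[OF K sym u c(3)] by metis
    define T where "T = measure lborel K / (2 * \<delta> ^ 3)"
    have "(\<lambda>j. c + (1 / real (Suc j))\<^sup>2 / ?m (1 / real (Suc j)) * T) \<longlonglongrightarrow> c + 0 * T"
      by (intro tendsto_intros q)
    then have "\<forall>\<^sub>F j in sequentially. c + (1 / real (Suc j))\<^sup>2 / ?m (1 / real (Suc j)) * T < l"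
      using c by (intro order_tendstoD) auto
    then show "\<forall>\<^sub>F j in sequentially. axis_mass (1 / real (Suc j)) K u / ?m (1 / real (Suc j)) < l"
      using pos
    proof eventually_elim
      fix j assume 1: "c + (1 / real (Suc j))\<^sup>2 / ?m (1 / real (Suc j)) * T < l" and 2: "0 < ?m (1 / real (Suc j))"
      define a where "a = 1 / real (Suc j)"
      have a: "0 < a" by (simp add: a_def)
      have m: "0 < ?m a" using 2 by (simp only: a_def)
      have "axis_mass a K u \<le> c * ?m a + a\<^sup>2 * T"
        using axis_mass_upper[OF K u a c(1) \<delta>] by (simp add: T_def)
      then have "axis_mass a K u / ?m a \<le> (c * ?m a + a\<^sup>2 * T) / ?m a"
        using m by (intro divide_right_mono) auto
      then have "axis_mass a K u / ?m a \<le> c + a\<^sup>2 / ?m a * T"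
        using m by (simp add: add_divide_distrib)
      then show "axis_mass a K u / ?m a < l" using 1 unfolding a_def by linarith
    qed
  qed
qed

text \<open>
  Normalize \<open>axis_mass_inequality\<close> and let \<open>a \<longrightarrow> 0\<close>. The normalized masses are bounded uniformly in the
  direction because \<open>K\<close> lies in a ball.
\<close>

theorem radial_intersection_body:
  fixes K :: "'a::euclidean_space set"
  assumes K: "convex_body K" and sym: "origin_symmetric K"
    and dim: "2 \<le> DIM('a)" "DIM('a) \<le> 4"
    and H: "admissible H" and neg: "\<And>u. norm u = 1 \<Longrightarrow> (\<integral>w. H w \<partial>perp_lborel u) \<le> 0"
  shows "(LBINT y. H y * radial K y) \<le> 0"
proof -
  let ?m = "unit_axis_mass TYPE('a)"
  let ?a = "\<lambda>j. 1 / real (Suc j)"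
  have [measurable]: "K \<in> sets borel" by (rule convex_body_measurable[OF K])
  have [measurable]: "H \<in> borel_measurable borel" using H by (rule admissible_measurable)
  have [measurable]: "radial K \<in> borel_measurable borel" by (rule radial_measurable[OF K])
  have [measurable]: "(\<lambda>y. axis_mass a K (sgn y)) \<in> borel_measurable borel" for a
    unfolding axis_mass_def perp_proj_def by measurable
  obtain C where C: "0 \<le> C" "\<And>x. \<bar>H x\<bar> \<le> C * gauss x" using admissible_bound[OF H] by blast
  have "bounded K" using K by (auto simp: convex_body_def compact_imp_bounded)
  then obtain R where R: "0 < R" "\<And>x. x \<in> K \<Longrightarrow> norm x \<le> R" unfolding bounded_pos by auto
  define B where "B = R + measure lborel K"
  have "\<forall>\<^sub>F j in sequentially. (?a j)\<^sup>2 / ?m (?a j) < 1"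
    using unit_axis_mass_tendsto(1)[OF dim] by (rule order_tendstoD) simp
  then have "\<forall>\<^sub>F j in sequentially. 0 < ?m (?a j) \<and> (?a j)\<^sup>2 / ?m (?a j) < 1"
    using unit_axis_mass_tendsto(2)[OF dim] by eventually_elim simp
  \<comment> \<open>Shifting the sequence by \<open>N\<close> makes the bounds below hold for every member.\<close>
  then obtain N where N: "\<And>j. N \<le> j \<Longrightarrow> 0 < ?m (?a j) \<and> (?a j)\<^sup>2 / ?m (?a j) < 1"
    unfolding eventually_sequentially by auto
  have ne: "AE y in lborel. (y::'a) \<noteq> 0" by (rule AE_lborel_singleton)
  define F where "F j y = H y * (axis_mass (?a (j + N)) K (sgn y) / ?m (?a (j + N)) / norm y)" for j y
  have "(\<lambda>j. LBINT y. F j y) \<longlonglongrightarrow> (LBINT y. H y * radial K y)"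
  proof (rule integral_dominated_convergence[where w="\<lambda>y. C * B * (gauss y / norm y)"])
    show "integrable lborel (\<lambda>y::'a. C * B * (gauss y / norm y))"
      by (intro integrable_mult_right integrable_gauss_div_norm dim)
    show "AE y in lborel. (\<lambda>j. F j y) \<longlonglongrightarrow> H y * radial K y"
      using ne
    proof eventually_elim
      fix y :: 'a assume y: "y \<noteq> 0"
      then have u: "norm (sgn y) = 1" by (simp add: norm_sgn)
      have "(\<lambda>j. axis_mass (?a (j + N)) K (sgn y) / ?m (?a (j + N))) \<longlonglongrightarrow> radial K (sgn y)"
        by (rule LIMSEQ_ignore_initial_segment[OF axis_mass_tendsto_radial[OF K sym u dim]])
      then have "(\<lambda>j. F j y) \<longlonglongrightarrow> H y * (radial K (sgn y) / norm y)"
        unfolding F_def using y by (intro tendsto_intros) auto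
      then show "(\<lambda>j. F j y) \<longlonglongrightarrow> H y * radial K y" by (simp add: radial_sgn[OF K y])
    qed
    fix j
    show "AE y in lborel. norm (F j y) \<le> C * B * (gauss y / norm y)"
      using ne
    proof eventually_elim
      fix y :: 'a assume y: "y \<noteq> 0"
      then have u: "norm (sgn y) = 1" by (simp add: norm_sgn)
      define a where "a = ?a (j + N)"
      have a: "0 < a" by (simp add: a_def)
      have m: "0 < ?m a" "a\<^sup>2 / ?m a < 1" using N[of "j + N"] by (auto simp only: a_def le_add2)
      have in_cylinder: "\<bar>x \<bullet> sgn y\<bar> \<le> R" if "x \<in> K" for x
        using Cauchy_Schwarz_ineq2[of x "sgn y"] R(2)[OF that] u by simp
      have "axis_mass a K (sgn y) \<le> R * ?m a + a\<^sup>2 / (2 * 1 ^ 3) * measure lborel K"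
        by (rule axis_mass_upper[OF K u a R(1)]) (auto intro: in_cylinder)
      then have "axis_mass a K (sgn y) / ?m a \<le> (R * ?m a + a\<^sup>2 / (2 * 1 ^ 3) * measure lborel K) / ?m a"
        using m by (intro divide_right_mono) auto
      then have "axis_mass a K (sgn y) / ?m a \<le> R + a\<^sup>2 / ?m a * (measure lborel K / 2)"
        using m by (simp add: add_divide_distrib)
      also have "\<dots> \<le> R + 1 * measure lborel K"
        using m by (intro add_left_mono mult_mono) auto
      finally have ub: "axis_mass a K (sgn y) / ?m a \<le> B" by (simp add: B_def)
      have lb0: "0 \<le> axis_mass a K (sgn y)"
        unfolding axis_mass_def
        by (intro integral_nonneg_AE AE_I2 mult_nonneg_nonneg slab_kernel_nonneg[OF a]) auto
      then have lb: "0 \<le> axis_mass a K (sgn y) / ?m a" using m by simp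
      have "norm (F j y) = \<bar>H y\<bar> * (axis_mass a K (sgn y) / ?m a) / norm y"
        using lb0 m unfolding F_def a_def[symmetric] by (simp add: abs_mult)
      also have "\<dots> \<le> (C * gauss y) * B / norm y"
        using lb ub by (intro divide_right_mono mult_mono C) (auto simp: C less_imp_le)
      finally show "norm (F j y) \<le> C * B * (gauss y / norm y)" by (simp add: ac_simps)
    qed
  qed (simp_all add: F_def)
  moreover have "(LBINT y. F j y) \<le> 0" for j
  proof -
    define a where "a = ?a (j + N)"
    have a: "0 < a" by (simp add: a_def)
    have m: "0 < ?m a" using N[of "j + N"] by (auto simp only: a_def le_add2)
    have "(LBINT y. F j y) = (LBINT y. 1 / ?m a * (H y * (axis_mass a K (sgn y) / norm y)))"
      unfolding F_def a_def[symmetric] by (intro Bochner_Integration.integral_cong refl) (simp add: ac_simps)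
    also have "\<dots> = 1 / ?m a * (LBINT y. H y * (axis_mass a K (sgn y) / norm y))"
      by (rule integral_mult_right_zero)
    also have "\<dots> \<le> 0"
      using axis_mass_inequality[OF K sym a dim(1) H neg] m by (intro mult_nonneg_nonpos) auto
    finally show ?thesis .
  qed
  ultimately show ?thesis by (intro LIMSEQ_le_const2) auto
qed

section \<open>Comparing the measures of two bodies\<close>

lemma section_meas_eq:
  fixes K :: "'a::euclidean_space set"
  assumes u: "norm u = 1" and [measurable]: "K \<in> sets borel" "f \<in> borel_measurable borel"
  shows "section_meas f u K = (\<integral>w. indicator K w * f w \<partial>perp_lborel u)"
  unfolding section_meas_def perp_lborel_def[symmetric] set_lebesgue_integral_def
proof (rule integral_cong_AE)
  have [measurable]: "perp u \<in> sets borel"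
    by (intro borel_closed closed_subspace subspace_perp)
  show "(\<lambda>x. indicat_real (K \<inter> perp u) x *\<^sub>R f x) \<in> borel_measurable (perp_lborel u)" by measurable
  show "(\<lambda>x. indicat_real K x * f x) \<in> borel_measurable (perp_lborel u)" by measurable
  show "AE x in perp_lborel u. indicat_real (K \<inter> perp u) x *\<^sub>R f x = indicat_real K x * f x"
    using AE_perp_lborel_perp[OF u] by eventually_elim (simp add: indicator_def perp_def)
qed

text \<open>
  The ratio of the two sides is the \<open>n\<close>-th power of the factor that the ball with the volume of \<open>K\<close> gains over the
  constant \<open>n/(n-1)\<close>.
\<close>

lemma unit_ball_vol_power_le:
  assumes "n \<in> {2, 3, 4::nat}"
  shows "unit_ball_vol (real n) ^ (n - 1) \<le> unit_ball_vol (real (n - 1)) ^ n"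
proof -
  have pi: "3 < pi" "pi < 4" using pi_gt3 pi_less_4 by auto
  consider "n = 2" | "n = 3" | "n = 4" using assms by auto
  then show ?thesis
  proof cases
    case 1
    then show ?thesis using pi by (simp add: unit_ball_vol_2)
  next
    case 2
    have "16 / 9 * pi\<^sup>2 \<le> pi * pi\<^sup>2" using pi by (intro mult_right_mono) auto
    then show ?thesis
      using 2 by (simp add: unit_ball_vol_2 unit_ball_vol_3 power_mult_distrib power3_eq_cube power2_eq_square field_simps)
  next
    case 3
    have "pi\<^sup>2 \<le> 4\<^sup>2" using pi by (intro power_mono) auto
    then have "81 * pi\<^sup>2 \<le> 2048" by simp
    then have "81 * pi\<^sup>2 * pi ^ 4 \<le> 2048 * pi ^ 4" by (rule mult_right_mono) simp
    then have "(pi\<^sup>2 / 2) ^ 3 \<le> (4 / 3 * pi) ^ 4"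
      by (simp add: power_divide power_mult_distrib eval_nat_numeral field_simps)
    moreover have "unit_ball_vol (real n) = pi\<^sup>2 / 2" "unit_ball_vol (real (n - 1)) = 4 / 3 * pi"
      using 3 by (simp_all add: unit_ball_vol_3 eval_unit_ball_vol)
    moreover have "n - 1 = 3" "n = 4" using 3 by simp_all
    ultimately show ?thesis by metis
  qed
qed

lemma convex_body_cball: "0 < r \<Longrightarrow> convex_body (cball (0::'a::euclidean_space) r)"
  by (simp add: convex_body_def)

lemma integrable_admissible_radial:
  fixes F :: "'a::euclidean_space \<Rightarrow> real"
  assumes F: "admissible F" and K: "convex_body K" and dim: "2 \<le> DIM('a)"
  shows "integrable lborel (\<lambda>y. F y * radial K y)"
proof -
  have [measurable]: "F \<in> borel_measurable borel" "radial K \<in> borel_measurable borel"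
    using F K by (auto intro: admissible_measurable radial_measurable)
  obtain C where C: "0 \<le> C" "\<And>x. \<bar>F x\<bar> \<le> C * gauss x" using admissible_bound[OF F] by blast
  have "bounded K" using K by (auto simp: convex_body_def compact_imp_bounded)
  then obtain R where R: "0 < R" "\<And>x. x \<in> K \<Longrightarrow> norm x \<le> R" unfolding bounded_pos by auto
  show ?thesis
  proof (rule Bochner_Integration.integrable_bound[OF integrable_mult_right[OF integrable_gauss_div_norm[OF dim]]])
    show "AE y in lborel. norm (F y * radial K y) \<le> norm (C * R * (gauss y / norm y))"
    proof (rule AE_I2)
      fix y :: 'a
      have "norm (F y * radial K y) = \<bar>F y\<bar> * radial K y"
        using radial_nonneg[OF K, of y] by (simp add: abs_mult)
      also have "\<dots> \<le> (C * gauss y) * (R / norm y)"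
        using radial_nonneg[OF K, of y] by (intro mult_mono C radial_le[OF K R(2)]) (auto simp: C less_imp_le)
      also have "\<dots> = norm (C * R * (gauss y / norm y))"
        using C(1) R(1) by (simp add: abs_mult less_imp_le abs_of_pos)
      finally show "norm (F y * radial K y) \<le> norm (C * R * (gauss y / norm y))" .
    qed
  qed measurable
qed

text \<open>
  Polar coordinates would give \<open>\<integral>\<^sub>K \<rho>\<^sub>K = (n-1)\<^sup>-\<^sup>1 \<integral> \<rho>\<^sub>K\<^sup>n\<close> over the sphere; homogeneity replaces them.
\<close>

lemma integral_radial_body:
  fixes K :: "'a::euclidean_space set"
  assumes K: "convex_body K" and dim: "2 \<le> DIM('a)"
  shows "(LBINT y. indicator K y * radial K y) = real DIM('a) / (real DIM('a) - 1) * measure lborel K"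
proof -
  have [measurable]: "K \<in> sets borel" by (rule convex_body_measurable[OF K])
  have [measurable]: "radial K \<in> borel_measurable borel" by (rule radial_measurable[OF K])
  have fin: "emeasure lborel K < \<infinity>"
    using K by (intro emeasure_bounded_finite) (auto simp: convex_body_def compact_imp_bounded)
  have n: "0 \<le> real DIM('a) / (real DIM('a) - 1)" using dim by simp
  have set: "{y. 1 \<le> radial K y} = K - {0}" by (auto simp: one_le_radial_iff[OF K])
  have "(\<integral>\<^sup>+y. ennreal (indicator K y * radial K y) \<partial>lborel) = (\<integral>\<^sup>+y. ennreal (radial K y) * indicator {y. 1 \<le> radial K y} y \<partial>lborel)"
    unfolding set by (rule nn_integral_cong) (simp add: radial_def indicator_def)
  also have "\<dots> = ennreal (real DIM('a) / (real DIM('a) - 1)) * emeasure lborel {y. 1 \<le> radial K y}"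
    by (rule nn_integral_homogeneous[OF _ dim radial_scale[OF K]]) measurable
  also have "emeasure lborel {y. 1 \<le> radial K y} = emeasure lborel K"
    unfolding set by (rule emeasure_Diff_null_set) (auto simp: null_sets_def)
  also have "\<dots> = ennreal (measure lborel K)"
    using fin by (simp add: emeasure_eq_ennreal_measure)
  finally have "(\<integral>\<^sup>+y. ennreal (indicator K y * radial K y) \<partial>lborel) = ennreal (real DIM('a) / (real DIM('a) - 1) * measure lborel K)"
    by (simp only: ennreal_mult[OF n measure_nonneg])
  then show ?thesis
    using n radial_nonneg[OF K] by (intro integral_eq_nn_integral[THEN trans]) (auto simp: enn2real_ennreal)
qed

text \<open>
  One half of the absolute value. Here \<open>H\<close>, \<open>B\<close> and \<open>D\<close> are as in the introduction, and \<open>t\<close> is \<open>Vol(K)\<^sup>1\<^sup>/\<^sup>n\<close>; the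
  function \<open>\<rho>\<close> enters twice by the comparison of \<open>\<rho>\<close> with \<open>1\<close> on and off \<open>K\<close>.
\<close>

lemma body_meas_diff_le:
  fixes f :: "'a::euclidean_space \<Rightarrow> real"
  assumes dim: "2 \<le> DIM('a)" "DIM('a) \<le> 4"
    and f: "continuous_on UNIV f" "\<And>x. 0 < f x"
    and K: "convex_body K" "origin_symmetric K" and L: "convex_body L"
    and sec: "\<And>u. norm u = 1 \<Longrightarrow> section_meas f u K - section_meas f u L \<le> e" and e: "0 \<le> e"
  shows "body_meas f K - body_meas f L
    \<le> real DIM('a) / (real DIM('a) - 1) * e * measure lborel K powr (1 / real DIM('a))"
proof -
  let ?n = "DIM('a)"
  have [measurable]: "f \<in> borel_measurable borel" using f(1) by (rule borel_measurable_continuous_onI)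
  have [measurable]: "K \<in> sets borel" "L \<in> sets borel" by (intro convex_body_measurable K L)+
  define V where "V = measure lborel K"
  have V: "0 < V"
  proof -
    obtain d where d: "0 < d" "ball 0 d \<subseteq> K" using K(1) unfolding convex_body_def mem_interior by auto
    have "0 < measure lborel (ball (0::'a) d)" using d(1) by simp
    also have "\<dots> \<le> V" unfolding V_def
      using d(2) K(1) by (intro measure_mono_fmeasurable) (auto simp: convex_body_def fmeasurable_compact)
    finally show ?thesis .
  qed
  define \<kappa> \<kappa>' where "\<kappa> = unit_ball_vol (real ?n)" and "\<kappa>' = unit_ball_vol (real (?n - 1))"
  have \<kappa>: "0 < \<kappa>" "0 < \<kappa>'" by (auto simp: \<kappa>_def \<kappa>'_def)
  define t R where "t = V powr (1 / real ?n)" and "R = (V / \<kappa>) powr (1 / real ?n)"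
  have t: "0 < t" "t ^ ?n = V" and R: "0 < R" "R ^ ?n = V / \<kappa>"
    using V \<kappa> by (auto simp: t_def R_def powr_realpow[symmetric] powr_powr)
  define D where "D = \<kappa>' * R ^ (?n - 1)"
  have D: "0 < D" using \<kappa> R by (simp add: D_def)
  \<comment> \<open>The \<open>n\<close>-th power of the inequality is the comparison of ball volumes.\<close>
  have VD: "V \<le> t * D"
  proof -
    have "(t ^ (?n - 1)) ^ ?n = V ^ (?n - 1)"
      unfolding t(2)[symmetric] by (simp only: power_mult[symmetric] mult.commute)
    also have "\<dots> = \<kappa> ^ (?n - 1) * (R ^ ?n) ^ (?n - 1)"
      unfolding R(2) using \<kappa> by (simp add: power_divide)
    also have "\<dots> \<le> \<kappa>' ^ ?n * (R ^ ?n) ^ (?n - 1)"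
      unfolding \<kappa>_def \<kappa>'_def using dim R(1) by (intro mult_right_mono unit_ball_vol_power_le) auto
    also have "\<dots> = D ^ ?n"
      unfolding D_def power_mult_distrib by (simp only: power_mult[symmetric] mult.commute)
    finally have "t ^ (?n - 1) \<le> D"
      using D dim by (subst (asm) power_mono_iff) (use t in auto)
    then have "t * t ^ (?n - 1) \<le> t * D" using t by simp
    moreover have "t * t ^ (?n - 1) = V" using t(2) dim by (simp add: power_eq_if)
    ultimately show ?thesis by simp
  qed
  \<comment> \<open>\<open>R\<close> is chosen such that this ball has the volume of \<open>K\<close>; \<open>D\<close> is the volume of its central sections.\<close>
  define B where "B = cball (0::'a) R"
  have cB: "convex_body B" using R by (simp add: B_def convex_body_cball)
  have aK: "admissible (\<lambda>x. indicator K x * f x)" and aL: "admissible (\<lambda>x. indicator L x * f x)"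
    by (intro admissible_body K L f)+
  have aB: "admissible (indicator B :: 'a \<Rightarrow> real)" and aI: "admissible (indicator K :: 'a \<Rightarrow> real)"
    using cB K by (auto intro: admissible_indicator)
  define \<rho> where "\<rho> = radial K"
  have int: "integrable lborel (\<lambda>y. F y * \<rho> y)" if "admissible F" for F
    unfolding \<rho>_def by (rule integrable_admissible_radial[OF that K(1) dim(1)])
  have ne: "AE y in lborel. (y::'a) \<noteq> 0" by (rule AE_lborel_singleton)
  have rho: "1 \<le> \<rho> y \<longleftrightarrow> y \<in> K" if "y \<noteq> 0" for y
    using one_le_radial_iff[OF K(1), of y] that by (simp add: \<rho>_def)
  define H where "H x = (indicator K x * f x + (- 1) * (indicator L x * f x)) + (- (e / D)) * indicator B x" for x
  have aH: "admissible H"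
    unfolding H_def by (intro admissible_add admissible_cmult aK aL aB)
  have "(\<integral>w. H w \<partial>perp_lborel u) \<le> 0" if u: "norm u = 1" for u
  proof -
    have "(\<integral>w. indicator B w \<partial>perp_lborel u) = measure (perp_lborel u) B" by (simp add: B_def)
    also have "\<dots> = D"
      using emeasure_perp_lborel_cball[OF u R(1)] D by (simp add: measure_def B_def D_def \<kappa>'_def)
    finally have "(\<integral>w. H w \<partial>perp_lborel u) = section_meas f u K - section_meas f u L - e"
      unfolding H_def using D
      by (simp add: section_meas_eq[OF u] admissible_integrable_perp_lborel[OF _ u] aK aL aB)
    then show ?thesis using sec[OF u] by simp
  qed
  then have "(LBINT y. H y * \<rho> y) \<le> 0"
    unfolding \<rho>_def by (intro radial_intersection_body K dim aH)
  also have "(LBINT y. H y * \<rho> y) = (LBINT y. indicator K y * f y * \<rho> y)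
      - (LBINT y. indicator L y * f y * \<rho> y) - (e / D) * (LBINT y. indicator B y * \<rho> y)"
    unfolding H_def distrib_right mult.assoc[of "- _"] using int[OF aK] int[OF aL] int[OF aB]
    by (simp del: mult_minus_left)
  finally have 1: "(LBINT y. indicator K y * f y * \<rho> y) - (LBINT y. indicator L y * f y * \<rho> y)
      \<le> (e / D) * (LBINT y. indicator B y * \<rho> y)" by simp
  have "body_meas f K - body_meas f L = (LBINT y. indicator K y * f y - indicator L y * f y)"
    using admissible_integrable[OF aK] admissible_integrable[OF aL]
    by (simp add: body_meas_def set_lebesgue_integral_def)
  also have "\<dots> \<le> (LBINT y. indicator K y * f y * \<rho> y - indicator L y * f y * \<rho> y)"
  proof (rule integral_mono_AE)
    show "AE y in lborel. indicator K y * f y - indicator L y * f y \<le> indicator K y * f y * \<rho> y - indicator L y * f y * \<rho> y"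
      using ne
    proof eventually_elim
      fix y :: 'a assume "y \<noteq> 0"
      \<comment> \<open>Both factors are \<open>\<ge> 0\<close> on \<open>K\<close> and \<open>\<le> 0\<close> off \<open>K\<close>.\<close>
      from rho[OF this] have "0 \<le> (indicator K y - indicator L y) * (\<rho> y - 1)"
        by (auto simp: indicator_def)
      then have "0 \<le> f y * ((indicator K y - indicator L y) * (\<rho> y - 1))"
        by (rule mult_nonneg_nonneg[OF less_imp_le[OF f(2)]])
      then show "indicator K y * f y - indicator L y * f y \<le> indicator K y * f y * \<rho> y - indicator L y * f y * \<rho> y"
        by (simp add: algebra_simps)
    qed
  qed (intro Bochner_Integration.integrable_diff admissible_integrable aK aL int)+
  also have "\<dots> = (LBINT y. indicator K y * f y * \<rho> y) - (LBINT y. indicator L y * f y * \<rho> y)"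
    by (rule Bochner_Integration.integral_diff[OF int[OF aK] int[OF aL]])
  also note 1
  finally have diff: "body_meas f K - body_meas f L \<le> (e / D) * (LBINT y. indicator B y * \<rho> y)" .
  have "(LBINT y. indicator B y * \<rho> y) \<le> (LBINT y. indicator K y * \<rho> y + (indicator B y - indicator K y))"
  proof (rule integral_mono_AE)
    show "AE y in lborel. indicator B y * \<rho> y \<le> indicator K y * \<rho> y + (indicator B y - indicator K y)"
      using ne
    proof eventually_elim
      fix y :: 'a assume "y \<noteq> 0"
      from rho[OF this] show "indicator B y * \<rho> y \<le> indicator K y * \<rho> y + (indicator B y - indicator K y)"
        by (auto simp: indicator_def)
    qed
  qed (intro Bochner_Integration.integrable_add Bochner_Integration.integrable_diff admissible_integrable aB aI int)+
  also have "\<dots> = (LBINT y. indicator K y * \<rho> y) + (measure lborel B - V)"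
    using int[OF aI] admissible_integrable[OF aB] admissible_integrable[OF aI] by (simp add: V_def B_def)
  also have "measure lborel B = V"
    using R \<kappa> by (simp add: B_def content_cball \<kappa>_def[symmetric])
  also have "(LBINT y. indicator K y * \<rho> y) = real ?n / (real ?n - 1) * V"
    unfolding \<rho>_def V_def by (rule integral_radial_body[OF K(1) dim(1)])
  finally have "(LBINT y. indicator B y * \<rho> y) \<le> real ?n / (real ?n - 1) * V" by simp
  then have "(e / D) * (LBINT y. indicator B y * \<rho> y) \<le> (e / D) * (real ?n / (real ?n - 1) * V)"
    using e D by (intro mult_left_mono) auto
  also have "\<dots> = real ?n / (real ?n - 1) * e * (V / D)" by (simp add: ac_simps)
  also have "\<dots> \<le> real ?n / (real ?n - 1) * e * t"
    using VD D e dim by (intro mult_left_mono) (auto simp: pos_divide_le_eq)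
  finally show ?thesis using diff by (simp add: t_def V_def)
qed

theorem corollary1:
  fixes f :: "real ^ 'n \<Rightarrow> real" and K L :: "(real ^ 'n) set"
  assumes "2 \<le> CARD('n)" and "CARD('n) \<le> 4"
    and "continuous_on UNIV f" and "\<And>x. 0 < f x" and "\<And>x. f (- x) = f x"
    and "convex_body K" and "origin_symmetric K"
    and "convex_body L" and "origin_symmetric L"
  shows "(\<exists>\<xi>\<in>sphere 0 1. \<forall>\<eta>\<in>sphere 0 1. section_gap f K L \<eta> \<le> section_gap f K L \<xi>) \<and>
    \<bar>body_meas f K - body_meas f L\<bar>
      \<le> real CARD('n) / (real CARD('n) - 1) *
        (SUP \<xi>\<in>sphere 0 1. section_gap f K L \<xi>) *
        max (measure lborel K powr (1 / real CARD('n)))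
            (measure lborel L powr (1 / real CARD('n)))"
proof -
  let ?S = "sphere (0::real^'n) 1"
  have [measurable]: "f \<in> borel_measurable borel" using assms(3) by (rule borel_measurable_continuous_onI)
  have [measurable]: "K \<in> sets borel" "L \<in> sets borel" by (intro convex_body_measurable assms)+
  have dim: "2 \<le> DIM(real^'n)" "DIM(real^'n) \<le> 4" using assms by auto
  have aK: "admissible (\<lambda>x. indicator K x * f x)" and aL: "admissible (\<lambda>x. indicator L x * f x)"
    by (intro admissible_body assms)+
  have "continuous_on ?S (\<lambda>u. \<bar>(\<integral>w. indicator K w * f w \<partial>perp_lborel u) - (\<integral>w. indicator L w * f w \<partial>perp_lborel u)\<bar>)"
    by (intro continuous_intros continuous_on_perp_lborel_integral aK aL)
  then have cont: "continuous_on ?S (section_gap f K L)"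
    by (rule continuous_on_eq) (simp add: section_gap_def section_meas_eq)
  have "axis undefined 1 \<in> ?S" by (simp add: norm_axis_1)
  then have "?S \<noteq> {}" by blast
  then obtain \<xi> where \<xi>: "\<xi> \<in> ?S" "\<And>\<eta>. \<eta> \<in> ?S \<Longrightarrow> section_gap f K L \<eta> \<le> section_gap f K L \<xi>"
    using continuous_attains_sup[OF compact_sphere _ cont] by metis
  define e where "e = (SUP \<xi>\<in>?S. section_gap f K L \<xi>)"
  have le: "section_gap f K L u \<le> e" if "u \<in> ?S" for u
    unfolding e_def using that \<xi> by (intro cSUP_upper bdd_aboveI2) auto
  have e: "0 \<le> e" using le[OF \<xi>(1)] by (rule order_trans[rotated]) (simp add: section_gap_def)
  define c where "c = real CARD('n) / (real CARD('n) - 1) * e"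
  have c: "0 \<le> c" using e assms(1) by (simp add: c_def)
  have KL: "body_meas f K - body_meas f L \<le> c * measure lborel K powr (1 / real CARD('n))"
    unfolding c_def
    using body_meas_diff_le[OF dim assms(3,4,6,7,8) _ e] le
    by (simp add: section_gap_def abs_le_iff)
  have LK: "body_meas f L - body_meas f K \<le> c * measure lborel L powr (1 / real CARD('n))"
    unfolding c_def
    using body_meas_diff_le[OF dim assms(3,4,8,9,6) _ e] le
    by (simp add: section_gap_def abs_le_iff)
  let ?M = "max (measure lborel K powr (1 / real CARD('n))) (measure lborel L powr (1 / real CARD('n)))"
  have "c * measure lborel K powr (1 / real CARD('n)) \<le> c * ?M" "c * measure lborel L powr (1 / real CARD('n)) \<le> c * ?M"
    using c by (auto intro!: mult_left_mono)
  then have "\<bar>body_meas f K - body_meas f L\<bar> \<le> c * ?M" using KL LK by (simp add: abs_le_iff)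
  then show ?thesis using \<xi> unfolding c_def e_def by blast
qed

end
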